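(* Let $\mathbf{G}_N$ be the $N\times N$ complex Ginibre matrix. Then $$C(W(\mathbf{G}_N),\mathbf{G}_N)\lesssim 2\qquad\text{almost surely as } N\to\infty,$$ that is, for every $\epsilon>0$, the indicator $\mathbf{1}\big[C(W(\mathbf{G}_N),\mathbf{G}_N)<2+\epsilon\big]$ converges to $1$ almost surely as $N\to\infty$.
   Context: Ginibre matrix: $\mathbf{G}_N=\frac{1}{\sqrt{2N}}(\mathbf{X}_N+\mathrm{i}\,\mathbf{Y}_N)$, where $\mathbf{X}_N,\mathbf{Y}_N$ are independent $N\times N$ matrices with i.i.d. real standard Gaussian entries. All $N$ are treated on one probability space: $\mathbf{X}_N$ and $\mathbf{Y}_N$ are the leading $N\times N$ principal blocks of fixed infinite arrays of i.i.d. standard Gaussians. Numerical range: $W(\mathbf{A})=\{\mathbf{v}^*\mathbf{A}\mathbf{v}:\|\mathbf{v}\|=1\}$ for $\mathbf{A}\in\mathbb{C}^{N\times N}$, with $\mathbf{v}\in\mathbb{C}^N$. For a set $\Omega\subset\mathbb{C}$ and a matrix $\mathbf{A}$, $$C(\Omega,\mathbf{A})=\sup\big\{\|f(\mathbf{A})\|/\|f\|_\Omega\big\},$$ where the supremum is over functions $f\not\equiv 0$ analytic on $\Omega$ and extending continuously to $\partial\Omega$, $\|f\|_\Omega=\sup_{z\in\Omega}|f(z)|$, and $\|f(\mathbf{A})\|$ is the operator 2-norm. When $\Omega$ is a compact set such as $W(\mathbf{A})$, "analytic on $\Omega$ and extending continuously to $\partial\Omega$" means continuous on $\Omega$ and analytic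 in its interior; $f(\mathbf{A})$ is given by the holomorphic functional calculus when the spectrum of $\mathbf{A}$ lies in the interior of $\Omega$, and otherwise one sets $C(\Omega,\mathbf{A})=+\infty$. *)

theory Defs
  imports
    "HOL-Probability.Probability"
    "HOL-Complex_Analysis.Complex_Analysis"
    "Jordan_Normal_Form.Spectral_Radius"
    "Jordan_Normal_Form.Gauss_Jordan_Elimination"
begin

unbundle no vec_syntax

definition cvec_norm :: "complex Matrix.vec \<Rightarrow> real" where
  "cvec_norm v = L2_set (\<lambda>i. cmod (v $ i)) {..<dim_vec v}"

definition op_norm2 :: "complex Matrix.mat \<Rightarrow> real" where
  "op_norm2 A = (SUP v \<in> {v \<in> carrier_vec (dim_col A). cvec_norm v \<le> 1}. cvec_norm (A *\<^sub>v v))"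

(* \<open>u \<bullet>c v\<close> is conjugate-linear in v, so \<open>(A *\<^sub>v v) \<bullet>c v\<close> is v* A v. *)
definition numerical_range :: "complex Matrix.mat \<Rightarrow> complex set" where
  "numerical_range A = {(A *\<^sub>v v) \<bullet>c v | v. v \<in> carrier_vec (dim_row A) \<and> cvec_norm v = 1}"

definition resolvent :: "complex Matrix.mat \<Rightarrow> complex \<Rightarrow> complex Matrix.mat" where
  "resolvent A z = the (mat_inverse (z \<cdot>\<^sub>m 1\<^sub>m (dim_row A) - A))"

(* The contour of the functional calculus is the union of the positively oriented circles of
   radius r around the eigenvalues. For admissible r these lie in U, wind once around every
   eigenvalue, and do not wind around any point outside U. *)
definition admissible_radius :: "complex set \<Rightarrow> complex Matrix.mat \<Rightarrow> real \<Rightarrow> bool" where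
  "admissible_radius U A r \<longleftrightarrow> r > 0 \<and> (\<forall>\<nu>\<in>spectrum A. cball \<nu> r \<subseteq> U) \<and>
     (\<forall>\<nu>\<in>spectrum A. \<forall>\<mu>\<in>spectrum A. \<nu> \<noteq> \<mu> \<longrightarrow> cball \<nu> r \<inter> cball \<mu> r = {})"

lemma ex_admissible_radius:
  assumes A: "A \<in> carrier_mat n n" and "open U" and sub: "spectrum A \<subseteq> U"
  shows "\<exists>r. admissible_radius U A r"
proof -
  have fin: "finite (spectrum A)"
    by (rule card_finite_spectrum(1)[OF A])
  have inside: "\<forall>\<^sub>F r in at_right 0. cball \<nu> r \<subseteq> U" if "\<nu> \<in> spectrum A" for \<nu>
  proof -
    have "\<nu> \<in> U"
      using that sub by (rule rev_subsetD)
    then obtain e where e: "e > 0" "cball \<nu> e \<subseteq> U"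
      using open_contains_cball_eq[OF \<open>open U\<close>] by blast
    show ?thesis
    proof (rule eventually_at_rightI[OF _ e(1)])
      fix r assume "r \<in> {0<..<e}"
      then have "r \<le> e"
        by simp
      then show "cball \<nu> r \<subseteq> U"
        by (rule subset_trans[OF subset_cball e(2)])
    qed
  qed
  have disj: "\<forall>\<^sub>F r in at_right 0. \<nu> \<noteq> \<mu> \<longrightarrow> cball \<nu> r \<inter> cball \<mu> r = {}" for \<nu> \<mu> :: complex
  proof (cases "\<nu> = \<mu>")
    case False
    then have pos: "0 < dist \<nu> \<mu> / 2"
      by simp
    show ?thesis
    proof (rule eventually_at_rightI[OF _ pos], rule impI, rule equals0I)
      fix r z assume r: "r \<in> {0<..<dist \<nu> \<mu> / 2}" and z: "z \<in> cball \<nu> r \<inter> cball \<mu> r"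
      have "dist \<nu> \<mu> \<le> dist \<nu> z + dist \<mu> z"
        by (rule dist_triangle2)
      then show False
        using r z by simp
    qed
  qed simp
  have "\<forall>\<^sub>F r in at_right 0. admissible_radius U A r"
    unfolding admissible_radius_def
  proof (intro eventually_conj)
    show "\<forall>\<^sub>F r in at_right (0::real). 0 < r"
      by (rule eventually_at_right_less)
    show "\<forall>\<^sub>F r in at_right 0. \<forall>\<nu>\<in>spectrum A. cball \<nu> r \<subseteq> U"
      by (rule eventually_ball_finite[OF fin]) (rule ballI, rule inside)
    show "\<forall>\<^sub>F r in at_right 0. \<forall>\<nu>\<in>spectrum A. \<forall>\<mu>\<in>spectrum A. \<nu> \<noteq> \<mu> \<longrightarrow>
        cball \<nu> r \<inter> cball \<mu> r = {}"
      by (rule eventually_ball_finite[OF fin], rule ballI,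
          rule eventually_ball_finite[OF fin], rule ballI, rule disj)
  qed
  then show ?thesis
    by (rule eventually_happens'[rotated]) (rule trivial_limit_at_right_real)
qed

(* f(A) as the contour integral of f(z) (z I - A)^(-1) over 2 pi i, entry by entry, for f
   holomorphic on an open set U containing the spectrum of A; by Cauchy's theorem its value does
   not depend on the choice of the admissible radius. *)
definition holo_calculus ::
  "complex set \<Rightarrow> (complex \<Rightarrow> complex) \<Rightarrow> complex Matrix.mat \<Rightarrow> complex Matrix.mat" where
  "holo_calculus U f A =
     (let r = (SOME r. admissible_radius U A r) in
      Matrix.mat (dim_row A) (dim_row A) (\<lambda>(i, j).
        (\<Sum>\<nu>\<in>spectrum A.
           contour_integral (circlepath \<nu> r) (\<lambda>z. f z * resolvent A z $$ (i, j)))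
        / (2 * of_real pi * \<i>)))"

(* Functions are total, so a continuous extension to the boundary is encoded by the values of f
   itself on closure \<Omega>; for compact \<Omega> the condition reads: continuous on \<Omega>, holomorphic in its
   interior. *)
definition spectral_test_functions :: "complex set \<Rightarrow> (complex \<Rightarrow> complex) set" where
  "spectral_test_functions \<Omega> = {f. continuous_on (closure \<Omega>) f \<and> f holomorphic_on interior \<Omega> \<and>
     (\<exists>z\<in>\<Omega>. f z \<noteq> 0)}"

definition spectral_constant :: "complex set \<Rightarrow> complex Matrix.mat \<Rightarrow> ennreal" where
  "spectral_constant \<Omega> A =
     (if spectrum A \<subseteq> interior \<Omega>
      then SUP f \<in> spectral_test_functions \<Omega>.
             ennreal (op_norm2 (holo_calculus (interior \<Omega>) f A)) / (SUP z\<in>\<Omega>. ennreal (cmod (f z)))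
      else \<infinity>)"

definition ginibre ::
  "(nat \<Rightarrow> nat \<Rightarrow> 'a \<Rightarrow> real) \<Rightarrow> (nat \<Rightarrow> nat \<Rightarrow> 'a \<Rightarrow> real) \<Rightarrow> nat \<Rightarrow> 'a \<Rightarrow> complex Matrix.mat" where
  "ginibre X Y N \<omega> = Matrix.mat N N (\<lambda>(i, j).
     (of_real (X i j \<omega>) + \<i> * of_real (Y i j \<omega>)) / of_real (sqrt (2 * real N)))"

end

theory Submission
  imports Defs
begin

text \<open>Gaussian integration by parts gives an exact recursion for the expected products of normalised
  traces of words in the Ginibre matrix \<open>G\<close> and its adjoint. Its leading part counts non-crossing
  pairings and the rest carries a factor \<open>1 / N\<^sup>2\<close>, hence is negligible for words of length up to
  about \<open>N powr (1 / 4)\<close>. Moments of that order show that almost surely, eventually, the powers of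
  \<open>G\<close> grow at most like \<open>(13 / 10) ^ k\<close> and all rotated self-adjoint parts
  \<open>(c G + cnj c G\<^sup>*) / 2\<close> have largest eigenvalue close to \<open>sqrt 2\<close>; so the numerical range is
  squeezed between two discs of radius close to \<open>sqrt 2\<close>.

  On a disc containing the numerical range the spectral constant is at most 2: averaging over roots
  of unity against a positive kernel bounds \<open>p(T) + p(0)\<close>, taken in a pair of unit vectors
  \<open>x\<close>, \<open>y\<close>, by 2, and if \<open>p\<close>, \<open>x\<close>, \<open>y\<close> nearly maximise the form of \<open>p(T)\<close>, then varying \<open>p\<close> by disc
  automorphisms shows that \<open>x\<close> and \<open>y\<close> are nearly orthogonal, so that the term in \<open>p(0)\<close> drops out.
  A function \<open>f\<close> bounded on the numerical range only is first dilated from the inner to the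
  outer disc, which changes \<open>f(G)\<close> little because the Taylor coefficients decay faster than
  \<open>(13 / 10) ^ k\<close> grows.\<close>

section \<open>Planar recursion for trace moments\<close>

text \<open>Whether the spectral constant of a matrix on its own numerical range is always at most 2
  is Crouzeix's conjecture. For a disc the bound 2 is available, so the proof depends on the
  numerical range of \<open>G\<close> being nearly a disc. It is, because the self-adjoint part of
  \<open>c G\<close> has the same covariance \<open>1 / (2 N)\<close> for every unit
  \<open>c\<close>, hence the same semicircular edge \<open>sqrt 2\<close> in every direction.
  Dilating is cheap because the powers of \<open>G\<close> grow more slowly than powers of
  \<open>sqrt 2\<close>: the moment method bounds the norm of the \<open>m\<close>-th power
  asymptotically by \<open>m + 1\<close>, which is polynomial in \<open>m\<close>. Upper bounds on
  norms need moments of growing order, since passing from a norm to a trace loses a factor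
  \<open>N\<close>, which only a geometric factor with large exponent absorbs. Lower bounds on the
  edge use one moment of fixed order together with a variance estimate. Both kinds of tail
  probability are \<open>O(1 / N^2)\<close>, which suits Borel-Cantelli. Quadratic forms are bounded
  by traces through repeated squaring, so the growing orders are powers of two.\<close>

fun splits :: "'l list \<Rightarrow> ('l list \<times> 'l \<times> 'l list) list" where
  "splits [] = []"
| "splits (x # u) = ([], x, u) # map (\<lambda>(a, y, b). (x # a, y, b)) (splits u)"

lemma splits_append:
  "splits (u @ v) = map (\<lambda>(a, y, b). (a, y, b @ v)) (splits u) @ map (\<lambda>(a, y, b). (u @ a, y, b)) (splits v)"
  by (induction u) (auto simp: case_prod_unfold o_def)

lemma splits_Cons_sum:
  "(\<Sum>(a, y, b)\<leftarrow>splits (x # u). F a y b) = F [] x u + (\<Sum>(a, y, b)\<leftarrow>splits u. F (x # a) y b)"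
  by (simp add: case_prod_unfold o_def)

lemma splits_append_sum:
  fixes F :: "'l list \<Rightarrow> 'l \<Rightarrow> 'l list \<Rightarrow> 'b::comm_monoid_add"
  shows "(\<Sum>(a, y, b)\<leftarrow>splits (u @ v). F a y b) =
   (\<Sum>(a, y, b)\<leftarrow>splits u. F a y (b @ v)) + (\<Sum>(a, y, b)\<leftarrow>splits v. F (u @ a) y b)"
  by (simp add: splits_append case_prod_unfold o_def)

lemma splitsD: "(a, y, b) \<in> set (splits u) \<Longrightarrow> u = a @ y # b"
  by (induction u arbitrary: a) auto

lemma length_splits [simp]: "length (splits u) = length u"
  by (induction u) auto

text \<open>Two marked letters may be chosen with the left one first or the right one first. All
  exchanges of double sums over pairs of letters below rest on this.\<close>

lemma splits_coassoc:
  fixes F :: "'l list \<Rightarrow> 'l \<Rightarrow> 'l list \<Rightarrow> 'l \<Rightarrow> 'l list \<Rightarrow> 'b::comm_monoid_add"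
  shows "(\<Sum>(a, y, c)\<leftarrow>splits u. \<Sum>(c1, z, c2)\<leftarrow>splits c. F a y c1 z c2) =
    (\<Sum>(b, z, c2)\<leftarrow>splits u. \<Sum>(a, y, c1)\<leftarrow>splits b. F a y c1 z c2)"
proof (induction u arbitrary: F)
  case (Cons x u)
  show ?case
    unfolding splits_Cons_sum Cons.IH
    by (simp add: sum_list_addf[symmetric] case_prod_unfold o_def)
qed simp

lemma sum_list_mono3:
  fixes f g :: "'a \<Rightarrow> 'b \<Rightarrow> 'c \<Rightarrow> real"
  assumes "\<And>a y b. (a, y, b) \<in> set xs \<Longrightarrow> f a y b \<le> g a y b"
  shows "(\<Sum>(a, y, b)\<leftarrow>xs. f a y b) \<le> (\<Sum>(a, y, b)\<leftarrow>xs. g a y b)"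
  using assms by (intro sum_list_mono) auto

lemma sum_list_nonneg3:
  fixes f :: "'a \<Rightarrow> 'b \<Rightarrow> 'c \<Rightarrow> real"
  assumes "\<And>a y b. (a, y, b) \<in> set xs \<Longrightarrow> 0 \<le> f a y b"
  shows "0 \<le> (\<Sum>(a, y, b)\<leftarrow>xs. f a y b)"
  using assms by (intro sum_list_nonneg) auto

lemma sum_list_cong3:
  assumes "\<And>a y b. (a, y, b) \<in> set xs \<Longrightarrow> f a y b = g a y b"
  shows "(\<Sum>(a, y, b)\<leftarrow>xs. f a y b) = (\<Sum>(a, y, b)\<leftarrow>xs. g a y b)"
  using assms by (intro arg_cong[where f=sum_list] map_cong) auto

lemma sum_list_add3:
  fixes f :: "'a \<Rightarrow> 'b \<Rightarrow> 'c \<Rightarrow> 'd::comm_monoid_add"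
  shows "(\<Sum>(a, y, b)\<leftarrow>xs. f a y b + g a y b) = (\<Sum>(a, y, b)\<leftarrow>xs. f a y b) + (\<Sum>(a, y, b)\<leftarrow>xs. g a y b)"
  by (simp add: sum_list_addf case_prod_unfold)

lemma sum_list_cmult3:
  fixes f :: "'a \<Rightarrow> 'b \<Rightarrow> 'c \<Rightarrow> 'd::semiring_0"
  shows "(\<Sum>(a, y, b)\<leftarrow>xs. k * f a y b) = k * (\<Sum>(a, y, b)\<leftarrow>xs. f a y b)"
  by (simp add: sum_list_const_mult case_prod_unfold)

lemma sum_list_multc3:
  fixes f :: "'a \<Rightarrow> 'b \<Rightarrow> 'c \<Rightarrow> 'd::semiring_0"
  shows "(\<Sum>(a, y, b)\<leftarrow>xs. f a y b * k) = (\<Sum>(a, y, b)\<leftarrow>xs. f a y b) * k"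
  by (simp add: sum_list_mult_const case_prod_unfold)

text \<open>Termination measure of the recursion. The extra one per word makes dropping an empty
  word count as progress; cutting a word in two adds one word but removes two letters, so the
  measure still falls.\<close>

definition wmeas :: "'l list list \<Rightarrow> nat" where
  "wmeas ws = sum_list (map (\<lambda>w. Suc (length w)) ws)"

lemma wmeas_simps [simp]: "wmeas [] = 0" "wmeas (w # ws) = Suc (length w) + wmeas ws"
  "wmeas (ws @ vs) = wmeas ws + wmeas vs"
  by (auto simp: wmeas_def)

text \<open>In the intended model \<open>\<alpha> ws\<close> is the expected product of the
  normalised traces of the words \<open>ws\<close>. The first letter \<open>x\<close> is contracted
  with a letter \<open>y\<close>: inside the same word this cuts one trace into the traces of
  \<open>a\<close> and \<open>b\<close>, in another word it fuses two traces at the price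
  \<open>q\<close>, which will be \<open>1 / N^2\<close>. Unfolded, \<open>\<alpha>\<close> is a sum
  of nonnegative weights over pairings of letters, and the inequalities below come from comparing
  sets of pairings.\<close>

locale schwinger_dyson =
  fixes cov :: "'l \<Rightarrow> 'l \<Rightarrow> real" and q :: real and \<alpha> :: "'l list list \<Rightarrow> real"
  assumes cov_nonneg: "0 \<le> cov x y" and cov_sym: "cov x y = cov y x" and q_nonneg: "0 \<le> q"
    and alpha_Nil [simp]: "\<alpha> [] = 1"
    and alpha_Nil_Cons [simp]: "\<alpha> ([] # ws) = \<alpha> ws"
    and alpha_Cons: "\<alpha> ((x # u) # ws) =
      (\<Sum>(a, y, b)\<leftarrow>splits u. cov x y * \<alpha> (b # a # ws)) +
      q * (\<Sum>(ws1, w, ws2)\<leftarrow>splits ws. \<Sum>(a, y, b)\<leftarrow>splits w. cov x y * \<alpha> ((b @ a @ u) # ws1 @ ws2))"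
begin

lemma alpha_nonneg: "0 \<le> \<alpha> ws"
proof (induction "wmeas ws" arbitrary: ws rule: less_induct)
  case less
  show ?case
  proof (cases ws)
    case (Cons w ws')
    show ?thesis
    proof (cases w)
      case Nil
      then show ?thesis using less[of ws'] Cons by simp
    next
      case w: (Cons x u)
      show ?thesis unfolding Cons w alpha_Cons
        by (intro add_nonneg_nonneg mult_nonneg_nonneg sum_list_nonneg3 cov_nonneg q_nonneg less)
          (auto dest!: splitsD simp: Cons w)
    qed
  qed simp
qed

text \<open>The product collects the pairings that never join \<open>ws\<close> to
  \<open>vs\<close>; all others have nonnegative weight.\<close>

lemma alpha_mult_le: "\<alpha> ws * \<alpha> vs \<le> \<alpha> (ws @ vs)"
proof (induction "wmeas ws" arbitrary: ws rule: less_induct)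
  case less
  show ?case
  proof (cases ws)
    case (Cons w ws')
    show ?thesis
    proof (cases w)
      case Nil
      then show ?thesis using less[of ws'] Cons by simp
    next
      case w: (Cons x u)
      have 1: "(\<Sum>(a, y, b)\<leftarrow>splits u. cov x y * \<alpha> (b # a # ws')) * \<alpha> vs
         \<le> (\<Sum>(a, y, b)\<leftarrow>splits u. cov x y * \<alpha> (b # a # ws' @ vs))"
        unfolding sum_list_multc3[symmetric]
      proof (rule sum_list_mono3)
        fix a y b assume "(a, y, b) \<in> set (splits u)"
        then have "\<alpha> (b # a # ws') * \<alpha> vs \<le> \<alpha> ((b # a # ws') @ vs)"
          by (intro less) (auto dest!: splitsD simp: Cons w)
        then show "cov x y * \<alpha> (b # a # ws') * \<alpha> vs \<le> cov x y * \<alpha> (b # a # ws' @ vs)"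
          using mult_left_mono[OF _ cov_nonneg, of _ _ x y] by (simp add: mult.assoc)
      qed
      have 2: "(\<Sum>(ws1, w, ws2)\<leftarrow>splits ws'. \<Sum>(a, y, b)\<leftarrow>splits w. cov x y * \<alpha> ((b @ a @ u) # ws1 @ ws2)) * \<alpha> vs
         \<le> (\<Sum>(ws1, w, ws2)\<leftarrow>splits ws'. \<Sum>(a, y, b)\<leftarrow>splits w. cov x y * \<alpha> ((b @ a @ u) # ws1 @ ws2 @ vs))"
        unfolding sum_list_multc3[symmetric]
      proof (intro sum_list_mono3)
        fix ws1 w' ws2 a y b assume "(ws1, w', ws2) \<in> set (splits ws')" "(a, y, b) \<in> set (splits w')"
        then have "\<alpha> ((b @ a @ u) # ws1 @ ws2) * \<alpha> vs \<le> \<alpha> (((b @ a @ u) # ws1 @ ws2) @ vs)"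
          by (intro less) (auto dest!: splitsD simp: Cons w)
        then show "cov x y * \<alpha> ((b @ a @ u) # ws1 @ ws2) * \<alpha> vs \<le> cov x y * \<alpha> ((b @ a @ u) # ws1 @ ws2 @ vs)"
          using mult_left_mono[OF _ cov_nonneg, of _ _ x y] by (simp add: mult.assoc)
      qed
      have 3: "0 \<le> (\<Sum>(ws1, w, ws2)\<leftarrow>splits vs. \<Sum>(a, y, b)\<leftarrow>splits w. cov x y * \<alpha> ((b @ a @ u) # (ws' @ ws1) @ ws2))"
        by (intro sum_list_nonneg3 mult_nonneg_nonneg cov_nonneg alpha_nonneg)
      from 2 3 have 4: "q * ((\<Sum>(ws1, w, ws2)\<leftarrow>splits ws'. \<Sum>(a, y, b)\<leftarrow>splits w. cov x y * \<alpha> ((b @ a @ u) # ws1 @ ws2)) * \<alpha> vs)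
        \<le> q * ((\<Sum>(ws1, w, ws2)\<leftarrow>splits ws'. \<Sum>(a, y, b)\<leftarrow>splits w. cov x y * \<alpha> ((b @ a @ u) # ws1 @ ws2 @ vs)) +
          (\<Sum>(ws1, w, ws2)\<leftarrow>splits vs. \<Sum>(a, y, b)\<leftarrow>splits w. cov x y * \<alpha> ((b @ a @ u) # (ws' @ ws1) @ ws2)))"
        by (intro mult_left_mono q_nonneg) auto
      show ?thesis unfolding Cons w append_Cons alpha_Cons splits_append_sum distrib_right mult.assoc
        using 1 4 by linarith
    qed
  qed simp
qed

end

lemma sum_list_swap3:
  fixes F :: "_ \<Rightarrow> _ \<Rightarrow> _ \<Rightarrow> _ \<Rightarrow> _ \<Rightarrow> _ \<Rightarrow> 'd::comm_monoid_add"
  shows "(\<Sum>(a, y, b)\<leftarrow>xs. \<Sum>(c, z, d)\<leftarrow>ys. F a y b c z d) = (\<Sum>(c, z, d)\<leftarrow>ys. \<Sum>(a, y, b)\<leftarrow>xs. F a y b c z d)"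
  by (induction xs) (simp_all add: case_prod_unfold sum_list_addf)

lemma sum_list_swap33:
  fixes F :: "_ \<Rightarrow> _ \<Rightarrow> _ \<Rightarrow> _ \<Rightarrow> _ \<Rightarrow> _ \<Rightarrow> _ \<Rightarrow> _ \<Rightarrow> _ \<Rightarrow> 'd::comm_monoid_add"
  shows "(\<Sum>(a, y, b)\<leftarrow>xs. \<Sum>(c, z, d)\<leftarrow>g a y b. \<Sum>(e, t, f)\<leftarrow>ys. F a y b c z d e t f) =
    (\<Sum>(e, t, f)\<leftarrow>ys. \<Sum>(a, y, b)\<leftarrow>xs. \<Sum>(c, z, d)\<leftarrow>g a y b. F a y b c z d e t f)"
  by (subst sum_list_swap3[symmetric], intro sum_list_cong3) (rule sum_list_swap3)

context schwinger_dyson begin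

text \<open>The recursion without the terms in which \<open>x\<close> meets a letter of
  \<open>m\<close>. Later \<open>m\<close> is a word inserted by a fusion, and the dropped terms are
  those that have no counterpart before the insertion.\<close>

lemma alpha_ge_insert_head:
  "(\<Sum>(p, y, r)\<leftarrow>splits w1. cov x y * \<alpha> ((r @ m @ w2) # p # R)) +
   (\<Sum>(p, y, r)\<leftarrow>splits w2. cov x y * \<alpha> (r # (w1 @ m @ p) # R)) +
   q * (\<Sum>(s1, w, s2)\<leftarrow>splits R. \<Sum>(a, y, b)\<leftarrow>splits w. cov x y * \<alpha> ((b @ a @ w1 @ m @ w2) # s1 @ s2))
   \<le> \<alpha> ((x # w1 @ m @ w2) # R)"
proof -
  have "0 \<le> (\<Sum>(a, y, b)\<leftarrow>splits m. cov x y * \<alpha> ((b @ w2) # (w1 @ a) # R))"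
    by (intro sum_list_nonneg3 mult_nonneg_nonneg cov_nonneg alpha_nonneg)
  then show ?thesis
    unfolding alpha_Cons splits_append_sum append_assoc by linarith
qed

lemma alpha_ge_insert_tail:
  "(\<Sum>(a, y, b)\<leftarrow>splits u. cov x y * \<alpha> (b # a # S1 @ (w1 @ m @ w2) # S2)) +
   q * ((\<Sum>(s1, w, s2)\<leftarrow>splits S1. \<Sum>(a, y, b)\<leftarrow>splits w. cov x y * \<alpha> ((b @ a @ u) # s1 @ s2 @ (w1 @ m @ w2) # S2)) +
     (\<Sum>(a, y, b)\<leftarrow>splits w1. cov x y * \<alpha> ((b @ m @ w2 @ a @ u) # S1 @ S2)) +
     (\<Sum>(a, y, b)\<leftarrow>splits w2. cov x y * \<alpha> ((b @ w1 @ m @ a @ u) # S1 @ S2)) +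
     (\<Sum>(s1, w, s2)\<leftarrow>splits S2. \<Sum>(a, y, b)\<leftarrow>splits w. cov x y * \<alpha> ((b @ a @ u) # S1 @ (w1 @ m @ w2) # s1 @ s2)))
   \<le> \<alpha> ((x # u) # S1 @ (w1 @ m @ w2) # S2)"
proof -
  have "0 \<le> q * (\<Sum>(a, y, b)\<leftarrow>splits m. cov x y * \<alpha> ((b @ w2 @ w1 @ a @ u) # S1 @ S2))"
    by (intro sum_list_nonneg3 mult_nonneg_nonneg cov_nonneg alpha_nonneg q_nonneg)
  then show ?thesis
    unfolding alpha_Cons splits_append_sum splits_Cons_sum append_assoc append_Cons distrib_left
    by (simp add: algebra_simps)
qed

text \<open>A pairing that joins \<open>v\<close> to \<open>ws\<close> contains some joining pair
  \<open>y\<close>, \<open>z\<close>. Contracting it fuses \<open>v\<close>, read cyclically after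
  \<open>z\<close>, into the word of \<open>y\<close>. Summing over all possible joining pairs
  counts each such pairing at least once, hence an upper bound.\<close>

lemma alpha_append_le:
  "\<alpha> (ws @ [v]) \<le> \<alpha> ws * \<alpha> [v] + q * (\<Sum>(ws1, w, ws2)\<leftarrow>splits ws. \<Sum>(w1, y, w2)\<leftarrow>splits w.
     \<Sum>(v1, z, v2)\<leftarrow>splits v. cov y z * \<alpha> (ws1 @ (w1 @ v2 @ v1 @ w2) # ws2))"
proof (induction "wmeas ws" arbitrary: ws rule: less_induct)
  case less
  \<comment> \<open>\<open>I\<close> inserts \<open>v\<close> into the single word \<open>w\<close>
    standing between \<open>pre\<close> and \<open>suf\<close>; \<open>J\<close> runs this over all
    words of a list. The contexts are needed because the recursion rewrites the list around
    \<open>w\<close>.\<close>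
  define I where "I pre w suf = (\<Sum>(w1, y, w2)\<leftarrow>splits w. \<Sum>(v1, z, v2)\<leftarrow>splits v.
      cov y z * \<alpha> (pre @ (w1 @ v2 @ v1 @ w2) # suf))" for pre w suf
  define J where "J pre ws suf = (\<Sum>(ws1, w, ws2)\<leftarrow>splits ws. I (pre @ ws1) w (ws2 @ suf))" for pre ws suf
  have J_Cons: "J pre (w # ws) suf = I pre w (ws @ suf) + J (pre @ [w]) ws suf" for pre w ws suf
    by (simp add: J_def case_prod_unfold o_def)
  have J_append: "J pre (ws @ ws') suf = J pre ws (ws' @ suf) + J (pre @ ws) ws' suf" for pre ws ws' suf
    by (simp add: J_def splits_append case_prod_unfold o_def)
  have IH: "\<alpha> (ws' @ [v]) \<le> \<alpha> ws' * \<alpha> [v] + q * J [] ws' []" if "wmeas ws' < wmeas ws" for ws'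
    using less[OF that] by (simp add: J_def I_def)
  have "\<alpha> (ws @ [v]) \<le> \<alpha> ws * \<alpha> [v] + q * J [] ws []"
  proof (cases ws)
    case Nil
    then show ?thesis by (simp add: J_def)
  next
    case ws: (Cons w ws')
    show ?thesis
    proof (cases w)
      case Nil
      have "J [] ([] # ws') [] = J [] ws' []"
        unfolding J_Cons by (simp add: J_def I_def)
      then show ?thesis using IH[of ws'] by (simp add: ws Nil)
    next
      case w: (Cons x u)
      note [simp] = ws w
      have S1: "(\<Sum>(a, y, b)\<leftarrow>splits u. cov x y * \<alpha> (b # a # ws' @ [v]))
         \<le> (\<Sum>(a, y, b)\<leftarrow>splits u. cov x y * \<alpha> (b # a # ws')) * \<alpha> [v] + q * (\<Sum>(a, y, b)\<leftarrow>splits u. cov x y * J [] (b # a # ws') [])"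
        unfolding sum_list_multc3[symmetric] sum_list_cmult3[symmetric] sum_list_add3[symmetric]
      proof (rule sum_list_mono3)
        fix a y b assume "(a, y, b) \<in> set (splits u)"
        then have "\<alpha> ((b # a # ws') @ [v]) \<le> \<alpha> (b # a # ws') * \<alpha> [v] + q * J [] (b # a # ws') []"
          by (intro IH) (auto dest!: splitsD)
        from mult_left_mono[OF this cov_nonneg, of x y]
        show "cov x y * \<alpha> (b # a # ws' @ [v]) \<le> cov x y * \<alpha> (b # a # ws') * \<alpha> [v] + q * (cov x y * J [] (b # a # ws') [])"
          by (simp add: algebra_simps)
      qed
      have S2: "(\<Sum>(ws1, w, ws2)\<leftarrow>splits ws'. \<Sum>(a, y, b)\<leftarrow>splits w. cov x y * \<alpha> ((b @ a @ u) # ws1 @ ws2 @ [v]))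
         \<le> (\<Sum>(ws1, w, ws2)\<leftarrow>splits ws'. \<Sum>(a, y, b)\<leftarrow>splits w. cov x y * \<alpha> ((b @ a @ u) # ws1 @ ws2)) * \<alpha> [v] +
           q * (\<Sum>(ws1, w, ws2)\<leftarrow>splits ws'. \<Sum>(a, y, b)\<leftarrow>splits w. cov x y * J [] ((b @ a @ u) # ws1 @ ws2) [])"
        unfolding sum_list_multc3[symmetric] sum_list_cmult3[symmetric] sum_list_add3[symmetric]
      proof (intro sum_list_mono3)
        fix ws1 w' ws2 a y b assume "(ws1, w', ws2) \<in> set (splits ws')" "(a, y, b) \<in> set (splits w')"
        then have "\<alpha> (((b @ a @ u) # ws1 @ ws2) @ [v]) \<le> \<alpha> ((b @ a @ u) # ws1 @ ws2) * \<alpha> [v] + q * J [] ((b @ a @ u) # ws1 @ ws2) []"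
          by (intro IH) (auto dest!: splitsD)
        from mult_left_mono[OF this cov_nonneg, of x y]
        show "cov x y * \<alpha> ((b @ a @ u) # ws1 @ ws2 @ [v]) \<le> cov x y * \<alpha> ((b @ a @ u) # ws1 @ ws2) * \<alpha> [v] + q * (cov x y * J [] ((b @ a @ u) # ws1 @ ws2) [])"
          by (simp add: algebra_simps)
      qed
      define M where "M = (\<Sum>(ws1, w, ws2)\<leftarrow>splits ws'. \<Sum>(a, y, b)\<leftarrow>splits w. cov x y * J [] ((b @ a @ u) # ws1 @ ws2) [])"
      define P where "P = (\<Sum>(a, y, b)\<leftarrow>splits u. cov x y * J [] (b # a # ws') [])"
      define S3 where "S3 = (\<Sum>(v1, z, v2)\<leftarrow>splits v. cov x z * \<alpha> ((v2 @ v1 @ u) # ws'))"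
      \<comment> \<open>Contracting the first letter \<open>x\<close> and fusing \<open>v\<close>
        elsewhere commute. The terms of \<open>P\<close> and \<open>M\<close> fuse after the
        contraction; they are regrouped so as to contract after the fusion, and the two insertion
        lemmas then reassemble them. \<open>S3\<close> is the case in which \<open>x\<close> itself
        is the letter joined to \<open>v\<close>.\<close>
      have main: "P + q * M + S3 \<le> J [] ws []"
      proof -
        define P1 where "P1 = (\<Sum>(a, y, b)\<leftarrow>splits u. \<Sum>(w1, t, w2)\<leftarrow>splits b. \<Sum>(v1, z, v2)\<leftarrow>splits v.
          cov x y * (cov t z * \<alpha> ((w1 @ v2 @ v1 @ w2) # a # ws')))"
        define P2 where "P2 = (\<Sum>(a, y, b)\<leftarrow>splits u. \<Sum>(w1, t, w2)\<leftarrow>splits a. \<Sum>(v1, z, v2)\<leftarrow>splits v.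
          cov x y * (cov t z * \<alpha> (b # (w1 @ v2 @ v1 @ w2) # ws')))"
        define P3 where "P3 = (\<Sum>(a, y, b)\<leftarrow>splits u. \<Sum>(S1, w, S2)\<leftarrow>splits ws'. \<Sum>(w1, t, w2)\<leftarrow>splits w. \<Sum>(v1, z, v2)\<leftarrow>splits v.
          cov x y * (cov t z * \<alpha> (b # a # S1 @ (w1 @ v2 @ v1 @ w2) # S2)))"
        have P: "P = P1 + P2 + P3"
          unfolding P_def P1_def P2_def P3_def sum_list_add3[symmetric]
          by (intro sum_list_cong3) (simp add: J_Cons, simp add: J_def I_def sum_list_cmult3 distrib_left)
        define M1 where "M1 = (\<Sum>(S1, w, S2)\<leftarrow>splits ws'. \<Sum>(a, y, b)\<leftarrow>splits w. \<Sum>(w1, t, w2)\<leftarrow>splits b. \<Sum>(v1, z, v2)\<leftarrow>splits v.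
          cov x y * (cov t z * \<alpha> ((w1 @ v2 @ v1 @ w2 @ a @ u) # S1 @ S2)))"
        define M2 where "M2 = (\<Sum>(S1, w, S2)\<leftarrow>splits ws'. \<Sum>(a, y, b)\<leftarrow>splits w. \<Sum>(w1, t, w2)\<leftarrow>splits a. \<Sum>(v1, z, v2)\<leftarrow>splits v.
          cov x y * (cov t z * \<alpha> ((b @ w1 @ v2 @ v1 @ w2 @ u) # S1 @ S2)))"
        define M3 where "M3 = (\<Sum>(S1, w, S2)\<leftarrow>splits ws'. \<Sum>(a, y, b)\<leftarrow>splits w. \<Sum>(w1, t, w2)\<leftarrow>splits u. \<Sum>(v1, z, v2)\<leftarrow>splits v.
          cov x y * (cov t z * \<alpha> ((b @ a @ w1 @ v2 @ v1 @ w2) # S1 @ S2)))"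
        define M4 where "M4 = (\<Sum>(s1, w, s2)\<leftarrow>splits ws'. \<Sum>(S1, w', S2)\<leftarrow>splits s1. \<Sum>(a, y, b)\<leftarrow>splits w. \<Sum>(w1, t, w2)\<leftarrow>splits w'. \<Sum>(v1, z, v2)\<leftarrow>splits v.
          cov x y * (cov t z * \<alpha> ((b @ a @ u) # S1 @ (w1 @ v2 @ v1 @ w2) # S2 @ s2)))"
        define M5 where "M5 = (\<Sum>(s1, w, s2)\<leftarrow>splits ws'. \<Sum>(S1, w', S2)\<leftarrow>splits s2. \<Sum>(a, y, b)\<leftarrow>splits w. \<Sum>(w1, t, w2)\<leftarrow>splits w'. \<Sum>(v1, z, v2)\<leftarrow>splits v.
          cov x y * (cov t z * \<alpha> ((b @ a @ u) # s1 @ S1 @ (w1 @ v2 @ v1 @ w2) # S2)))"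
        have M: "M = M1 + M2 + M3 + M4 + M5"
        proof -
          have *: "(\<Sum>(a, y, b)\<leftarrow>splits w. cov x y * J [] ((b @ a @ u) # s1 @ s2) []) =
            (\<Sum>(a, y, b)\<leftarrow>splits w. \<Sum>(w1, t, w2)\<leftarrow>splits b. \<Sum>(v1, z, v2)\<leftarrow>splits v.
              cov x y * (cov t z * \<alpha> ((w1 @ v2 @ v1 @ w2 @ a @ u) # s1 @ s2))) +
            (\<Sum>(a, y, b)\<leftarrow>splits w. \<Sum>(w1, t, w2)\<leftarrow>splits a. \<Sum>(v1, z, v2)\<leftarrow>splits v.
              cov x y * (cov t z * \<alpha> ((b @ w1 @ v2 @ v1 @ w2 @ u) # s1 @ s2))) +
            (\<Sum>(a, y, b)\<leftarrow>splits w. \<Sum>(w1, t, w2)\<leftarrow>splits u. \<Sum>(v1, z, v2)\<leftarrow>splits v.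
              cov x y * (cov t z * \<alpha> ((b @ a @ w1 @ v2 @ v1 @ w2) # s1 @ s2))) +
            (\<Sum>(S1, w', S2)\<leftarrow>splits s1. \<Sum>(a, y, b)\<leftarrow>splits w. \<Sum>(w1, t, w2)\<leftarrow>splits w'. \<Sum>(v1, z, v2)\<leftarrow>splits v.
              cov x y * (cov t z * \<alpha> ((b @ a @ u) # S1 @ (w1 @ v2 @ v1 @ w2) # S2 @ s2))) +
            (\<Sum>(S1, w', S2)\<leftarrow>splits s2. \<Sum>(a, y, b)\<leftarrow>splits w. \<Sum>(w1, t, w2)\<leftarrow>splits w'. \<Sum>(v1, z, v2)\<leftarrow>splits v.
              cov x y * (cov t z * \<alpha> ((b @ a @ u) # s1 @ S1 @ (w1 @ v2 @ v1 @ w2) # S2)))" for s1 w s2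
            unfolding sum_list_swap3[where xs="splits s1" and ys="splits w"] sum_list_swap3[where xs="splits s2" and ys="splits w"]
              sum_list_add3[symmetric]
            by (intro sum_list_cong3)
              (simp add: J_Cons J_append, simp add: J_def I_def splits_append_sum sum_list_cmult3 distrib_left)
          show ?thesis
            unfolding M_def M1_def M2_def M3_def M4_def M5_def * sum_list_add3 by simp
        qed
        have R1a: "P1 = (\<Sum>(w1, t, w2)\<leftarrow>splits u. \<Sum>(v1, z, v2)\<leftarrow>splits v. cov t z *
           (\<Sum>(p, y, r)\<leftarrow>splits w1. cov x y * \<alpha> ((r @ (v2 @ v1) @ w2) # p # ws')))"
          unfolding P1_def splits_coassoc sum_list_cmult3[symmetric]
          by (intro sum_list_cong3, subst sum_list_swap3) (simp add: mult.left_commute)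
        have R1b: "P2 = (\<Sum>(w1, t, w2)\<leftarrow>splits u. \<Sum>(v1, z, v2)\<leftarrow>splits v. cov t z *
           (\<Sum>(p, y, r)\<leftarrow>splits w2. cov x y * \<alpha> (r # (w1 @ (v2 @ v1) @ p) # ws')))"
          unfolding P2_def splits_coassoc[symmetric] sum_list_cmult3[symmetric]
          by (intro sum_list_cong3, subst sum_list_swap3) (simp add: mult.left_commute)
        have R1c: "M3 = (\<Sum>(w1, t, w2)\<leftarrow>splits u. \<Sum>(v1, z, v2)\<leftarrow>splits v. cov t z *
           (\<Sum>(s1, w, s2)\<leftarrow>splits ws'. \<Sum>(a, y, b)\<leftarrow>splits w. cov x y * \<alpha> ((b @ a @ w1 @ (v2 @ v1) @ w2) # s1 @ s2)))"
          unfolding M3_def sum_list_cmult3[symmetric] sum_list_swap3[where xs="splits v" and ys="splits ws'"]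
            sum_list_swap3[where xs="splits u" and ys="splits ws'"]
          by (intro sum_list_cong3, subst sum_list_swap3, intro sum_list_cong3, subst sum_list_swap3) (simp add: mult.left_commute)
        have R2a: "P3 = (\<Sum>(S1, w, S2)\<leftarrow>splits ws'. \<Sum>(w1, t, w2)\<leftarrow>splits w. \<Sum>(v1, z, v2)\<leftarrow>splits v. cov t z *
           (\<Sum>(a, y, b)\<leftarrow>splits u. cov x y * \<alpha> (b # a # S1 @ (w1 @ (v2 @ v1) @ w2) # S2)))"
          unfolding P3_def sum_list_cmult3[symmetric] sum_list_swap3[where xs="splits u" and ys="splits ws'"]
          by (intro sum_list_cong3, subst sum_list_swap3, intro sum_list_cong3, subst sum_list_swap3) (simp add: mult.left_commute)
        have R2b: "M5 = (\<Sum>(S1, w, S2)\<leftarrow>splits ws'. \<Sum>(w1, t, w2)\<leftarrow>splits w. \<Sum>(v1, z, v2)\<leftarrow>splits v. cov t z *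
           (\<Sum>(s1, w, s2)\<leftarrow>splits S1. \<Sum>(a, y, b)\<leftarrow>splits w. cov x y * \<alpha> ((b @ a @ u) # s1 @ s2 @ (w1 @ (v2 @ v1) @ w2) # S2)))"
          unfolding M5_def splits_coassoc sum_list_cmult3[symmetric]
          by (intro sum_list_cong3, subst sum_list_swap33, intro sum_list_cong3, subst sum_list_swap33) (simp add: mult.left_commute)
        have R2c: "M1 = (\<Sum>(S1, w, S2)\<leftarrow>splits ws'. \<Sum>(w1, t, w2)\<leftarrow>splits w. \<Sum>(v1, z, v2)\<leftarrow>splits v. cov t z *
           (\<Sum>(a, y, b)\<leftarrow>splits w1. cov x y * \<alpha> ((b @ (v2 @ v1) @ w2 @ a @ u) # S1 @ S2)))"
          unfolding M1_def splits_coassoc sum_list_cmult3[symmetric]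
          by (intro sum_list_cong3, subst sum_list_swap3) (simp add: mult.left_commute)
        have R2d: "M2 = (\<Sum>(S1, w, S2)\<leftarrow>splits ws'. \<Sum>(w1, t, w2)\<leftarrow>splits w. \<Sum>(v1, z, v2)\<leftarrow>splits v. cov t z *
           (\<Sum>(a, y, b)\<leftarrow>splits w2. cov x y * \<alpha> ((b @ w1 @ (v2 @ v1) @ a @ u) # S1 @ S2)))"
          unfolding M2_def splits_coassoc[symmetric] sum_list_cmult3[symmetric]
          by (intro sum_list_cong3, subst sum_list_swap3) (simp add: mult.left_commute)
        have R2e: "M4 = (\<Sum>(S1, w, S2)\<leftarrow>splits ws'. \<Sum>(w1, t, w2)\<leftarrow>splits w. \<Sum>(v1, z, v2)\<leftarrow>splits v. cov t z *
           (\<Sum>(s1, w, s2)\<leftarrow>splits S2. \<Sum>(a, y, b)\<leftarrow>splits w. cov x y * \<alpha> ((b @ a @ u) # S1 @ (w1 @ (v2 @ v1) @ w2) # s1 @ s2)))"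
          unfolding M4_def splits_coassoc[symmetric] sum_list_cmult3[symmetric]
          by (intro sum_list_cong3, subst sum_list_swap33, intro sum_list_cong3, subst sum_list_swap33) (simp add: mult.left_commute)
        have "P + q * M + S3 = S3 +
           (\<Sum>(w1, t, w2)\<leftarrow>splits u. \<Sum>(v1, z, v2)\<leftarrow>splits v. cov t z *
            ((\<Sum>(p, y, r)\<leftarrow>splits w1. cov x y * \<alpha> ((r @ (v2 @ v1) @ w2) # p # ws')) +
             (\<Sum>(p, y, r)\<leftarrow>splits w2. cov x y * \<alpha> (r # (w1 @ (v2 @ v1) @ p) # ws')) +
             q * (\<Sum>(s1, w, s2)\<leftarrow>splits ws'. \<Sum>(a, y, b)\<leftarrow>splits w. cov x y * \<alpha> ((b @ a @ w1 @ (v2 @ v1) @ w2) # s1 @ s2)))) +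
           (\<Sum>(S1, w, S2)\<leftarrow>splits ws'. \<Sum>(w1, t, w2)\<leftarrow>splits w. \<Sum>(v1, z, v2)\<leftarrow>splits v. cov t z *
            ((\<Sum>(a, y, b)\<leftarrow>splits u. cov x y * \<alpha> (b # a # S1 @ (w1 @ (v2 @ v1) @ w2) # S2)) +
             q * ((\<Sum>(s1, w, s2)\<leftarrow>splits S1. \<Sum>(a, y, b)\<leftarrow>splits w. cov x y * \<alpha> ((b @ a @ u) # s1 @ s2 @ (w1 @ (v2 @ v1) @ w2) # S2)) +
               (\<Sum>(a, y, b)\<leftarrow>splits w1. cov x y * \<alpha> ((b @ (v2 @ v1) @ w2 @ a @ u) # S1 @ S2)) +
               (\<Sum>(a, y, b)\<leftarrow>splits w2. cov x y * \<alpha> ((b @ w1 @ (v2 @ v1) @ a @ u) # S1 @ S2)) +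
               (\<Sum>(s1, w, s2)\<leftarrow>splits S2. \<Sum>(a, y, b)\<leftarrow>splits w. cov x y * \<alpha> ((b @ a @ u) # S1 @ (w1 @ (v2 @ v1) @ w2) # s1 @ s2)))))"
          unfolding P M R1a R1b R1c R2a R2b R2c R2d R2e distrib_left sum_list_add3 sum_list_cmult3 mult.left_commute[of _ q]
          by (simp add: add_ac)
        also have "\<dots> \<le> S3 + (\<Sum>(w1, t, w2)\<leftarrow>splits u. \<Sum>(v1, z, v2)\<leftarrow>splits v. cov t z * \<alpha> ((x # w1 @ (v2 @ v1) @ w2) # ws')) +
           (\<Sum>(S1, w, S2)\<leftarrow>splits ws'. \<Sum>(w1, t, w2)\<leftarrow>splits w. \<Sum>(v1, z, v2)\<leftarrow>splits v. cov t z * \<alpha> ((x # u) # S1 @ (w1 @ (v2 @ v1) @ w2) # S2))"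
          by (intro add_mono order.refl sum_list_mono3 mult_left_mono cov_nonneg alpha_ge_insert_head alpha_ge_insert_tail)
        also have "\<dots> = J [] ws []"
          by (simp add: J_Cons, simp add: J_def I_def splits_Cons_sum S3_def del: splits.simps)
        finally show ?thesis .
      qed
      have "\<alpha> (ws @ [v]) = (\<Sum>(a, y, b)\<leftarrow>splits u. cov x y * \<alpha> (b # a # ws' @ [v])) +
        q * ((\<Sum>(ws1, w, ws2)\<leftarrow>splits ws'. \<Sum>(a, y, b)\<leftarrow>splits w. cov x y * \<alpha> ((b @ a @ u) # ws1 @ ws2 @ [v])) + S3)"
        by (simp add: alpha_Cons splits_append_sum S3_def)
      also have "\<dots> \<le> (\<Sum>(a, y, b)\<leftarrow>splits u. cov x y * \<alpha> (b # a # ws')) * \<alpha> [v] + q * P +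
        q * ((\<Sum>(ws1, w, ws2)\<leftarrow>splits ws'. \<Sum>(a, y, b)\<leftarrow>splits w. cov x y * \<alpha> ((b @ a @ u) # ws1 @ ws2)) * \<alpha> [v] + q * M + S3)"
        using S1 S2 q_nonneg by (intro add_mono mult_left_mono) (auto simp: P_def M_def)
      also have "\<dots> = \<alpha> ws * \<alpha> [v] + q * (P + q * M + S3)"
        by (simp add: alpha_Cons algebra_simps)
      also have "\<dots> \<le> \<alpha> ws * \<alpha> [v] + q * J [] ws []"
        using main q_nonneg by (intro add_left_mono mult_left_mono)
      finally show ?thesis .
    qed
  qed
  then show ?case by (simp add: J_def I_def)
qed
end

text \<open>Weighted count of non-crossing pairings: \<open>s\<close> holds the letters still open,
  and each new letter either opens a pair or closes the one on top of the stack.\<close>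

fun stack_count :: "('l \<Rightarrow> 'l \<Rightarrow> real) \<Rightarrow> 'l list \<Rightarrow> 'l list \<Rightarrow> real" where
  "stack_count c s [] = (if s = [] then 1 else 0)"
| "stack_count c s (x # w) = stack_count c (x # s) w +
     (case s of [] \<Rightarrow> 0 | y # s' \<Rightarrow> c y x * stack_count c s' w)"

text \<open>Cut the word at the letter \<open>y\<close> that closes \<open>x\<close>: everything
  above \<open>x\<close> on the stack has to be closed before \<open>y\<close>, everything below it
  afterwards. With empty stacks this becomes the Catalan recursion.\<close>

lemma stack_count_append:
  "stack_count c (t @ x # s) u =
    (\<Sum>(a, y, b)\<leftarrow>splits u. c x y * (stack_count c t a * stack_count c s b))"
proof (induction u arbitrary: t)
  case (Cons z u)
  have "stack_count c (t @ x # s) (z # u) = stack_count c ((z # t) @ x # s) u +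
     (case t of [] \<Rightarrow> c x z * stack_count c s u | y # t' \<Rightarrow> c y z * stack_count c (t' @ x # s) u)"
    by (cases t) simp_all
  then show ?case
    unfolding splits_Cons_sum Cons.IH[of "z # t"]
    by (cases t) (simp_all add: Cons.IH sum_list_cmult3[symmetric] sum_list_add3[symmetric] algebra_simps)
qed simp

lemma stack_count_nonneg: "(\<And>x y. 0 \<le> c x y) \<Longrightarrow> 0 \<le> stack_count c s u"
  by (induction u arbitrary: s) (auto split: list.splits intro!: add_nonneg_nonneg mult_nonneg_nonneg)

lemma stack_count_Cons: "stack_count c [] (x # u) =
    (\<Sum>(a, y, b)\<leftarrow>splits u. c x y * (stack_count c [] a * stack_count c [] b))"
  using stack_count_append[of c "[]" x "[]" u] by simp

section \<open>Crossing pairs and the error of the planar approximation\<close>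

context schwinger_dyson begin

definition csum :: "'l list \<Rightarrow> ('l list \<Rightarrow> 'l \<Rightarrow> 'l list \<Rightarrow> 'l \<Rightarrow> 'l list \<Rightarrow> 'l \<Rightarrow> 'l list \<Rightarrow> real) \<Rightarrow> real" where
  "csum r F = (\<Sum>(w2, y, r2)\<leftarrow>splits r. \<Sum>(w3, z, r3)\<leftarrow>splits r2. \<Sum>(w4, t, w5)\<leftarrow>splits r3. F w2 y w3 z w4 t w5)"

text \<open>The pairs \<open>x\<close>, \<open>x'\<close> and \<open>y\<close>, \<open>y'\<close>
  cross. Contracting the first cuts the trace into two pieces that the second pair joins, so
  contracting the second fuses them again, to \<open>w1 @ w4 @ w3 @ w2 @ w5\<close>. This is the
  removal of one handle.\<close>

definition crossing_sum :: "'l list \<Rightarrow> real" where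
  "crossing_sum w = (\<Sum>(w1, x, r1)\<leftarrow>splits w. csum r1 (\<lambda>w2 y w3 x' w4 y' w5.
      cov x x' * cov y y' * \<alpha> [w1 @ w4 @ w3 @ w2 @ w5]))"

lemma csum_mono: "(\<And>w2 y w3 z w4 t w5. F w2 y w3 z w4 t w5 \<le> G w2 y w3 z w4 t w5) \<Longrightarrow> csum r F \<le> csum r G"
  unfolding csum_def by (intro sum_list_mono3)

lemma csum_swap: "(\<Sum>(a, y, b)\<leftarrow>xs. csum r (F a y b)) =
    csum r (\<lambda>w2 y' w3 z w4 t w5. \<Sum>(a, y, b)\<leftarrow>xs. F a y b w2 y' w3 z w4 t w5)"
  unfolding csum_def
  by (subst sum_list_swap3, intro sum_list_cong3, subst sum_list_swap3, intro sum_list_cong3, subst sum_list_swap3) simp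

lemma csum_shift: "(\<Sum>(r, x, b)\<leftarrow>splits s. csum r (\<lambda>w2 y w3 z w4 t w5. F w2 y w3 z w4 t w5 x b)) =
    csum s (\<lambda>w2 y w3 z w4 t r. \<Sum>(w5, x, b)\<leftarrow>splits r. F w2 y w3 z w4 t w5 x b)"
  unfolding csum_def splits_coassoc[symmetric] ..

lemma csum_cmult: "k * csum r F = csum r (\<lambda>w2 y w3 z w4 t w5. k * F w2 y w3 z w4 t w5)"
  unfolding csum_def sum_list_cmult3 ..

lemma csum_add: "csum r F + csum r G = csum r (\<lambda>w2 y w3 z w4 t w5. F w2 y w3 z w4 t w5 + G w2 y w3 z w4 t w5)"
  unfolding csum_def sum_list_add3 ..

lemma crossing_sum_nonneg: "0 \<le> crossing_sum w"
  unfolding crossing_sum_def csum_def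
  by (intro sum_list_nonneg3 mult_nonneg_nonneg cov_nonneg alpha_nonneg)

text \<open>Keep only the pairings in which the two pieces cut off by the pair of \<open>x\<close>
  are not joined to each other; supermultiplicativity bounds these from below by the
  product.\<close>

lemma stack_count_le_alpha: "stack_count cov [] w \<le> \<alpha> [w]"
proof (induction "length w" arbitrary: w rule: less_induct)
  case less
  show ?case
  proof (cases w)
    case (Cons x u)
    have "stack_count cov [] w = (\<Sum>(a, y, b)\<leftarrow>splits u. cov x y * (stack_count cov [] a * stack_count cov [] b))"
      by (simp only: Cons stack_count_Cons)
    also have "\<dots> \<le> (\<Sum>(a, y, b)\<leftarrow>splits u. cov x y * \<alpha> [b, a])"
    proof (intro sum_list_mono3 mult_left_mono cov_nonneg)
      fix a y b assume "(a, y, b) \<in> set (splits u)"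
      then have "stack_count cov [] a * stack_count cov [] b \<le> \<alpha> [a] * \<alpha> [b]"
        by (intro mult_mono less alpha_nonneg stack_count_nonneg cov_nonneg) (auto dest!: splitsD simp: Cons)
      also have "\<dots> \<le> \<alpha> [b, a]" using alpha_mult_le[of "[b]" "[a]"] by (simp add: mult.commute)
      finally show "stack_count cov [] a * stack_count cov [] b \<le> \<alpha> [b, a]" .
    qed
    finally show ?thesis by (simp add: Cons alpha_Cons)
  qed simp
qed

lemma crossing_sum_Cons:
  "crossing_sum (x # u) = csum u (\<lambda>w2 y w3 x' w4 y' w5. cov x x' * cov y y' * \<alpha> [w4 @ w3 @ w2 @ w5]) +
    (\<Sum>(w1, z, r1)\<leftarrow>splits u. csum r1 (\<lambda>w2 y w3 z' w4 y' w5.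
      cov z z' * cov y y' * \<alpha> [x # w1 @ w4 @ w3 @ w2 @ w5]))"
  unfolding crossing_sum_def splits_Cons_sum by simp

text \<open>The case in which \<open>x\<close> is not one of the four marked letters. After pairing
  \<open>x\<close> with \<open>t\<close> the crossing lies inside \<open>b\<close> or inside
  \<open>a\<close>; with the marked letters chosen first, the rearranged middle part acts as an
  inserted block, and \<open>alpha_ge_insert_head\<close> absorbs the sum over
  \<open>t\<close>.\<close>

lemma crossing_sum_splits_le:
  "(\<Sum>(a, t, b)\<leftarrow>splits u. cov x t * (crossing_sum b * \<alpha> [a] + \<alpha> [b] * crossing_sum a)) \<le>
    (\<Sum>(w1, z, r1)\<leftarrow>splits u. csum r1 (\<lambda>w2 y w3 z' w4 y' w5.
      cov z z' * cov y y' * \<alpha> [x # w1 @ w4 @ w3 @ w2 @ w5]))"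
proof -
  have 1: "(\<Sum>(a, t, b)\<leftarrow>splits u. cov x t * (crossing_sum b * \<alpha> [a])) \<le>
     (\<Sum>(w1, z, r1)\<leftarrow>splits u. csum r1 (\<lambda>w2 y w3 z' w4 y' w5. \<Sum>(a, t, b)\<leftarrow>splits w1.
      cov z z' * cov y y' * (cov x t * \<alpha> [b @ w4 @ w3 @ w2 @ w5, a])))"
  proof -
    have "(\<Sum>(a, t, b)\<leftarrow>splits u. cov x t * (crossing_sum b * \<alpha> [a])) =
      (\<Sum>(w1, z, r1)\<leftarrow>splits u. csum r1 (\<lambda>w2 y w3 z' w4 y' w5. \<Sum>(a, t, b)\<leftarrow>splits w1.
        cov z z' * cov y y' * (cov x t * (\<alpha> [b @ w4 @ w3 @ w2 @ w5] * \<alpha> [a]))))"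
      unfolding crossing_sum_def csum_swap[symmetric] splits_coassoc[symmetric]
      unfolding sum_list_multc3[symmetric] sum_list_cmult3[symmetric]
      by (intro sum_list_cong3)
        (simp add: csum_cmult mult.commute[of "csum _ _"] mult_ac)
    also have "\<dots> \<le> (\<Sum>(w1, z, r1)\<leftarrow>splits u. csum r1 (\<lambda>w2 y w3 z' w4 y' w5. \<Sum>(a, t, b)\<leftarrow>splits w1.
        cov z z' * cov y y' * (cov x t * \<alpha> ([b @ w4 @ w3 @ w2 @ w5] @ [a]))))"
      by (intro sum_list_mono3 csum_mono mult_left_mono alpha_mult_le cov_nonneg mult_nonneg_nonneg)
    finally show ?thesis by simp
  qed
  have 2: "(\<Sum>(a, t, b)\<leftarrow>splits u. cov x t * (\<alpha> [b] * crossing_sum a)) \<le>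
     (\<Sum>(w1, z, r1)\<leftarrow>splits u. csum r1 (\<lambda>w2 y w3 z' w4 y' w5. \<Sum>(a, t, b)\<leftarrow>splits w5.
      cov z z' * cov y y' * (cov x t * \<alpha> [b, w1 @ w4 @ w3 @ w2 @ a])))"
  proof -
    have "(\<Sum>(a, t, b)\<leftarrow>splits u. cov x t * (\<alpha> [b] * crossing_sum a)) =
      (\<Sum>(w1, z, r1)\<leftarrow>splits u. csum r1 (\<lambda>w2 y w3 z' w4 y' w5. \<Sum>(a, t, b)\<leftarrow>splits w5.
        cov z z' * cov y y' * (cov x t * (\<alpha> [b] * \<alpha> [w1 @ w4 @ w3 @ w2 @ a]))))"
      unfolding crossing_sum_def csum_shift[symmetric] splits_coassoc
      unfolding sum_list_cmult3[symmetric]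
      by (intro sum_list_cong3) (simp add: csum_cmult mult_ac)
    also have "\<dots> \<le> (\<Sum>(w1, z, r1)\<leftarrow>splits u. csum r1 (\<lambda>w2 y w3 z' w4 y' w5. \<Sum>(a, t, b)\<leftarrow>splits w5.
        cov z z' * cov y y' * (cov x t * \<alpha> ([b] @ [w1 @ w4 @ w3 @ w2 @ a]))))"
      by (intro sum_list_mono3 csum_mono mult_left_mono alpha_mult_le cov_nonneg mult_nonneg_nonneg)
    finally show ?thesis by simp
  qed
  have 3: "(\<Sum>(a, t, b)\<leftarrow>splits w1. k * (cov x t * \<alpha> [b @ m @ w5, a])) + (\<Sum>(a, t, b)\<leftarrow>splits w5. k * (cov x t * \<alpha> [b, w1 @ m @ a]))
      \<le> k * \<alpha> [x # w1 @ m @ w5]" if "0 \<le> k" for w1 w5 m k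
    using mult_left_mono[OF alpha_ge_insert_head[where x=x and ?w1.0=w1 and m=m and ?w2.0=w5 and R="[]"] that]
    by (simp add: sum_list_cmult3 distrib_left)
  have "(\<Sum>(w1, z, r1)\<leftarrow>splits u. csum r1 (\<lambda>w2 y w3 z' w4 y' w5. \<Sum>(a, t, b)\<leftarrow>splits w1.
      cov z z' * cov y y' * (cov x t * \<alpha> [b @ w4 @ w3 @ w2 @ w5, a]))) +
     (\<Sum>(w1, z, r1)\<leftarrow>splits u. csum r1 (\<lambda>w2 y w3 z' w4 y' w5. \<Sum>(a, t, b)\<leftarrow>splits w5.
      cov z z' * cov y y' * (cov x t * \<alpha> [b, w1 @ w4 @ w3 @ w2 @ a]))) \<le>
    (\<Sum>(w1, z, r1)\<leftarrow>splits u. csum r1 (\<lambda>w2 y w3 z' w4 y' w5.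
      cov z z' * cov y y' * \<alpha> [x # w1 @ w4 @ w3 @ w2 @ w5]))"
    unfolding sum_list_add3[symmetric] csum_add
    using 3[OF mult_nonneg_nonneg[OF cov_nonneg cov_nonneg], where m = "_ @ _ @ _"]
    by (intro sum_list_mono3 csum_mono) simp
  with 1 2 show ?thesis
    by (simp add: distrib_left sum_list_add3)
qed

text \<open>A pairing of one word is either non-crossing or contains two crossing pairs, and
  removing such a couple costs one factor \<open>q\<close>. Counting a pairing once for each of its
  couples only enlarges the bound.\<close>

lemma alpha_le_crossing_sum: "\<alpha> [w] \<le> stack_count cov [] w + q * crossing_sum w"
proof (induction "length w" arbitrary: w rule: less_induct)
  case less
  show ?case
  proof (cases w)
    case (Cons x u)
    have "\<alpha> [x # u] = (\<Sum>(a, t, b)\<leftarrow>splits u. cov x t * \<alpha> ([b] @ [a]))"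
      by (simp add: alpha_Cons)
    \<comment> \<open>Three sources: planar pairings of both pieces, a crossing inside one piece,
      and in the last sum a pair that joins the two pieces and therefore crosses the pair
      \<open>x\<close>, \<open>t\<close>.\<close>
    also have "\<dots> \<le> (\<Sum>(a, t, b)\<leftarrow>splits u. cov x t * ((stack_count cov [] a * stack_count cov [] b +
        q * (crossing_sum b * \<alpha> [a] + \<alpha> [b] * crossing_sum a)) +
        q * (\<Sum>(b1, y', b2)\<leftarrow>splits b. \<Sum>(a1, y, a2)\<leftarrow>splits a. cov y' y * \<alpha> [b1 @ a2 @ a1 @ b2])))"
    proof (intro sum_list_mono3 mult_left_mono cov_nonneg)
      fix a y b assume "(a, y, b) \<in> set (splits u)"
      then have a: "\<alpha> [a] \<le> stack_count cov [] a + q * crossing_sum a" and b: "\<alpha> [b] \<le> stack_count cov [] b + q * crossing_sum b"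
        using less by (auto dest!: splitsD simp: Cons)
      have "\<alpha> [b] * \<alpha> [a] \<le> stack_count cov [] b * \<alpha> [a] + q * (crossing_sum b * \<alpha> [a])"
        using mult_right_mono[OF b alpha_nonneg[of "[a]"]] by (simp add: algebra_simps)
      also have "stack_count cov [] b * \<alpha> [a] \<le> stack_count cov [] b * stack_count cov [] a + q * (stack_count cov [] b * crossing_sum a)"
        using mult_left_mono[OF a stack_count_nonneg[of cov "[]" b]] cov_nonneg by (simp add: algebra_simps)
      also have "q * (stack_count cov [] b * crossing_sum a) \<le> q * (\<alpha> [b] * crossing_sum a)"
        by (intro mult_left_mono mult_right_mono stack_count_le_alpha crossing_sum_nonneg q_nonneg)
      finally have "\<alpha> [b] * \<alpha> [a] \<le> stack_count cov [] a * stack_count cov [] b + q * (crossing_sum b * \<alpha> [a] + \<alpha> [b] * crossing_sum a)"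
        by (simp add: algebra_simps)
      then show "\<alpha> ([b] @ [a]) \<le> stack_count cov [] a * stack_count cov [] b + q * (crossing_sum b * \<alpha> [a] + \<alpha> [b] * crossing_sum a) +
        q * (\<Sum>(b1, y', b2)\<leftarrow>splits b. \<Sum>(a1, y, a2)\<leftarrow>splits a. cov y' y * \<alpha> [b1 @ a2 @ a1 @ b2])"
        using alpha_append_le[of "[b]" a] by simp
    qed
    also have "\<dots> = stack_count cov [] w + q * (\<Sum>(a, t, b)\<leftarrow>splits u. cov x t * (crossing_sum b * \<alpha> [a] + \<alpha> [b] * crossing_sum a)) +
       q * (\<Sum>(a, t, b)\<leftarrow>splits u. \<Sum>(b1, y', b2)\<leftarrow>splits b. \<Sum>(a1, y, a2)\<leftarrow>splits a. cov x t * (cov y' y * \<alpha> [b1 @ a2 @ a1 @ b2]))"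
      by (simp only: Cons stack_count_Cons distrib_left sum_list_add3 sum_list_cmult3 mult.left_commute[of _ q])
    also have "(\<Sum>(a, t, b)\<leftarrow>splits u. \<Sum>(b1, y', b2)\<leftarrow>splits b. \<Sum>(a1, y, a2)\<leftarrow>splits a. cov x t * (cov y' y * \<alpha> [b1 @ a2 @ a1 @ b2]))
      = (\<Sum>(a, t, b)\<leftarrow>splits u. \<Sum>(a1, y, a2)\<leftarrow>splits a. \<Sum>(b1, y', b2)\<leftarrow>splits b. cov x t * cov y y' * \<alpha> [b1 @ a2 @ a1 @ b2])"
      by (intro sum_list_cong3, subst sum_list_swap3) (simp add: cov_sym mult.assoc)
    also have "\<dots> = csum u (\<lambda>w2 y w3 x' w4 y' w5. cov x x' * cov y y' * \<alpha> [w4 @ w3 @ w2 @ w5])"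
      unfolding csum_def splits_coassoc[symmetric] ..
    finally show ?thesis
      using mult_left_mono[OF crossing_sum_splits_le[of x u] q_nonneg]
      unfolding Cons crossing_sum_Cons distrib_left by linarith
  qed (simp add: crossing_sum_nonneg q_nonneg)
qed

end

section \<open>Growth of planar counts for words with few runs and for semicircular words\<close>

lemma sum_list_splits_le:
  assumes "\<And>a y b. u = a @ y # b \<Longrightarrow> F a y b \<le> (K::real)"
  shows "(\<Sum>(a, y, b)\<leftarrow>splits u. F a y b) \<le> real (length u) * K"
proof -
  have "(\<Sum>(a, y, b)\<leftarrow>splits u. F a y b) \<le> (\<Sum>(a, y, b)\<leftarrow>splits u. K)"
    by (intro sum_list_mono3 assms splitsD)
  then show ?thesis by (simp add: case_prod_unfold sum_list_triv)
qed

text \<open>Runs may be empty and neighbouring runs may carry the same letter, which keeps the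
  predicate stable under cutting and gluing.\<close>

inductive blocks :: "nat \<Rightarrow> nat \<Rightarrow> 'l list \<Rightarrow> bool" for m where
  blocks_Nil: "blocks m r []"
| blocks_Cons: "blocks m r w \<Longrightarrow> k \<le> m \<Longrightarrow> blocks m (Suc r) (replicate k x @ w)"

lemma blocks_mono: "blocks m r w \<Longrightarrow> r \<le> r' \<Longrightarrow> blocks m r' w"
proof (induction arbitrary: r' rule: blocks.induct)
  case (blocks_Cons r w k x)
  then show ?case by (cases r') (auto intro: blocks.blocks_Cons)
qed (rule blocks.blocks_Nil)

lemma blocks_append: "blocks m r w \<Longrightarrow> blocks m r' w' \<Longrightarrow> blocks m (r + r') (w @ w')"
proof (induction rule: blocks.induct)
  case (blocks_Nil r)
  then show ?case by (auto intro: blocks_mono)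
next
  case (blocks_Cons r w k x)
  then show ?case by (auto intro: blocks.blocks_Cons)
qed

text \<open>Deleting a letter inside a run leaves a piece of that run on either side, hence the one
  extra run.\<close>

lemma blocks_split:
  "blocks m r w \<Longrightarrow> w = u @ y # v \<Longrightarrow> \<exists>r1 r2. blocks m r1 u \<and> blocks m r2 v \<and> r1 + r2 \<le> Suc r"
proof (induction arbitrary: u rule: blocks.induct)
  case (blocks_Cons r w k x)
  show ?case
  proof (cases "length u < k")
    case True
    have "u = take (length u) (replicate k x @ w)" "v = drop (Suc (length u)) (replicate k x @ w)"
      using blocks_Cons.prems by simp_all
    then have u: "u = replicate (length u) x" and v: "v = replicate (k - Suc (length u)) x @ w"
      using True by simp_all
    have "blocks m (Suc 0) (replicate (length u) x @ [])"
      using True blocks_Cons by (intro blocks.intros) auto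
    then have "blocks m (Suc 0) u" using u by simp
    moreover have "blocks m (Suc r) v"
      unfolding v using blocks_Cons by (intro blocks.blocks_Cons) auto
    ultimately show ?thesis by (intro exI[of _ "Suc 0"] exI[of _ "Suc r"]) auto
  next
    case False
    then have "take k u = take k (replicate k x @ w)" "drop k u @ y # v = drop k (replicate k x @ w)"
      unfolding blocks_Cons.prems by simp_all
    then have u: "u = replicate k x @ drop k u" and w: "w = drop k u @ y # v"
      by (simp_all, metis append_take_drop_id)
    from blocks_Cons.IH[OF w] obtain r1 r2 where r: "blocks m r1 (drop k u)" "blocks m r2 v" "r1 + r2 \<le> Suc r" by auto
    have "blocks m (Suc r1) u"
      by (subst u, rule blocks.blocks_Cons) (use r blocks_Cons in auto)
    then show ?thesis using r by (intro exI[of _ "Suc r1"] exI[of _ r2]) auto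
  qed
qed simp

lemma blocks_replicate_cycle:
  "blocks m (2 * k) (concat (replicate k (replicate m x @ replicate m y)))"
proof (induction k)
  case (Suc k)
  have "blocks m (Suc (Suc (2 * k))) (replicate m x @ replicate m y @ concat (replicate k (replicate m x @ replicate m y)))"
    using Suc by (intro blocks.blocks_Cons) auto
  then show ?case by simp
qed (simp add: blocks.blocks_Nil)

text \<open>A non-crossing matching cannot pair two letters of one run, so inside a run the letters that
  close a pair all precede those that open one, and their number determines them.\<close>

lemma stack_count_replicate_le:
  assumes c: "\<And>x y. 0 \<le> c x y" "\<And>x y. c x y \<le> 1" "\<And>x. c x x = 0"
    and B: "\<And>s. stack_count c s w \<le> B"
  shows "stack_count c (x # s) (replicate k x @ w) \<le> B"
    and "stack_count c s (replicate k x @ w) \<le> (real k + 1) * B"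
proof -
  have B0: "0 \<le> B" using stack_count_nonneg[of c "[]" w, OF c(1)] B[of "[]"] by linarith
  have 1: "stack_count c (x # s) (replicate k x @ w) \<le> B" for s k
    by (induction k arbitrary: s) (auto simp: B c)
  show "stack_count c (x # s) (replicate k x @ w) \<le> B" by (rule 1)
  show "stack_count c s (replicate k x @ w) \<le> (real k + 1) * B"
  proof (induction k arbitrary: s)
    case (Suc k)
    have "(case s of [] \<Rightarrow> 0 | y # s' \<Rightarrow> c y x * stack_count c s' (replicate k x @ w)) \<le> (real k + 1) * B"
    proof (cases s)
      case (Cons y s')
      have "c y x * stack_count c s' (replicate k x @ w) \<le> 1 * ((real k + 1) * B)"
        using Suc c by (intro mult_mono) (auto intro: stack_count_nonneg)
      then show ?thesis using Cons by simp
    qed (use B0 in simp)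
    then show ?case using 1[of s k] by (simp add: algebra_simps)
  qed (use B in simp)
qed

text \<open>A run offers at most \<open>m + 1\<close> choices for the number of its letters that
  close a pair. With \<open>r = 2 * k\<close> this bounds the moments of the \<open>m\<close>-th
  power times its adjoint by powers of \<open>(m + 1)^2\<close>, the source of the norm bound
  \<open>m + 1\<close>.\<close>

lemma stack_count_blocks_le:
  assumes c: "\<And>x y. 0 \<le> c x y" "\<And>x y. c x y \<le> 1" "\<And>x. c x x = 0"
  shows "blocks m r w \<Longrightarrow> stack_count c s w \<le> (real m + 1) ^ r"
proof (induction arbitrary: s rule: blocks.induct)
  case (blocks_Cons r w k x)
  have "stack_count c s (replicate k x @ w) \<le> (real k + 1) * (real m + 1) ^ r"
    using stack_count_replicate_le[where c=c and w=w, OF c blocks_Cons.IH] by blast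
  also have "\<dots> \<le> (real m + 1) * (real m + 1) ^ r"
    using blocks_Cons by (intro mult_right_mono) auto
  finally show ?case by simp
qed simp

text \<open>The function \<open>1 / sqrt 2 ^ length s\<close> is an eigenfunction of the walk of
  stack heights: a push of weight 1 and a pop of weight 1/2 both contribute the factor
  \<open>1 / sqrt 2\<close>, together \<open>sqrt 2\<close>. This is the edge of the semicircle law
  of variance 1/2; the empty stack only loses a term.\<close>

lemma stack_count_half_le:
  assumes c: "\<And>x y. c x y = 1 / 2"
  shows "stack_count c s w \<le> sqrt 2 ^ length w / sqrt 2 ^ length s"
proof (induction w arbitrary: s)
  case (Cons x w)
  have 2: "sqrt 2 * sqrt 2 = (2::real)" by simp
  have "stack_count c (x # s) w \<le> sqrt 2 ^ length w / sqrt 2 ^ length s / sqrt 2"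
    using Cons[of "x # s"] by (simp add: field_simps)
  moreover have "(case s of [] \<Rightarrow> 0 | y # s' \<Rightarrow> c y x * stack_count c s' w) \<le> sqrt 2 ^ length w / sqrt 2 ^ length s / sqrt 2"
  proof (cases s)
    case s: (Cons y s')
    have "stack_count c s' w / 2 \<le> sqrt 2 ^ length w / sqrt 2 ^ length s' / 2"
      using Cons[of s'] by simp
    also have "\<dots> = sqrt 2 ^ length w / sqrt 2 ^ length s / sqrt 2"
      by (simp add: s field_simps)
    finally show ?thesis by (simp add: s c)
  qed simp
  ultimately have "stack_count c s (x # w) \<le> 2 * (sqrt 2 ^ length w / sqrt 2 ^ length s / sqrt 2)" by simp
  also have "\<dots> = sqrt 2 ^ length (x # w) / sqrt 2 ^ length s"
    by (simp add: field_simps)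
  finally show ?case .
qed simp

lemma stack_count_short: "length w < length s \<Longrightarrow> stack_count c s w = 0"
  by (induction w arbitrary: s) (auto split: list.splits)

text \<open>Number of nonnegative walks from height \<open>n\<close> to 0 with \<open>m\<close>
  steps up, by the reflection principle.\<close>

definition ballot :: "nat \<Rightarrow> nat \<Rightarrow> real" where
  "ballot n m = real ((n + 2 * m) choose m) - (if m = 0 then 0 else real ((n + 2 * m) choose (m - 1)))"

lemma ballot_rec:
  assumes "n + m > 0"
  shows "ballot n m = (if m = 0 then 0 else ballot (Suc n) (m - 1)) + (if n = 0 then 0 else ballot (n - 1) m)"
proof (cases m)
  case (Suc k)
  show ?thesis
  proof (cases n)
    case 0
    have "Suc (2 * k) choose Suc k = Suc (2 * k) choose k"
      by (subst binomial_symmetric) auto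
    then show ?thesis using 0 Suc
      by (cases k) (simp_all add: ballot_def)
  next
    case n: (Suc n')
    show ?thesis using n Suc by (cases k) (simp_all add: ballot_def)
  qed
qed (use assms in \<open>auto simp: ballot_def\<close>)

lemma stack_count_half:
  assumes c: "\<And>x y. c x y = 1 / 2"
  shows "length w = length s + 2 * m \<Longrightarrow> stack_count c s w = (1 / 2) ^ (length s + m) * ballot (length s) m"
proof (induction w arbitrary: s m)
  case Nil
  then show ?case by (simp add: ballot_def)
next
  case (Cons x w)
  have push: "stack_count c (x # s) w = (1 / 2) ^ (length s + m) * (if m = 0 then 0 else ballot (Suc (length s)) (m - 1))"
  proof (cases m)
    case 0
    then show ?thesis using Cons.prems by (simp add: stack_count_short)
  next
    case (Suc k)
    then show ?thesis using Cons.IH[of "x # s" k] Cons.prems by simp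
  qed
  have pop: "(case s of [] \<Rightarrow> 0 | y # s' \<Rightarrow> c y x * stack_count c s' w) =
     (1 / 2) ^ (length s + m) * (if length s = 0 then 0 else ballot (length s - 1) m)"
  proof (cases s)
    case s: (Cons y s')
    have "c = (\<lambda>_ _. 1 / 2)" using c by (intro ext) simp
    with s show ?thesis using Cons.IH[of s' m] Cons.prems by simp
  qed simp
  have "length s + m > 0" using Cons.prems by auto
  from ballot_rec[OF this] show ?case
    by (simp add: push pop distrib_left)
qed

text \<open>\<open>ballot 0 m\<close> is a Catalan number, a central binomial coefficient over
  \<open>m + 1\<close>. Later only its exponential rate matters, so a polynomial loss is affordable;
  \<open>(real m + 1)^2\<close> keeps the formula valid at \<open>m = 0\<close>.\<close>

lemma stack_count_half_ge:
  assumes c: "\<And>x y. c x y = 1 / 2" and w: "length w = 2 * m"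
  shows "stack_count c [] w \<ge> 2 ^ m / (2 * (real m + 1)\<^sup>2)"
proof (cases "m = 0")
  case True
  then show ?thesis using w by simp
next
  case False
  then obtain k where k: "m = Suc k" by (cases m) auto
  have "(real m + 1) * real ((2 * m) choose (m - 1)) = real m * real ((2 * m) choose m)"
  proof -
    have "Suc k * (2 * m choose Suc k) = (2 * m - k) * (2 * m choose k)"
      by (simp only: binomial_absorb_comp binomial_absorption)
    then have "m * (2 * m choose m) = (m + 1) * (2 * m choose (m - 1))"
      by (simp add: k)
    then have "real (m * (2 * m choose m)) = real ((m + 1) * (2 * m choose (m - 1)))"
      by (rule arg_cong)
    then show ?thesis by (simp only: of_nat_mult of_nat_add of_nat_1)
  qed
  then have "ballot 0 m = real ((2 * m) choose m) / (real m + 1)"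
    using False by (simp add: ballot_def field_simps)
  also have "\<dots> \<ge> 4 ^ m / (2 * real m) / (real m + 1)"
    using central_binomial_lower_bound[of m] False by (intro divide_right_mono) auto
  finally have "(1 / 2) ^ m * (4 ^ m / (2 * real m) / (real m + 1)) \<le> (1 / 2) ^ m * ballot 0 m"
    by (intro mult_left_mono) auto
  also have "\<dots> = stack_count c [] w" using stack_count_half[where s="[]" and m=m and w=w and c=c, OF c] w by simp
  also have "(1 / 2) ^ m * (4 ^ m / (2 * real m) / (real m + 1)) = 2 ^ m / (2 * (real m * (real m + 1)))"
  proof -
    have "(1 / 2) ^ m * 4 ^ m = (2::real) ^ m" by (simp add: power_mult_distrib[symmetric])
    then show ?thesis by (simp add: field_simps)
  qed
  finally have "2 ^ m / (2 * (real m * (real m + 1))) \<le> stack_count c [] w" .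
  moreover have "2 ^ m / (2 * (real m + 1)\<^sup>2) \<le> 2 ^ m / (2 * (real m * (real m + 1)))"
    using False by (intro divide_left_mono mult_left_mono) (auto simp: power2_eq_square)
  ultimately show ?thesis by linarith
qed

context schwinger_dyson begin

lemma crossing_sum_le:
  assumes "\<And>w1 x w2 y w3 x' w4 y' w5. w = w1 @ x # w2 @ y # w3 @ x' # w4 @ y' # w5 \<Longrightarrow>
     cov x x' * cov y y' * \<alpha> [w1 @ w4 @ w3 @ w2 @ w5] \<le> K" and "0 \<le> K" "length w \<le> L"
  shows "crossing_sum w \<le> real L ^ 4 * K"
proof -
  have *: "(\<Sum>(a, y, b)\<leftarrow>splits u. F a y b) \<le> real L * K'"
    if "\<And>a y b. u = a @ y # b \<Longrightarrow> F a y b \<le> K'" "length u \<le> L" "0 \<le> K'" for u K' and F :: "'l list \<Rightarrow> 'l \<Rightarrow> 'l list \<Rightarrow> real"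
    using order.trans[OF sum_list_splits_le[where u=u and F=F, OF that(1)] mult_right_mono[OF _ that(3)]] that(2) by auto
  have "crossing_sum w \<le> real L * (real L * (real L * (real L * K)))"
    unfolding crossing_sum_def csum_def using assms by (intro *) (auto intro!: mult_nonneg_nonneg)
  then show ?thesis by (simp add: power_def numeral_eq_Suc mult_ac)
qed

text \<open>Removing four letters creates at most four new runs, so the crossing term is at most
  \<open>q * L ^ 4 * (m + 1) ^ 4\<close> times the bound being proved for shorter words. Once that
  product is at most 1/2, the constant 2 reproduces itself as \<open>1 + 2 / 2\<close>.\<close>

lemma alpha_blocks_le:
  assumes c: "\<And>x y. cov x y \<le> 1" "\<And>x. cov x x = 0"
    and L: "q * (real L ^ 4 * (real m + 1) ^ 4) \<le> 1 / 2"
  shows "blocks m r w \<Longrightarrow> length w \<le> L \<Longrightarrow> \<alpha> [w] \<le> 2 * (real m + 1) ^ r"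
proof (induction "length w" arbitrary: w r rule: less_induct)
  case less
  have "crossing_sum w \<le> real L ^ 4 * (2 * (real m + 1) ^ (r + 4))"
  proof (rule crossing_sum_le[OF _ _ less.prems(2)])
    fix w1 x w2 y w3 x' w4 y' w5 assume w: "w = w1 @ x # w2 @ y # w3 @ x' # w4 @ y' # w5"
    obtain r1 s1 where 1: "blocks m r1 w1" "blocks m s1 (w2 @ y # w3 @ x' # w4 @ y' # w5)" "r1 + s1 \<le> Suc r"
      using blocks_split[OF less.prems(1) w] by blast
    obtain r2 s2 where 2: "blocks m r2 w2" "blocks m s2 (w3 @ x' # w4 @ y' # w5)" "r2 + s2 \<le> Suc s1"
      using blocks_split[OF 1(2) refl] by blast
    obtain r3 s3 where 3: "blocks m r3 w3" "blocks m s3 (w4 @ y' # w5)" "r3 + s3 \<le> Suc s2"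
      using blocks_split[OF 2(2) refl] by blast
    obtain r4 r5 where 4: "blocks m r4 w4" "blocks m r5 w5" "r4 + r5 \<le> Suc s3"
      using blocks_split[OF 3(2) refl] by blast
    have "blocks m (r1 + (r4 + (r3 + (r2 + r5)))) (w1 @ w4 @ w3 @ w2 @ w5)"
      using 1 2 3 4 by (intro blocks_append)
    then have "blocks m (r + 4) (w1 @ w4 @ w3 @ w2 @ w5)"
      by (rule blocks_mono) (use 1 2 3 4 in linarith)
    then have "\<alpha> [w1 @ w4 @ w3 @ w2 @ w5] \<le> 2 * (real m + 1) ^ (r + 4)"
      by (rule less.hyps[rotated]) (use w less.prems in auto)
    moreover have "cov x x' * cov y y' * \<alpha> [w1 @ w4 @ w3 @ w2 @ w5] \<le> 1 * 1 * \<alpha> [w1 @ w4 @ w3 @ w2 @ w5]"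
      using c cov_nonneg alpha_nonneg by (intro mult_mono) auto
    ultimately show "cov x x' * cov y y' * \<alpha> [w1 @ w4 @ w3 @ w2 @ w5] \<le> 2 * (real m + 1) ^ (r + 4)" by simp
  qed simp
  then have "q * crossing_sum w \<le> q * (real L ^ 4 * (2 * (real m + 1) ^ (r + 4)))"
    by (intro mult_left_mono q_nonneg)
  also have "\<dots> = (q * (real L ^ 4 * (real m + 1) ^ 4)) * (2 * (real m + 1) ^ r)"
    by (simp add: power_add mult_ac)
  also have "\<dots> \<le> 1 / 2 * (2 * (real m + 1) ^ r)"
    by (intro mult_right_mono L) simp
  finally show ?case
    using alpha_le_crossing_sum[of w] stack_count_blocks_le[where c=cov, OF cov_nonneg c less.prems(1), of "[]"] by simp
qed

lemma alpha_half_le: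
  assumes c: "\<And>x y. cov x y = 1 / 2" and L: "q * real L ^ 4 \<le> 1 / 2"
  shows "length w \<le> L \<Longrightarrow> \<alpha> [w] \<le> 2 * sqrt 2 ^ length w"
proof (induction "length w" arbitrary: w rule: less_induct)
  case less
  have "crossing_sum w \<le> real L ^ 4 * (2 * sqrt 2 ^ length w)"
  proof (rule crossing_sum_le[OF _ _ less.prems])
    fix w1 x w2 y w3 x' w4 y' w5 assume w: "w = w1 @ x # w2 @ y # w3 @ x' # w4 @ y' # w5"
    have "\<alpha> [w1 @ w4 @ w3 @ w2 @ w5] \<le> 2 * sqrt 2 ^ length (w1 @ w4 @ w3 @ w2 @ w5)"
      by (rule less.hyps) (use w less.prems in auto)
    also have "\<dots> \<le> 2 * sqrt 2 ^ length w"
      by (intro mult_left_mono power_increasing) (auto simp: w)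
    finally show "cov x x' * cov y y' * \<alpha> [w1 @ w4 @ w3 @ w2 @ w5] \<le> 2 * sqrt 2 ^ length w"
      using alpha_nonneg[of "[w1 @ w4 @ w3 @ w2 @ w5]"] by (simp add: c)
  qed simp
  then have "q * crossing_sum w \<le> q * (real L ^ 4 * (2 * sqrt 2 ^ length w))"
    by (intro mult_left_mono q_nonneg)
  also have "\<dots> = (q * real L ^ 4) * (2 * sqrt 2 ^ length w)"
    by (simp add: mult_ac)
  also have "\<dots> \<le> 1 / 2 * (2 * sqrt 2 ^ length w)"
    by (intro mult_right_mono L) simp
  finally show ?case
    using alpha_le_crossing_sum[of w] stack_count_half_le[where c=cov and s="[]", OF c, of w] by simp
qed

text \<open>Decorrelation of two traces: every fused word again falls under
  \<open>alpha_half_le\<close>, so the covariance is at most of order \<open>q\<close>. This feeds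
  the variance estimate for moments of fixed order.\<close>

lemma alpha_half_pair_le:
  assumes c: "\<And>x y. cov x y = 1 / 2" and L: "q * real L ^ 4 \<le> 1 / 2" and len: "length v + length w \<le> L"
  shows "\<alpha> [v, w] \<le> \<alpha> [v] * \<alpha> [w] + q * (real L ^ 2 * (2 * sqrt 2 ^ L))"
proof -
  have "(\<Sum>(w1, y, w2)\<leftarrow>splits v. \<Sum>(v1, z, v2)\<leftarrow>splits w. cov y z * \<alpha> [w1 @ v2 @ v1 @ w2])
     \<le> real (length v) * (real (length w) * (2 * sqrt 2 ^ L))"
  proof (intro sum_list_splits_le)
    fix w1 y w2 v1 z v2 assume v: "v = w1 @ y # w2" and w: "w = v1 @ z # v2"
    have "\<alpha> [w1 @ v2 @ v1 @ w2] \<le> 2 * sqrt 2 ^ length (w1 @ v2 @ v1 @ w2)"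
      by (rule alpha_half_le[OF c L]) (use v w len in auto)
    also have "\<dots> \<le> 2 * sqrt 2 ^ L"
      using len by (intro mult_left_mono power_increasing) (auto simp: v w)
    finally show "cov y z * \<alpha> [w1 @ v2 @ v1 @ w2] \<le> 2 * sqrt 2 ^ L"
      using alpha_nonneg[of "[w1 @ v2 @ v1 @ w2]"] by (simp add: c)
  qed
  also have "\<dots> = (real (length v) * real (length w)) * (2 * sqrt 2 ^ L)" by simp
  also have "\<dots> \<le> real L ^ 2 * (2 * sqrt 2 ^ L)"
    unfolding power2_eq_square using len by (intro mult_right_mono mult_mono) auto
  finally have "q * (\<Sum>(w1, y, w2)\<leftarrow>splits v. \<Sum>(v1, z, v2)\<leftarrow>splits w. cov y z * \<alpha> [w1 @ v2 @ v1 @ w2])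
     \<le> q * (real L ^ 2 * (2 * sqrt 2 ^ L))"
    by (intro mult_left_mono q_nonneg)
  then show ?thesis using alpha_append_le[of "[v]" w] by simp
qed

end

section \<open>Gaussian matrices and the Schwinger-Dyson equations\<close>

definition gauss_moment :: "nat \<Rightarrow> real" where
  "gauss_moment n = (\<integral>x. std_normal_density x * x ^ n \<partial>lborel)"

lemma gauss_moment_0 [simp]: "gauss_moment 0 = 1"
  using integral_normal_moment_even[of 1 0 0] by (simp add: gauss_moment_def)

lemma gauss_moment_1 [simp]: "gauss_moment (Suc 0) = 0"
  using integral_normal_moment_odd[of 1 0 0] by (simp add: gauss_moment_def)

lemma gauss_moment_Suc_Suc: "gauss_moment (Suc (Suc n)) = real (Suc n) * gauss_moment n"
proof (cases "even n")
  case True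
  then obtain k where n: "n = 2 * k" by (elim evenE)
  have "gauss_moment (2 * k) = fact (2 * k) / (2 ^ k * fact k)"
    using integral_normal_moment_even[of 1 0 k] by (simp add: gauss_moment_def)
  moreover have "gauss_moment (2 * Suc k) = fact (2 * Suc k) / (2 ^ Suc k * fact (Suc k))"
    using integral_normal_moment_even[of 1 0 "Suc k"] by (simp add: gauss_moment_def)
  moreover have "(fact (2 * Suc k) :: real) = (2 * real (Suc k)) * (real (Suc (2 * k)) * fact (2 * k))"
    by (simp add: algebra_simps)
  moreover have "2 ^ Suc k * (fact (Suc k) :: real) = (2 * real (Suc k)) * (2 ^ k * fact k)"
    by simp
  ultimately have "gauss_moment (2 * Suc k) = real (Suc (2 * k)) * gauss_moment (2 * k)"
    by (simp only: mult_divide_mult_cancel_left_if) simp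
  then show ?thesis by (simp add: n)
next
  case False
  then obtain k where n: "n = 2 * k + 1" by (elim oddE)
  have "gauss_moment (2 * k + 1) = 0"
    using integral_normal_moment_odd[of 1 0 k] by (simp add: gauss_moment_def)
  moreover have "gauss_moment (2 * Suc k + 1) = 0"
    using integral_normal_moment_odd[of 1 0 "Suc k"] by (simp add: gauss_moment_def)
  ultimately show ?thesis by (simp add: n)
qed

text \<open>Integration by parts for a monomial. At \<open>n = 0\<close> the truncated
  \<open>n - 1\<close> is harmless, as its factor is 0.\<close>

lemma gauss_moment_Suc: "gauss_moment (Suc n) = real n * gauss_moment (n - 1)"
  by (cases n) (simp_all add: gauss_moment_Suc_Suc)

locale std_gaussians = prob_space M for M :: "'a measure" +
  fixes Z :: "'k \<Rightarrow> 'a \<Rightarrow> real"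
  assumes distr: "\<And>k. distributed M lborel (Z k) std_normal_density"
    and indep: "indep_vars (\<lambda>_. borel) Z UNIV"
begin

definition mono :: "'k list \<Rightarrow> 'a \<Rightarrow> real" where
  "mono ks \<omega> = prod_list (map (\<lambda>k. Z k \<omega>) ks)"

lemma integrable_Z_power: "integrable M (\<lambda>\<omega>. Z k \<omega> ^ n)"
  using distributed_integrable[OF distr, of "\<lambda>x. x ^ n" k] integrable_normal_moment[of 1 0 n] by simp

lemma expectation_Z_power: "expectation (\<lambda>\<omega>. Z k \<omega> ^ n) = gauss_moment n"
  using distributed_integral[OF distr, of "\<lambda>x. x ^ n" k] by (simp add: gauss_moment_def)

lemma mono_eq:
  assumes "finite S" "set ks \<subseteq> S"
  shows "mono ks \<omega> = (\<Prod>k\<in>S. Z k \<omega> ^ count_list ks k)"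
  using assms(2)
proof (induction ks)
  case (Cons k ks)
  have "(\<Prod>j\<in>S. Z j \<omega> ^ count_list (k # ks) j) = (\<Prod>j\<in>S. (if j = k then Z k \<omega> else 1) * Z j \<omega> ^ count_list ks j)"
    by (intro prod.cong) auto
  also have "\<dots> = Z k \<omega> * (\<Prod>j\<in>S. Z j \<omega> ^ count_list ks j)"
    using assms Cons.prems by (simp add: prod.distrib)
  finally show ?case using Cons by (simp add: mono_def)
qed (simp add: mono_def)

lemma indep_powers: "indep_vars (\<lambda>_. borel) (\<lambda>k \<omega>. Z k \<omega> ^ c k) S"
  by (rule indep_vars_compose2[where Y="\<lambda>k x. x ^ c k", OF indep_vars_subset[OF indep]]) auto

lemma integrable_mono: "integrable M (mono ks)"
proof -
  have "integrable M (\<lambda>\<omega>. \<Prod>k\<in>set ks. Z k \<omega> ^ count_list ks k)"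
    by (rule indep_vars_integrable[OF _ indep_powers integrable_Z_power]) simp
  then show ?thesis by (simp add: mono_eq[of "set ks" ks] cong: Bochner_Integration.integrable_cong)
qed

lemma expectation_mono:
  assumes "finite S" "set ks \<subseteq> S"
  shows "expectation (mono ks) = (\<Prod>k\<in>S. gauss_moment (count_list ks k))"
  using indep_vars_lebesgue_integral[OF assms(1) indep_powers integrable_Z_power]
  by (simp add: mono_eq[OF assms] expectation_Z_power cong: Bochner_Integration.integral_cong)

lemma sum_list_splits_count:
  "(\<Sum>(a, y, b)\<leftarrow>splits ks. if y = k then (C::real) else 0) = real (count_list ks k) * C"
  by (induction ks) (simp_all add: case_prod_unfold o_def algebra_simps)

text \<open>By independence only the exponent of \<open>Z k\<close> is affected; its moment
  recursion yields as many equal terms as \<open>k\<close> occurs in \<open>ks\<close>.\<close>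

lemma wick_mono:
  "expectation (mono (k # ks)) = (\<Sum>(a, y, b)\<leftarrow>splits ks. of_bool (y = k) * expectation (mono (a @ b)))"
proof -
  define S where "S = insert k (set ks)"
  have S: "finite S" "set ks \<subseteq> S" "k \<in> S" by (auto simp: S_def)
  define C where "C = gauss_moment (count_list ks k - 1) * (\<Prod>j\<in>S-{k}. gauss_moment (count_list ks j))"
  have "(\<Sum>(a, y, b)\<leftarrow>splits ks. of_bool (y = k) * expectation (mono (a @ b))) = (\<Sum>(a, y, b)\<leftarrow>splits ks. if y = k then C else 0)"
  proof (intro sum_list_cong3)
    fix a y b assume "(a, y, b) \<in> set (splits ks)"
    then have ks: "ks = a @ y # b" by (rule splitsD)
    then have "set (a @ b) \<subseteq> S" using S by auto
    from expectation_mono[OF S(1) this] have "expectation (mono (a @ b)) = C" if "y = k"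
      using that S by (auto simp: ks C_def prod.remove[OF S(1,3)] intro!: prod.cong split: if_splits)
    then show "of_bool (y = k) * expectation (mono (a @ b)) = (if y = k then C else 0)" by simp
  qed
  also have "\<dots> = real (count_list ks k) * C" by (rule sum_list_splits_count)
  also have "\<dots> = gauss_moment (Suc (count_list ks k)) * (\<Prod>j\<in>S-{k}. gauss_moment (count_list ks j))"
    by (simp add: C_def gauss_moment_Suc)
  also have "(\<Prod>j\<in>S-{k}. gauss_moment (count_list ks j)) = (\<Prod>j\<in>S-{k}. gauss_moment (count_list (k # ks) j))"
    by (intro prod.cong) auto
  also have "gauss_moment (Suc (count_list ks k)) * \<dots> = (\<Prod>j\<in>S. gauss_moment (count_list (k # ks) j))"
    by (simp add: prod.remove[OF S(1,3)])
  also have "\<dots> = expectation (mono (k # ks))"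
    by (rule expectation_mono[symmetric]) (use S in auto)
  finally show ?thesis ..
qed

section \<open>Wick's formula for products of linear forms\<close>

definition lin :: "(complex \<times> 'k) list \<Rightarrow> 'a \<Rightarrow> complex" where
  "lin l \<omega> = (\<Sum>(c, k)\<leftarrow>l. c * of_real (Z k \<omega>))"

text \<open>Bilinear, without conjugation: entries of an adjoint matrix are separate linear forms
  that already carry conjugated coefficients.\<close>

definition lcov :: "(complex \<times> 'k) list \<Rightarrow> (complex \<times> 'k) list \<Rightarrow> complex" where
  "lcov l l' = (\<Sum>(c, k)\<leftarrow>l. \<Sum>(d, j)\<leftarrow>l'. c * d * of_bool (j = k))"

definition lprod :: "(complex \<times> 'k) list list \<Rightarrow> 'a \<Rightarrow> complex" where
  "lprod ls \<omega> = prod_list (map (\<lambda>l. lin l \<omega>) ls)"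

lemma lprod_simps [simp]: "lprod [] \<omega> = 1" "lprod (l # ls) \<omega> = lin l \<omega> * lprod ls \<omega>"
  "lprod (ls @ ms) \<omega> = lprod ls \<omega> * lprod ms \<omega>"
  by (simp_all add: lprod_def)

lemma lin_Nil [simp]: "lin [] \<omega> = 0" and lin_Cons [simp]: "lin ((c, k) # l) \<omega> = c * of_real (Z k \<omega>) + lin l \<omega>"
  by (simp_all add: lin_def)

lemma mono_lprod_Cons: "of_real (mono ks \<omega>) * (lin l \<omega> * P) = (\<Sum>(c, k)\<leftarrow>l. c * (of_real (mono (k # ks) \<omega>) * P))"
  by (induction l) (auto simp: mono_def algebra_simps)

lemma integrable_sum_list:
  fixes f :: "'i \<Rightarrow> 'a \<Rightarrow> complex"
  shows "(\<And>x. x \<in> set xs \<Longrightarrow> integrable M (f x)) \<Longrightarrow> integrable M (\<lambda>\<omega>. \<Sum>x\<leftarrow>xs. f x \<omega>)"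
  by (induction xs) auto

lemma integral_sum_list:
  fixes f :: "'i \<Rightarrow> 'a \<Rightarrow> complex"
  shows "(\<And>x. x \<in> set xs \<Longrightarrow> integrable M (f x)) \<Longrightarrow>
    (\<integral>\<omega>. (\<Sum>x\<leftarrow>xs. f x \<omega>) \<partial>M) = (\<Sum>x\<leftarrow>xs. \<integral>\<omega>. f x \<omega> \<partial>M)"
  by (induction xs) (auto simp: integrable_sum_list)

lemma integrable_mono_lprod: "integrable M (\<lambda>\<omega>. of_real (mono ks \<omega>) * lprod ls \<omega>)"
proof (induction ls arbitrary: ks)
  case Nil
  then show ?case by (simp add: integrable_mono)
next
  case (Cons l ls)
  show ?case unfolding lprod_simps mono_lprod_Cons case_prod_unfold
    by (intro integrable_sum_list integrable_mult_right Cons)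
qed

text \<open>A hybrid of monomials and linear forms, which lets the linear forms be expanded one at a
  time in the induction that lifts Wick's formula from variables to forms.\<close>

definition mixed :: "'k list \<Rightarrow> (complex \<times> 'k) list list \<Rightarrow> complex" where
  "mixed ks ls = (\<integral>\<omega>. of_real (mono ks \<omega>) * lprod ls \<omega> \<partial>M)"

lemma mixed_Cons: "mixed ks (l # ls) = (\<Sum>(c, k)\<leftarrow>l. c * mixed (k # ks) ls)"
  unfolding mixed_def lprod_simps mono_lprod_Cons case_prod_unfold
  by (subst integral_sum_list) (auto intro!: integrable_mult_right integrable_mono_lprod)

lemma mixed_swap: "mixed (j # k # ks) ls = mixed (k # j # ks) ls"
  by (simp add: mixed_def mono_def mult.left_commute)

lemma sum_list_swap23:
  fixes F :: "_ \<Rightarrow> _ \<Rightarrow> _ \<Rightarrow> _ \<Rightarrow> _ \<Rightarrow> 'd::comm_monoid_add"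
  shows "(\<Sum>(c, k)\<leftarrow>l. \<Sum>(a, y, b)\<leftarrow>xs. F c k a y b) = (\<Sum>(a, y, b)\<leftarrow>xs. \<Sum>(c, k)\<leftarrow>l. F c k a y b)"
  by (induction l) (simp_all add: case_prod_unfold sum_list_addf)

lemma wick_mixed:
  "mixed (k # ks) ls = (\<Sum>(a, y, b)\<leftarrow>splits ks. of_bool (y = k) * mixed (a @ b) ls) +
     (\<Sum>(a, y, b)\<leftarrow>splits ls. (\<Sum>(d, j)\<leftarrow>y. d * of_bool (j = k)) * mixed ks (a @ b))"
proof (induction ls arbitrary: ks)
  case Nil
  have "mixed ks [] = of_real (expectation (mono ks))" for ks
    by (simp add: mixed_def)
  moreover have "of_real (\<Sum>(a, y, b)\<leftarrow>xs. F a y b) = (\<Sum>(a, y, b)\<leftarrow>xs. complex_of_real (F a y b))"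
    for xs :: "('k list \<times> 'k \<times> 'k list) list" and F
    by (induction xs) auto
  moreover have "complex_of_real (of_bool P) = of_bool P" for P by simp
  ultimately show ?case by (simp only: wick_mono of_real_mult splits.simps list.map sum_list.Nil add_0_right)
next
  case (Cons l ls)
  have "mixed (k # ks) (l # ls) = (\<Sum>(d, j)\<leftarrow>l. d * mixed (k # j # ks) ls)"
    by (simp add: mixed_Cons mixed_swap)
  also have "\<dots> = (\<Sum>(d, j)\<leftarrow>l. d * (of_bool (j = k) * mixed ks ls) +
      (\<Sum>(a, y, b)\<leftarrow>splits ks. of_bool (y = k) * (d * mixed (j # a @ b) ls)) +
      (\<Sum>(a, y, b)\<leftarrow>splits ls. (\<Sum>(d, j)\<leftarrow>y. d * of_bool (j = k)) * (d * mixed (j # ks) (a @ b))))"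
    unfolding Cons.IH
    by (simp add: splits_Cons_sum distrib_left sum_list_cmult3[symmetric] add.assoc mult.left_commute
        del: splits.simps)
  also have "\<dots> = (\<Sum>(d, j)\<leftarrow>l. d * (of_bool (j = k) * mixed ks ls)) +
      (\<Sum>(d, j)\<leftarrow>l. \<Sum>(a, y, b)\<leftarrow>splits ks. of_bool (y = k) * (d * mixed (j # a @ b) ls)) +
      (\<Sum>(d, j)\<leftarrow>l. \<Sum>(a, y, b)\<leftarrow>splits ls. (\<Sum>(d, j)\<leftarrow>y. d * of_bool (j = k)) * (d * mixed (j # ks) (a @ b)))"
    by (simp only: case_prod_unfold sum_list_addf)
  also have "(\<Sum>(d, j)\<leftarrow>l. d * (of_bool (j = k) * mixed ks ls)) = (\<Sum>(d, j)\<leftarrow>l. d * of_bool (j = k)) * mixed ks ls"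
    by (simp only: case_prod_unfold sum_list_mult_const[symmetric] mult.assoc)
  also have "(\<Sum>(d, j)\<leftarrow>l. \<Sum>(a, y, b)\<leftarrow>splits ks. of_bool (y = k) * (d * mixed (j # a @ b) ls)) =
      (\<Sum>(a, y, b)\<leftarrow>splits ks. of_bool (y = k) * mixed (a @ b) (l # ls))"
    unfolding mixed_Cons
    by (subst sum_list_swap23, intro sum_list_cong3) (simp add: case_prod_unfold sum_list_const_mult)
  also have "(\<Sum>(d, j)\<leftarrow>l. \<Sum>(a, y, b)\<leftarrow>splits ls. (\<Sum>(d, j)\<leftarrow>y. d * of_bool (j = k)) * (d * mixed (j # ks) (a @ b))) =
      (\<Sum>(a, y, b)\<leftarrow>splits ls. (\<Sum>(d, j)\<leftarrow>y. d * of_bool (j = k)) * mixed ks (l # a @ b))"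
    unfolding mixed_Cons
    by (subst sum_list_swap23, intro sum_list_cong3) (simp add: case_prod_unfold sum_list_const_mult)
  finally show ?case
    by (simp add: splits_Cons_sum add_ac del: splits.simps)
qed

lemma wick:
  "(\<integral>\<omega>. lin l \<omega> * lprod ls \<omega> \<partial>M) = (\<Sum>(a, y, b)\<leftarrow>splits ls. lcov l y * (\<integral>\<omega>. lprod (a @ b) \<omega> \<partial>M))"
proof -
  have 1: "(\<integral>\<omega>. lprod ls \<omega> \<partial>M) = mixed [] ls" for ls
    by (simp add: mixed_def mono_def)
  have "mixed [] (l # ls) = (\<Sum>(c, k)\<leftarrow>l. \<Sum>(a, y, b)\<leftarrow>splits ls. c * (\<Sum>(d, j)\<leftarrow>y. d * of_bool (j = k)) * mixed [] (a @ b))"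
    by (simp add: mixed_Cons wick_mixed sum_list_cmult3[symmetric] mult.assoc)
  also have "\<dots> = (\<Sum>(a, y, b)\<leftarrow>splits ls. lcov l y * mixed [] (a @ b))"
    by (subst sum_list_swap23, intro sum_list_cong3)
      (simp add: lcov_def case_prod_unfold sum_list_mult_const sum_list_const_mult[symmetric] mult.assoc)
  finally show ?thesis unfolding lprod_simps(2)[symmetric] 1 .
qed

end

context std_gaussians begin

definition rep_val :: "(complex \<times> (complex \<times> 'k) list list) list \<Rightarrow> 'a \<Rightarrow> complex" where
  "rep_val R \<omega> = (\<Sum>(c, ls)\<leftarrow>R. c * lprod ls \<omega>)"

text \<open>The derivative is read off from a formal representation of the polynomial; different
  representations of one function may be used side by side.\<close>

definition rep_der :: "(complex \<times> (complex \<times> 'k) list list) list \<Rightarrow> (complex \<times> 'k) list \<Rightarrow> 'a \<Rightarrow> complex" where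
  "rep_der R l \<omega> = (\<Sum>(c, ls)\<leftarrow>R. c * (\<Sum>(a, y, b)\<leftarrow>splits ls. lcov l y * lprod (a @ b) \<omega>))"

text \<open>\<open>gpoly P D\<close>: \<open>P\<close> is a polynomial in the Gaussians and \<open>D l\<close> is its derivative in the
  direction dual to the linear form \<open>l\<close>.\<close>

definition gpoly :: "('a \<Rightarrow> complex) \<Rightarrow> ((complex \<times> 'k) list \<Rightarrow> 'a \<Rightarrow> complex) \<Rightarrow> bool" where
  "gpoly P D \<longleftrightarrow> (\<exists>R. P = rep_val R \<and> D = rep_der R)"

lemma rep_val_simps [simp]: "rep_val [] \<omega> = 0" "rep_val (r # R) \<omega> = fst r * lprod (snd r) \<omega> + rep_val R \<omega>"
  "rep_val (R @ S) \<omega> = rep_val R \<omega> + rep_val S \<omega>"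
  by (simp_all add: rep_val_def case_prod_unfold)

lemma rep_der_simps [simp]: "rep_der [] l \<omega> = 0"
  "rep_der (r # R) l \<omega> = fst r * (\<Sum>(a, y, b)\<leftarrow>splits (snd r). lcov l y * lprod (a @ b) \<omega>) + rep_der R l \<omega>"
  "rep_der (R @ S) l \<omega> = rep_der R l \<omega> + rep_der S l \<omega>"
  by (simp_all add: rep_der_def case_prod_unfold)

lemma integrable_lprod: "integrable M (lprod ls)"
  using integrable_mono_lprod[of "[]" ls] by (simp add: mono_def)

lemma gpoly_integrable: "gpoly P D \<Longrightarrow> integrable M P"
proof -
  have "integrable M (rep_val R)" for R
    unfolding rep_val_def case_prod_unfold
    by (intro integrable_sum_list integrable_mult_right integrable_lprod)
  then show "gpoly P D \<Longrightarrow> integrable M P" by (auto simp: gpoly_def)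
qed

lemma gpoly_wick:
  assumes "gpoly P D"
  shows "(\<integral>\<omega>. lin l \<omega> * P \<omega> \<partial>M) = (\<integral>\<omega>. D l \<omega> \<partial>M)" and "integrable M (D l)"
proof -
  have int: "integrable M (rep_val R)" "integrable M (\<lambda>\<omega>. lin l \<omega> * rep_val R \<omega>)" "integrable M (rep_der R l)"
     and "(\<integral>\<omega>. lin l \<omega> * rep_val R \<omega> \<partial>M) = (\<integral>\<omega>. rep_der R l \<omega> \<partial>M)" for R
  proof (induction R)
    case (Cons r R)
    obtain c ls where r: "r = (c, ls)" by (cases r)
    have i1: "integrable M (\<lambda>\<omega>. c * lprod ls \<omega>)" by (intro integrable_mult_right integrable_lprod)
    have i2: "integrable M (\<lambda>\<omega>. c * lprod (l # ls) \<omega>)" by (intro integrable_mult_right integrable_lprod)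
    have i3: "integrable M (\<lambda>\<omega>. \<Sum>(a, y, b)\<leftarrow>splits ls. lcov l y * lprod (a @ b) \<omega>)"
      unfolding case_prod_unfold by (intro integrable_sum_list integrable_mult_right integrable_lprod)
    {
      case 1 show ?case using Cons.IH i1 by (simp add: r)
    next
      case 2 show ?case using Cons.IH i2 by (simp add: r algebra_simps)
    next
      case 3 show ?case using Cons.IH i3 by (simp add: r)
    next
      case 4
      have eq: "lprod (l # ls) = (\<lambda>\<omega>. lin l \<omega> * lprod ls \<omega>)" by (simp add: fun_eq_iff)
      have "(\<integral>\<omega>. (\<Sum>(a, y, b)\<leftarrow>splits ls. lcov l y * lprod (a @ b) \<omega>) \<partial>M) = (\<integral>\<omega>. lprod (l # ls) \<omega> \<partial>M)"
        unfolding case_prod_unfold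
        by (subst integral_sum_list, intro integrable_mult_right integrable_lprod)
          (simp only: eq integral_mult_right_zero wick case_prod_unfold)
      moreover have "(\<integral>\<omega>. lin l \<omega> * rep_val (r # R) \<omega> \<partial>M) = (\<integral>\<omega>. c * lprod (l # ls) \<omega> + lin l \<omega> * rep_val R \<omega> \<partial>M)"
        by (simp add: r algebra_simps)
      moreover have "\<dots> = c * (\<integral>\<omega>. lprod (l # ls) \<omega> \<partial>M) + (\<integral>\<omega>. lin l \<omega> * rep_val R \<omega> \<partial>M)"
        using Bochner_Integration.integral_add[OF i2 Cons.IH(2)] by simp
      moreover have "(\<integral>\<omega>. rep_der (r # R) l \<omega> \<partial>M) =
        c * (\<integral>\<omega>. (\<Sum>(a, y, b)\<leftarrow>splits ls. lcov l y * lprod (a @ b) \<omega>) \<partial>M) + (\<integral>\<omega>. rep_der R l \<omega> \<partial>M)"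
        using Bochner_Integration.integral_add[OF integrable_mult_right[OF i3, of c] Cons.IH(3)]
        by (simp add: r)
      ultimately show ?case using Cons.IH(4) by simp
    }
  qed (simp_all add: rep_val_def[abs_def] rep_der_def[abs_def])
  then show "(\<integral>\<omega>. lin l \<omega> * P \<omega> \<partial>M) = (\<integral>\<omega>. D l \<omega> \<partial>M)" and "integrable M (D l)"
    using assms by (auto simp: gpoly_def)
qed

lemma gpoly_const: "gpoly (\<lambda>_. c) (\<lambda>_ _. 0)"
  unfolding gpoly_def by (intro exI[of _ "[(c, [])]"]) (auto simp: fun_eq_iff)

lemma gpoly_lin: "gpoly (lin l) (\<lambda>l0 _. lcov l0 l)"
  unfolding gpoly_def by (intro exI[of _ "[(1, [l])]"]) (auto simp: fun_eq_iff)

lemma gpoly_add: "gpoly P D \<Longrightarrow> gpoly Q E \<Longrightarrow> gpoly (\<lambda>\<omega>. P \<omega> + Q \<omega>) (\<lambda>l \<omega>. D l \<omega> + E l \<omega>)"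
  unfolding gpoly_def by (elim exE, rename_tac R S, rule_tac x="R @ S" in exI) (auto simp: fun_eq_iff)

lemma gpoly_mult:
  assumes "gpoly P D" "gpoly Q E"
  shows "gpoly (\<lambda>\<omega>. P \<omega> * Q \<omega>) (\<lambda>l \<omega>. D l \<omega> * Q \<omega> + P \<omega> * E l \<omega>)"
proof -
  define m1 where "m1 c ls S = map (\<lambda>r. (c * fst r, ls @ snd r)) S"
    for c :: complex and ls :: "(complex \<times> 'k) list list" and S :: "(complex \<times> (complex \<times> 'k) list list) list"
  have m1: "rep_val (m1 c ls S) \<omega> = c * lprod ls \<omega> * rep_val S \<omega>"
    "rep_der (m1 c ls S) l \<omega> = c * (\<Sum>(a, y, b)\<leftarrow>splits ls. lcov l y * lprod (a @ b) \<omega>) * rep_val S \<omega> + c * lprod ls \<omega> * rep_der S l \<omega>"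
    for c ls S l \<omega>
  proof (induction S)
    case (Cons r S)
    {
      case 1 show ?case using Cons by (simp add: m1_def algebra_simps)
    next
      case 2
      have "(\<Sum>(a, y, b)\<leftarrow>splits (ls @ snd r). lcov l y * lprod (a @ b) \<omega>) =
        (\<Sum>(a, y, b)\<leftarrow>splits ls. lcov l y * lprod (a @ b) \<omega>) * lprod (snd r) \<omega> +
        lprod ls \<omega> * (\<Sum>(a, y, b)\<leftarrow>splits (snd r). lcov l y * lprod (a @ b) \<omega>)"
        by (simp add: splits_append_sum sum_list_multc3[symmetric] sum_list_cmult3[symmetric] mult_ac)
      then show ?case using Cons by (simp add: m1_def algebra_simps)
    }
  qed (simp_all add: m1_def)
  define mm where "mm R S = concat (map (\<lambda>r. m1 (fst r) (snd r) S) R)" for R S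
  have mm: "rep_val (mm R S) \<omega> = rep_val R \<omega> * rep_val S \<omega>"
    "rep_der (mm R S) l \<omega> = rep_der R l \<omega> * rep_val S \<omega> + rep_val R \<omega> * rep_der S l \<omega>" for R S l \<omega>
    by (induction R) (simp_all add: mm_def m1 algebra_simps)
  from assms obtain R S where "P = rep_val R" "D = rep_der R" "Q = rep_val S" "E = rep_der S"
    by (auto simp: gpoly_def)
  then show ?thesis unfolding gpoly_def by (intro exI[of _ "mm R S"]) (simp add: mm fun_eq_iff)
qed

lemma gpoly_sum:
  "(\<And>i. i \<in> I \<Longrightarrow> gpoly (P i) (D i)) \<Longrightarrow> gpoly (\<lambda>\<omega>. \<Sum>i\<in>I. P i \<omega>) (\<lambda>l \<omega>. \<Sum>i\<in>I. D i l \<omega>)"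
  by (induction I rule: infinite_finite_induct) (auto intro: gpoly_const gpoly_add)

lemma gpoly_cmult: "gpoly P D \<Longrightarrow> gpoly (\<lambda>\<omega>. c * P \<omega>) (\<lambda>l \<omega>. c * D l \<omega>)"
  using gpoly_mult[OF gpoly_const[of c]] by simp

end

section \<open>Words in Gaussian matrices and their loop equations\<close>

fun word_mat :: "nat \<Rightarrow> ('l \<Rightarrow> nat \<Rightarrow> nat \<Rightarrow> complex) \<Rightarrow> 'l list \<Rightarrow> nat \<Rightarrow> nat \<Rightarrow> complex" where
  "word_mat N A [] i j = of_bool (i = j)"
| "word_mat N A (x # u) i j = (\<Sum>k<N. A x i k * word_mat N A u k j)"

definition ntrace :: "nat \<Rightarrow> (nat \<Rightarrow> nat \<Rightarrow> complex) \<Rightarrow> complex" where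
  "ntrace N B = (\<Sum>i<N. B i i) / of_nat N"

definition word_traces :: "nat \<Rightarrow> ('l \<Rightarrow> nat \<Rightarrow> nat \<Rightarrow> complex) \<Rightarrow> 'l list list \<Rightarrow> complex" where
  "word_traces N A ws = prod_list (map (\<lambda>w. ntrace N (word_mat N A w)) ws)"

lemma word_mat_append:
  "i < N \<Longrightarrow> word_mat N A (u @ v) i j = (\<Sum>k<N. word_mat N A u i k * word_mat N A v k j)"
proof (induction u arbitrary: i)
  case Nil
  have "(\<Sum>k<N. of_bool (i = k) * word_mat N A v k j) = (\<Sum>k<N. if k = i then word_mat N A v k j else 0)"
    by (intro sum.cong) auto
  with Nil show ?case by simp
next
  case (Cons x u)
  then show ?case by (simp add: sum_distrib_left sum_distrib_right mult.assoc) (rule sum.swap)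
qed

lemma sum_list_sum_swap:
  fixes F :: "_ \<Rightarrow> _ \<Rightarrow> _ \<Rightarrow> _ \<Rightarrow> 'b::comm_monoid_add"
  shows "(\<Sum>i\<in>I. \<Sum>(a, y, b)\<leftarrow>xs. F i a y b) = (\<Sum>(a, y, b)\<leftarrow>xs. \<Sum>i\<in>I. F i a y b)"
  by (induction xs) (simp_all add: sum.distrib case_prod_unfold)

text \<open>The index pattern \<open>j = k\<close>, \<open>i = l\<close> makes the contraction of
  two letters cut or glue matrix products. Both \<open>G\<close> with its adjoint and a single
  Hermitian letter are instances, with different \<open>c\<close>.\<close>

locale gaussian_letters = std_gaussians M Z for M :: "'a measure" and Z :: "'k \<Rightarrow> 'a \<Rightarrow> real" +
  fixes N :: nat and c :: "'l \<Rightarrow> 'l \<Rightarrow> real" and Lf :: "'l \<Rightarrow> nat \<Rightarrow> nat \<Rightarrow> (complex \<times> 'k) list"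
  assumes N_pos: "0 < N" and c_nonneg: "0 \<le> c x y" and c_sym: "c x y = c y x"
    and lcov_Lf: "i < N \<Longrightarrow> j < N \<Longrightarrow> k < N \<Longrightarrow> l < N \<Longrightarrow>
      lcov (Lf x i j) (Lf y k l) = of_real (c x y) / of_nat N * of_bool (j = k \<and> i = l)"
begin

definition L :: "'a \<Rightarrow> 'l \<Rightarrow> nat \<Rightarrow> nat \<Rightarrow> complex" where
  "L \<omega> x i j = lin (Lf x i j) \<omega>"

abbreviation "W w i j \<omega> \<equiv> word_mat N (L \<omega>) w i j"
abbreviation "T w \<omega> \<equiv> ntrace N (word_mat N (L \<omega>) w)"

lemma gpoly_word:
  "i < N \<Longrightarrow> gpoly (W w i j) (\<lambda>l0 \<omega>. \<Sum>(a, y, b)\<leftarrow>splits w. \<Sum>k<N. \<Sum>l<N. W a i k \<omega> * lcov l0 (Lf y k l) * W b l j \<omega>)"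
proof (induction w arbitrary: i)
  case Nil
  then show ?case using gpoly_const[of "of_bool (i = j)"] by simp
next
  case (Cons x w)
  have "gpoly (\<lambda>\<omega>. \<Sum>k<N. L \<omega> x i k * W w k j \<omega>)
    (\<lambda>l0 \<omega>. \<Sum>k<N. lcov l0 (Lf x i k) * W w k j \<omega> + L \<omega> x i k *
      (\<Sum>(a, y, b)\<leftarrow>splits w. \<Sum>k'<N. \<Sum>l<N. W a k k' \<omega> * lcov l0 (Lf y k' l) * W b l j \<omega>))"
    unfolding L_def[abs_def] using Cons.IH[unfolded L_def[abs_def]]
    by (intro gpoly_sum gpoly_mult gpoly_lin) auto
  moreover have "(\<Sum>k<N. lcov l0 (Lf x i k) * W w k j \<omega> + L \<omega> x i k *
      (\<Sum>(a, y, b)\<leftarrow>splits w. \<Sum>k'<N. \<Sum>l<N. W a k k' \<omega> * lcov l0 (Lf y k' l) * W b l j \<omega>)) =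
    (\<Sum>(a, y, b)\<leftarrow>splits (x # w). \<Sum>k<N. \<Sum>l<N. W a i k \<omega> * lcov l0 (Lf y k l) * W b l j \<omega>)" for l0 \<omega>
  proof -
    have 1: "(\<Sum>k<N. \<Sum>l<N. W [] i k \<omega> * lcov l0 (Lf x k l) * W w l j \<omega>) = (\<Sum>l<N. lcov l0 (Lf x i l) * W w l j \<omega>)"
      using Cons.prems by (subst sum.swap) (simp add: of_bool_def if_distrib if_distribR cong: if_cong)
    have 2: "(\<Sum>k<N. L \<omega> x i k * (\<Sum>(a, y, b)\<leftarrow>splits w. \<Sum>k'<N. \<Sum>l<N. W a k k' \<omega> * lcov l0 (Lf y k' l) * W b l j \<omega>)) =
      (\<Sum>(a, y, b)\<leftarrow>splits w. \<Sum>k'<N. \<Sum>l<N. W (x # a) i k' \<omega> * lcov l0 (Lf y k' l) * W b l j \<omega>)"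
      unfolding sum_list_cmult3[symmetric] sum_list_sum_swap
    proof (intro sum_list_cong3)
      fix a y b
      show "(\<Sum>k<N. L \<omega> x i k * (\<Sum>k'<N. \<Sum>l<N. W a k k' \<omega> * lcov l0 (Lf y k' l) * W b l j \<omega>)) =
        (\<Sum>k'<N. \<Sum>l<N. W (x # a) i k' \<omega> * lcov l0 (Lf y k' l) * W b l j \<omega>)"
        unfolding sum_distrib_left word_mat.simps sum_distrib_right
        by (subst sum.swap, rule sum.cong[OF refl], subst sum.swap) (simp add: mult.assoc)
    qed
    show ?thesis unfolding splits_Cons_sum sum.distrib 1 2 ..
  qed
  ultimately show ?case by simp
qed

lemma gpoly_ntrace: "gpoly (T w) (\<lambda>l0 \<omega>. (\<Sum>i<N. \<Sum>(a, y, b)\<leftarrow>splits w. \<Sum>k<N. \<Sum>l<N. W a i k \<omega> * lcov l0 (Lf y k l) * W b l i \<omega>) / of_nat N)"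
proof -
  have "gpoly (\<lambda>\<omega>. 1 / of_nat N * (\<Sum>i<N. W w i i \<omega>)) (\<lambda>l0 \<omega>. 1 / of_nat N *
    (\<Sum>i<N. \<Sum>(a, y, b)\<leftarrow>splits w. \<Sum>k<N. \<Sum>l<N. W a i k \<omega> * lcov l0 (Lf y k l) * W b l i \<omega>))"
    by (intro gpoly_cmult gpoly_sum gpoly_word) simp
  then show ?thesis by (simp add: ntrace_def)
qed

text \<open>Restricts the derivative to directions that are matrix entries, where the covariance
  pattern collapses the sums and gives closed formulas.\<close>

definition gder :: "('a \<Rightarrow> complex) \<Rightarrow> ('l \<Rightarrow> nat \<Rightarrow> nat \<Rightarrow> 'a \<Rightarrow> complex) \<Rightarrow> bool" where
  "gder P D \<longleftrightarrow> (\<exists>E. gpoly P E \<and> (\<forall>x i j. i < N \<longrightarrow> j < N \<longrightarrow> E (Lf x i j) = D x i j))"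

lemma sum_lcov:
  assumes "i < N" "j < N"
  shows "(\<Sum>k<N. \<Sum>l<N. f k * lcov (Lf x i j) (Lf y k l) * g l) = of_real (c x y) / of_nat N * (f j * g i)"
proof -
  have "(\<Sum>k<N. \<Sum>l<N. f k * lcov (Lf x i j) (Lf y k l) * g l) =
    (\<Sum>k<N. \<Sum>l<N. if l = i then (if k = j then of_real (c x y) / of_nat N * (f j * g i) else 0) else 0)"
    using assms by (intro sum.cong refl) (auto simp: lcov_Lf)
  also have "\<dots> = of_real (c x y) / of_nat N * (f j * g i)"
    using assms by simp
  finally show ?thesis .
qed

lemma gder_word:
  assumes "k < N"
  shows "gder (W w k m) (\<lambda>x i j \<omega>. \<Sum>(a, y, b)\<leftarrow>splits w. of_real (c x y) / of_nat N * (W a k j \<omega> * W b i m \<omega>))"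
  unfolding gder_def
  by (intro exI[of _ "\<lambda>l0 \<omega>. \<Sum>(a, y, b)\<leftarrow>splits w. \<Sum>p<N. \<Sum>l<N. W a k p \<omega> * lcov l0 (Lf y p l) * W b l m \<omega>"] conjI gpoly_word assms)
    (auto simp: sum_lcov fun_eq_iff)

text \<open>By cyclicity the pieces around the removed letter join to \<open>b @ a\<close>. One
  factor \<open>1 / N\<close> is the covariance, the other the normalisation of the trace.\<close>

lemma gder_ntrace:
  "gder (T w) (\<lambda>x i j \<omega>. \<Sum>(a, y, b)\<leftarrow>splits w. of_real (c x y) / of_nat N ^ 2 * W (b @ a) i j \<omega>)"
  unfolding gder_def
proof (intro exI conjI, rule gpoly_ntrace, intro allI impI ext)
  fix x i j \<omega> assume ij: "i < N" "j < N"
  have "(\<Sum>m<N. \<Sum>(a, y, b)\<leftarrow>splits w. \<Sum>k<N. \<Sum>l<N. W a m k \<omega> * lcov (Lf x i j) (Lf y k l) * W b l m \<omega>) / of_nat N =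
     1 / of_nat N * (\<Sum>(a, y, b)\<leftarrow>splits w. of_real (c x y) / of_nat N * (\<Sum>m<N. W a m j \<omega> * W b i m \<omega>))"
    by (simp only: sum_list_sum_swap sum_lcov[OF ij] sum_distrib_left) simp
  also have "\<dots> = (\<Sum>(a, y, b)\<leftarrow>splits w. of_real (c x y) / of_nat N ^ 2 * W (b @ a) i j \<omega>)"
    unfolding sum_list_cmult3[symmetric] using ij by (simp add: word_mat_append power2_eq_square mult.commute)
  finally show "(\<Sum>m<N. \<Sum>(a, y, b)\<leftarrow>splits w. \<Sum>k<N. \<Sum>l<N. W a m k \<omega> * lcov (Lf x i j) (Lf y k l) * W b l m \<omega>) / of_nat N =
    (\<Sum>(a, y, b)\<leftarrow>splits w. of_real (c x y) / of_nat N ^ 2 * W (b @ a) i j \<omega>)" .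
qed

lemma gder_mult: "gder P D \<Longrightarrow> gder Q E \<Longrightarrow> gder (\<lambda>\<omega>. P \<omega> * Q \<omega>) (\<lambda>x i j \<omega>. D x i j \<omega> * Q \<omega> + P \<omega> * E x i j \<omega>)"
  unfolding gder_def by (elim exE conjE, rule exI, rule conjI, erule (1) gpoly_mult) auto

lemma gder_wick:
  "gder P D \<Longrightarrow> i < N \<Longrightarrow> j < N \<Longrightarrow> (\<integral>\<omega>. L \<omega> x i j * P \<omega> \<partial>M) = (\<integral>\<omega>. D x i j \<omega> \<partial>M)"
  unfolding gder_def L_def using gpoly_wick(1) by fastforce

lemma integrable_gder_der: "gder P D \<Longrightarrow> i < N \<Longrightarrow> j < N \<Longrightarrow> integrable M (D x i j)"
  unfolding gder_def by (elim exE conjE, drule gpoly_wick(2)[of P _ "Lf x i j"]) simp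

lemma gder_traces:
  "gder (\<lambda>\<omega>. word_traces N (L \<omega>) ws) (\<lambda>x i j \<omega>. \<Sum>(ws1, w, ws2)\<leftarrow>splits ws.
     (\<Sum>(a, y, b)\<leftarrow>splits w. of_real (c x y) / of_nat N ^ 2 * W (b @ a) i j \<omega>) * word_traces N (L \<omega>) (ws1 @ ws2))"
proof (induction ws)
  case Nil
  then show ?case
    unfolding gder_def word_traces_def by (intro exI[of _ "\<lambda>_ _. 0"]) (auto simp: gpoly_const fun_eq_iff)
next
  case (Cons w ws)
  show ?case using gder_mult[OF gder_ntrace[of w] Cons]
    by (simp add: word_traces_def splits_Cons_sum sum_list_cmult3[symmetric] mult_ac del: splits.simps)
qed

lemma integrable_gder: "gder P D \<Longrightarrow> integrable M P"
  by (auto simp: gder_def gpoly_integrable)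

lemma integrable_traces: "integrable M (\<lambda>\<omega>. word_traces N (L \<omega>) ws)"
  by (rule integrable_gder[OF gder_traces])

text \<open>The trace of \<open>x # u\<close> is a sum of entries of the letter \<open>x\<close>
  times entries of \<open>u\<close>. Integrating the former by parts and using the product rule, the
  derivative either hits \<open>u\<close>, which cuts the trace, or hits another trace, which is
  then fused with it.\<close>

lemma expectation_traces_Cons:
  "(\<integral>\<omega>. word_traces N (L \<omega>) ((x # u) # ws) \<partial>M) =
    (\<Sum>(a, y, b)\<leftarrow>splits u. of_real (c x y) * (\<integral>\<omega>. word_traces N (L \<omega>) (b # a # ws) \<partial>M)) +
    1 / of_nat N ^ 2 * (\<Sum>(ws1, w, ws2)\<leftarrow>splits ws. \<Sum>(a, y, b)\<leftarrow>splits w.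
      of_real (c x y) * (\<integral>\<omega>. word_traces N (L \<omega>) ((b @ a @ u) # ws1 @ ws2) \<partial>M))"
proof -
  define PT where "PT ws \<omega> = word_traces N (L \<omega>) ws" for ws \<omega>
  define D where "D i k \<omega> = (\<Sum>(a, y, b)\<leftarrow>splits u. of_real (c x y) / of_nat N * (W a k k \<omega> * W b i i \<omega>)) * PT ws \<omega> +
     W u k i \<omega> * (\<Sum>(ws1, w, ws2)\<leftarrow>splits ws.
     (\<Sum>(a, y, b)\<leftarrow>splits w. of_real (c x y) / of_nat N ^ 2 * W (b @ a) i k \<omega>) * PT (ws1 @ ws2) \<omega>)" for i k \<omega>
  have g: "gder (\<lambda>\<omega>. W u k m \<omega> * PT ws \<omega>) (\<lambda>x i j \<omega>.
     (\<Sum>(a, y, b)\<leftarrow>splits u. of_real (c x y) / of_nat N * (W a k j \<omega> * W b i m \<omega>)) * PT ws \<omega> +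
     W u k m \<omega> * (\<Sum>(ws1, w, ws2)\<leftarrow>splits ws.
     (\<Sum>(a, y, b)\<leftarrow>splits w. of_real (c x y) / of_nat N ^ 2 * W (b @ a) i j \<omega>) * PT (ws1 @ ws2) \<omega>))"
    if "k < N" for k m
    unfolding PT_def by (intro gder_mult gder_word gder_traces that)
  have int: "integrable M (\<lambda>\<omega>. L \<omega> x i k * (W u k i \<omega> * PT ws \<omega>))" if "i < N" "k < N" for i k
  proof -
    have "gpoly (\<lambda>\<omega>. L \<omega> x i k) (\<lambda>l0 _. lcov l0 (Lf x i k))"
      unfolding L_def using gpoly_lin[of "Lf x i k"] by simp
    moreover obtain E where "gpoly (\<lambda>\<omega>. W u k i \<omega> * PT ws \<omega>) E"
      using g[OF \<open>k < N\<close>, of i] unfolding gder_def by blast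
    ultimately show ?thesis by (rule gpoly_integrable[OF gpoly_mult])
  qed
  have wk: "(\<integral>\<omega>. L \<omega> x i k * (W u k i \<omega> * PT ws \<omega>) \<partial>M) = (\<integral>\<omega>. D i k \<omega> \<partial>M)" if "i < N" "k < N" for i k
    unfolding D_def by (rule gder_wick[OF g[OF that(2)] that])
  have "PT ((x # u) # ws) = (\<lambda>\<omega>. 1 / of_nat N * (\<Sum>i<N. \<Sum>k<N. L \<omega> x i k * (W u k i \<omega> * PT ws \<omega>)))"
    by (auto simp: PT_def word_traces_def fun_eq_iff ntrace_def sum_distrib_right mult.assoc)
  note * = this
  have "(\<integral>\<omega>. PT ((x # u) # ws) \<omega> \<partial>M) = 1 / of_nat N * (\<Sum>i<N. \<Sum>k<N. \<integral>\<omega>. L \<omega> x i k * (W u k i \<omega> * PT ws \<omega>) \<partial>M)"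
  proof -
    have "(\<integral>\<omega>. (\<Sum>i<N. \<Sum>k<N. L \<omega> x i k * (W u k i \<omega> * PT ws \<omega>)) \<partial>M) =
      (\<Sum>i<N. \<integral>\<omega>. (\<Sum>k<N. L \<omega> x i k * (W u k i \<omega> * PT ws \<omega>)) \<partial>M)"
      by (intro Bochner_Integration.integral_sum Bochner_Integration.integrable_sum int) auto
    also have "\<dots> = (\<Sum>i<N. \<Sum>k<N. \<integral>\<omega>. L \<omega> x i k * (W u k i \<omega> * PT ws \<omega>) \<partial>M)"
      by (intro sum.cong refl Bochner_Integration.integral_sum int) auto
    finally show ?thesis by (simp only: * integral_mult_right_zero)
  qed
  also have "\<dots> = 1 / of_nat N * (\<Sum>i<N. \<Sum>k<N. \<integral>\<omega>. D i k \<omega> \<partial>M)"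
    by (simp add: wk)
  also have "\<dots> = (\<integral>\<omega>. 1 / of_nat N * (\<Sum>i<N. \<Sum>k<N. D i k \<omega>) \<partial>M)"
  proof -
    have intD: "integrable M (\<lambda>\<omega>. D i k \<omega>)" if "i < N" "k < N" for i k
      unfolding D_def by (rule integrable_gder_der[OF g[OF that(2)] that])
    have "(\<integral>\<omega>. (\<Sum>i<N. \<Sum>k<N. D i k \<omega>) \<partial>M) = (\<Sum>i<N. \<integral>\<omega>. (\<Sum>k<N. D i k \<omega>) \<partial>M)"
      by (intro Bochner_Integration.integral_sum Bochner_Integration.integrable_sum intD) auto
    also have "\<dots> = (\<Sum>i<N. \<Sum>k<N. \<integral>\<omega>. D i k \<omega> \<partial>M)"
      by (intro sum.cong refl Bochner_Integration.integral_sum intD) auto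
    finally show ?thesis by (simp only: integral_mult_right_zero)
  qed
  also have "(\<lambda>\<omega>. 1 / of_nat N * (\<Sum>i<N. \<Sum>k<N. D i k \<omega>)) = (\<lambda>\<omega>. (\<Sum>(a, y, b)\<leftarrow>splits u. of_real (c x y) * PT (b # a # ws) \<omega>) +
      1 / of_nat N ^ 2 * (\<Sum>(ws1, w, ws2)\<leftarrow>splits ws. \<Sum>(a, y, b)\<leftarrow>splits w. of_real (c x y) * PT ((b @ a @ u) # ws1 @ ws2) \<omega>))"
  proof
    fix \<omega>
    have 1: "1 / of_nat N * (\<Sum>i<N. \<Sum>k<N. (\<Sum>(a, y, b)\<leftarrow>splits u. of_real (c x y) / of_nat N * (W a k k \<omega> * W b i i \<omega>)) * PT ws \<omega>) =
      (\<Sum>(a, y, b)\<leftarrow>splits u. of_real (c x y) * PT (b # a # ws) \<omega>)"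
      unfolding sum_list_multc3[symmetric] sum_list_sum_swap sum_list_cmult3[symmetric]
    proof (intro sum_list_cong3)
      fix a y b
      have "(\<Sum>i<N. \<Sum>k<N. of_real (c x y) / of_nat N * (W a k k \<omega> * W b i i \<omega>) * PT ws \<omega>) =
        of_real (c x y) / of_nat N * PT ws \<omega> * ((\<Sum>i<N. W b i i \<omega>) * (\<Sum>k<N. W a k k \<omega>))"
        unfolding sum_product unfolding sum_distrib_left by (intro sum.cong refl) simp
      then show "1 / of_nat N * (\<Sum>i<N. \<Sum>k<N. of_real (c x y) / of_nat N * (W a k k \<omega> * W b i i \<omega>) * PT ws \<omega>) =
        of_real (c x y) * PT (b # a # ws) \<omega>"
        using N_pos by (simp add: PT_def word_traces_def ntrace_def)
    qed
    have 2: "1 / of_nat N * (\<Sum>i<N. \<Sum>k<N. W u k i \<omega> * (\<Sum>(ws1, w, ws2)\<leftarrow>splits ws.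
     (\<Sum>(a, y, b)\<leftarrow>splits w. of_real (c x y) / of_nat N ^ 2 * W (b @ a) i k \<omega>) * PT (ws1 @ ws2) \<omega>)) =
      1 / of_nat N ^ 2 * (\<Sum>(ws1, w, ws2)\<leftarrow>splits ws. \<Sum>(a, y, b)\<leftarrow>splits w. of_real (c x y) * PT ((b @ a @ u) # ws1 @ ws2) \<omega>)"
      unfolding sum_list_multc3[symmetric] sum_list_cmult3[symmetric] sum_list_sum_swap
    proof (intro sum_list_cong3)
      fix ws1 w ws2 a y b
      have "(\<Sum>i<N. \<Sum>k<N. W u k i \<omega> * (of_real (c x y) / of_nat N ^ 2 * W (b @ a) i k \<omega> * PT (ws1 @ ws2) \<omega>)) =
         of_real (c x y) / of_nat N ^ 2 * PT (ws1 @ ws2) \<omega> * (\<Sum>i<N. \<Sum>k<N. W (b @ a) i k \<omega> * W u k i \<omega>)"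
        unfolding sum_distrib_left by (intro sum.cong refl) simp
      also have "(\<Sum>i<N. \<Sum>k<N. W (b @ a) i k \<omega> * W u k i \<omega>) = (\<Sum>i<N. W (b @ a @ u) i i \<omega>)"
        using word_mat_append[of _ N "L \<omega>" "b @ a" u] by (intro sum.cong refl) simp
      finally show "1 / of_nat N * (\<Sum>i<N. \<Sum>k<N. W u k i \<omega> * (of_real (c x y) / of_nat N ^ 2 * W (b @ a) i k \<omega> * PT (ws1 @ ws2) \<omega>)) =
        1 / of_nat N ^ 2 * (of_real (c x y) * PT ((b @ a @ u) # ws1 @ ws2) \<omega>)"
        by (simp add: PT_def word_traces_def ntrace_def mult_ac)
    qed
    show "1 / of_nat N * (\<Sum>i<N. \<Sum>k<N. D i k \<omega>) = (\<Sum>(a, y, b)\<leftarrow>splits u. of_real (c x y) * PT (b # a # ws) \<omega>) +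
      1 / of_nat N ^ 2 * (\<Sum>(ws1, w, ws2)\<leftarrow>splits ws. \<Sum>(a, y, b)\<leftarrow>splits w. of_real (c x y) * PT ((b @ a @ u) # ws1 @ ws2) \<omega>)"
      unfolding D_def sum.distrib distrib_left 1 2 ..
  qed
  also have "(\<integral>\<omega>. (\<Sum>(a, y, b)\<leftarrow>splits u. of_real (c x y) * PT (b # a # ws) \<omega>) +
      1 / of_nat N ^ 2 * (\<Sum>(ws1, w, ws2)\<leftarrow>splits ws. \<Sum>(a, y, b)\<leftarrow>splits w. of_real (c x y) * PT ((b @ a @ u) # ws1 @ ws2) \<omega>) \<partial>M) =
    (\<Sum>(a, y, b)\<leftarrow>splits u. of_real (c x y) * (\<integral>\<omega>. PT (b # a # ws) \<omega> \<partial>M)) +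
    1 / of_nat N ^ 2 * (\<Sum>(ws1, w, ws2)\<leftarrow>splits ws. \<Sum>(a, y, b)\<leftarrow>splits w.
      of_real (c x y) * (\<integral>\<omega>. PT ((b @ a @ u) # ws1 @ ws2) \<omega> \<partial>M))"
  proof -
    have i: "integrable M (\<lambda>\<omega>. k * PT ws \<omega>)" for k ws
      unfolding PT_def by (intro integrable_mult_right integrable_traces)
    have i3: "integrable M (\<lambda>\<omega>. \<Sum>(a, y, b)\<leftarrow>xs. F a y b \<omega>)"
        and s3: "(\<integral>\<omega>. (\<Sum>(a, y, b)\<leftarrow>xs. F a y b \<omega>) \<partial>M) = (\<Sum>(a, y, b)\<leftarrow>xs. \<integral>\<omega>. F a y b \<omega> \<partial>M)"
      if "\<And>a y b. integrable M (F a y b)" for xs :: "('p \<times> 'q \<times> 'r) list" and F :: "'p \<Rightarrow> 'q \<Rightarrow> 'r \<Rightarrow> 'a \<Rightarrow> complex"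
      unfolding case_prod_unfold by (intro integrable_sum_list integral_sum_list that)+
    show ?thesis
      by (subst Bochner_Integration.integral_add, intro i3 i, intro integrable_mult_right i3 i)
        (simp only: integral_mult_right_zero s3 i3 i)
  qed
  finally show ?thesis unfolding PT_def .
qed

text \<open>The coefficients of the loop equations are real, so the real parts satisfy the recursion
  among themselves.\<close>

lemma schwinger_dyson_expectation:
  "schwinger_dyson c (1 / real N ^ 2) (\<lambda>ws. Re (\<integral>\<omega>. word_traces N (L \<omega>) ws \<partial>M))"
proof
  fix ws x u
  have "ntrace N (word_mat N A ([] :: 'l list)) = 1" for A :: "'l \<Rightarrow> nat \<Rightarrow> nat \<Rightarrow> complex"
    using N_pos by (simp add: ntrace_def)
  then have "word_traces N (L \<omega>) ([] # ws) = word_traces N (L \<omega>) ws" for \<omega>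
    by (simp add: word_traces_def)
  then show "Re (\<integral>\<omega>. word_traces N (L \<omega>) ([] # ws) \<partial>M) = Re (\<integral>\<omega>. word_traces N (L \<omega>) ws \<partial>M)" by simp
  have Re_sum_list: "Re (\<Sum>(a, y, b)\<leftarrow>xs. F a y b) = (\<Sum>(a, y, b)\<leftarrow>xs. Re (F a y b))"
    for xs :: "('p \<times> 'q \<times> 'r) list" and F by (induction xs) auto
  have Re_mult: "Re (of_real r * z) = r * Re z" for r z by simp
  have q: "1 / complex_of_nat N ^ 2 = of_real (1 / real N ^ 2)" by simp
  show "Re (\<integral>\<omega>. word_traces N (L \<omega>) ((x # u) # ws) \<partial>M) =
      (\<Sum>(a, y, b)\<leftarrow>splits u. c x y * Re (\<integral>\<omega>. word_traces N (L \<omega>) (b # a # ws) \<partial>M)) +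
      1 / real N ^ 2 * (\<Sum>(ws1, w, ws2)\<leftarrow>splits ws. \<Sum>(a, y, b)\<leftarrow>splits w.
        c x y * Re (\<integral>\<omega>. word_traces N (L \<omega>) ((b @ a @ u) # ws1 @ ws2) \<partial>M))"
    unfolding expectation_traces_Cons q plus_complex.sel Re_mult Re_sum_list ..
qed (auto simp: c_nonneg word_traces_def prob_space intro: c_sym)

end

section \<open>Operators with numerical range in a disc\<close>

text \<open>Degenerate forms are allowed on purpose: vectors are infinite sequences of which the
  inner product of size \<open>N\<close> sees only the first \<open>N\<close> entries, and kernels
  and defect forms occurring below may have null vectors of their own.\<close>

locale hform =
  fixes h :: "(nat \<Rightarrow> complex) \<Rightarrow> (nat \<Rightarrow> complex) \<Rightarrow> complex"
  assumes add_left: "h (\<lambda>i. x i + y i) z = h x z + h y z"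
    and scale_left: "h (\<lambda>i. c * x i) z = c * h x z"
    and herm: "h y x = cnj (h x y)"
    and pos: "0 \<le> Re (h x x)"
begin

lemma add_right: "h z (\<lambda>i. x i + y i) = h z x + h z y"
  by (simp add: herm[of z] add_left)

lemma scale_right: "h z (\<lambda>i. c * x i) = cnj c * h z x"
  by (simp add: herm[of z] scale_left)

lemma diff_left: "h (\<lambda>i. x i - y i) z = h x z - h y z"
  using add_left[of x "\<lambda>i. (-1) * y i" z] scale_left[of "-1" y z] by simp

lemma diff_right: "h z (\<lambda>i. x i - y i) = h z x - h z y"
  using add_right[of z x "\<lambda>i. (-1) * y i"] scale_right[of z "-1" y] by simp

lemma zero_left [simp]: "h (\<lambda>i. 0) z = 0"
  using scale_left[of 0 "\<lambda>i. 0" z] by simp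

lemma sum_left: "h (\<lambda>i. \<Sum>k\<in>K. f k i) z = (\<Sum>k\<in>K. h (f k) z)"
  by (induction K rule: infinite_finite_induct) (simp_all add: add_left)

lemma sum_right: "h z (\<lambda>i. \<Sum>k\<in>K. f k i) = (\<Sum>k\<in>K. h z (f k))"
  by (simp add: herm[of z] sum_left)

lemma self_real: "h x x = of_real (Re (h x x))"
  using herm[of x x] by (simp add: complex_eq_iff)

lemma cauchy_schwarz: "cmod (h x y) ^ 2 \<le> Re (h x x) * Re (h y y)"
proof -
  define b where "b = h x y"
  \<comment> \<open>Positivity at \<open>x - t * b * y\<close>. Choosing \<open>t\<close> as the
    inverse of \<open>h y y\<close> gives the inequality; for a null vector \<open>y\<close>, a
    large \<open>t\<close> forces \<open>b = 0\<close>.\<close>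
  have f: "0 \<le> Re (h x x) - 2 * t * cmod b ^ 2 + t ^ 2 * cmod b ^ 2 * Re (h y y)" for t
  proof -
    have "h (\<lambda>i. x i + (- of_real t * b) * y i) (\<lambda>i. x i + (- of_real t * b) * y i) =
      h x x - of_real t * (cnj b * b) - of_real t * (b * cnj b) + of_real (t^2) * (b * cnj b) * h y y"
      unfolding add_left add_right scale_left scale_right b_def herm[of y x]
      by (simp add: algebra_simps power2_eq_square)
    also have "\<dots> = of_real (Re (h x x) - 2 * t * cmod b ^ 2 + t ^ 2 * cmod b ^ 2 * Re (h y y))"
      by (subst self_real[of x], subst self_real[of y])
        (simp add: complex_norm_square[symmetric] mult.commute[of "cnj b"])
    finally show ?thesis using pos[of "\<lambda>i. x i + (- of_real t * b) * y i"] by simp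
  qed
  show ?thesis
  proof (cases "Re (h y y) = 0")
    case True
    have "cmod b ^ 2 = 0"
    proof (rule ccontr)
      assume "cmod b ^ 2 \<noteq> 0"
      then have "0 < cmod b ^ 2" by simp
      with f[of "(Re (h x x) + 1) / (2 * cmod b ^ 2)"] show False
        by (simp add: True field_simps)
    qed
    then show ?thesis using True by (simp add: b_def)
  next
    case False
    then have "0 < Re (h y y)" using pos[of y] by simp
    with f[of "1 / Re (h y y)"] show ?thesis
      by (simp add: b_def field_simps power2_eq_square)
  qed
qed

lemma norm_le: "cmod (h x y) \<le> sqrt (Re (h x x)) * sqrt (Re (h y y))"
  using real_sqrt_le_mono[OF cauchy_schwarz[of x y]] by (simp add: real_sqrt_mult)

lemma norm_le_avg: "cmod (h x y) \<le> (Re (h x x) + Re (h y y)) / 2"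
  using norm_le[of x y] arith_geo_mean_sqrt[OF pos[of x] pos[of y]] by (simp add: real_sqrt_mult)

end

section \<open>Polynomials of an operator and sums over roots of unity\<close>

definition linop :: "((nat \<Rightarrow> complex) \<Rightarrow> nat \<Rightarrow> complex) \<Rightarrow> bool" where
  "linop T \<longleftrightarrow> (\<forall>x y. T (\<lambda>i. x i + y i) = (\<lambda>i. T x i + T y i)) \<and> (\<forall>c x. T (\<lambda>i. c * x i) = (\<lambda>i. c * T x i))"

lemma linopD: "linop T \<Longrightarrow> T (\<lambda>i. x i + y i) = (\<lambda>i. T x i + T y i)" "linop T \<Longrightarrow> T (\<lambda>i. c * x i) = (\<lambda>i. c * T x i)"
  by (auto simp: linop_def)

lemma linop_zero: "linop T \<Longrightarrow> T (\<lambda>i. 0) = (\<lambda>i. 0)"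
  using linopD(2)[of T 0 "\<lambda>i. 0"] by simp

lemma linop_sum: "linop T \<Longrightarrow> T (\<lambda>i. \<Sum>k\<in>K. f k i) = (\<lambda>i. \<Sum>k\<in>K. T (f k) i)"
proof (induction K rule: infinite_finite_induct)
  case (insert k K)
  then show ?case using linopD(1)[of T "f k" "\<lambda>i. \<Sum>k\<in>K. f k i"] by simp
qed (simp_all add: linop_zero)

lemma linop_funpow: "linop T \<Longrightarrow> linop (T ^^ n)"
  by (induction n) (auto simp: linop_def)

definition poly_op :: "((nat \<Rightarrow> complex) \<Rightarrow> nat \<Rightarrow> complex) \<Rightarrow> complex poly \<Rightarrow> (nat \<Rightarrow> complex) \<Rightarrow> nat \<Rightarrow> complex" where
  "poly_op T p x = (\<lambda>i. \<Sum>k\<le>degree p. coeff p k * (T ^^ k) x i)"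

lemma poly_op_altdef: "degree p \<le> n \<Longrightarrow> poly_op T p x = (\<lambda>i. \<Sum>k\<le>n. coeff p k * (T ^^ k) x i)"
  unfolding poly_op_def by (intro ext sum.mono_neutral_left) (auto simp: coeff_eq_0)

lemma poly_op_add: "poly_op T (p + q) x = (\<lambda>i. poly_op T p x i + poly_op T q x i)"
proof -
  have "degree (p + q) \<le> max (degree p) (degree q)" by (rule degree_add_le_max)
  then show ?thesis
    by (simp add: poly_op_altdef[of _ "max (degree p) (degree q)"] algebra_simps sum.distrib)
qed

lemma poly_op_smult: "poly_op T (Polynomial.smult c p) x = (\<lambda>i. c * poly_op T p x i)"
  by (simp add: poly_op_altdef[of _ "degree p"] degree_smult_le sum_distrib_left mult.assoc)

lemma poly_op_pCons: "linop T \<Longrightarrow> poly_op T (pCons a p) x = (\<lambda>i. a * x i + T (poly_op T p x) i)"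
proof -
  assume T: "linop T"
  have "degree (pCons a p) \<le> Suc (degree p)" by (rule degree_pCons_le)
  then have "poly_op T (pCons a p) x = (\<lambda>i. a * x i + (\<Sum>k\<le>degree p. coeff p k * T ((T ^^ k) x) i))"
    by (simp add: poly_op_altdef sum.atMost_Suc_shift del: sum.atMost_Suc)
  moreover have "T (poly_op T p x) = (\<lambda>i. \<Sum>k\<le>degree p. coeff p k * T ((T ^^ k) x) i)"
    unfolding poly_op_def by (simp add: linop_sum[OF T] linopD[OF T])
  ultimately show ?thesis by simp
qed

lemma poly_op_0 [simp]: "poly_op T 0 x = (\<lambda>i. 0)"
  by (simp add: poly_op_def)

lemma linop_poly_op: "linop T \<Longrightarrow> linop (poly_op T p)"
  unfolding linop_def[of "poly_op T p"] poly_op_def using linopD[OF linop_funpow]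
  by (auto simp: algebra_simps sum.distrib sum_distrib_left)

lemma poly_op_mult: "linop T \<Longrightarrow> poly_op T (p * q) x = poly_op T p (poly_op T q x)"
proof (induction p)
  case (pCons a p)
  then show ?case by (simp add: poly_op_add poly_op_smult poly_op_pCons)
qed simp

lemma sum_roots_of_unity:
  assumes "0 < n"
  shows "(\<Sum>j<n. cis (2 * pi * real j / real n) ^ m) = (if n dvd m then of_nat n else 0)"
proof -
  define z where "z = cis (2 * pi * real m / real n)"
  have pw: "cis (2 * pi * real j / real n) ^ m = z ^ j" for j
    unfolding z_def Complex.DeMoivre by (rule arg_cong[where f=cis]) simp
  have zn: "z ^ n = 1"
  proof -
    have "real n * (2 * pi * real m / real n) = 2 * pi * real m" using assms by simp
    then have "z ^ n = cis (2 * pi * real m)" by (simp only: z_def Complex.DeMoivre)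
    then show ?thesis by (simp add: cis_multiple_2pi)
  qed
  show ?thesis
  proof (cases "n dvd m")
    case True
    then obtain k where "m = n * k" by (elim dvdE)
    then have "2 * pi * real m / real n = 2 * pi * real k" using assms by simp
    then have "z = 1" unfolding z_def by (simp add: cis_multiple_2pi)
    then show ?thesis using True by (simp add: pw)
  next
    case False
    define r where "r = m mod n"
    have r: "r < n" "r \<noteq> 0" using False assms by (auto simp: r_def dvd_eq_mod_eq_0)
    have "2 * pi * real m / real n = 2 * pi * real (m div n) + 2 * pi * real r / real n"
    proof -
      have "real m = real (m div n) * real n + real r" unfolding r_def
        by (metis div_mult_mod_eq of_nat_add of_nat_mult)
      then show ?thesis using assms by (simp add: field_simps)
    qed
    then have "z = cis (2 * pi * real r / real n)"
      unfolding z_def by (simp add: cis_mult[symmetric] cis_multiple_2pi)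
    moreover have "cis (2 * pi * real r / real n) \<noteq> cis (2 * pi * real 0 / real n)"
      using inj_onD[OF bij_betw_imp_inj_on[OF Complex.bij_betw_roots_unity[OF assms]], of r 0] r by auto
    ultimately have "z \<noteq> 1" by simp
    then show ?thesis using False zn by (simp add: pw sum_gp_strict)
  qed
qed

lemma telescope_op:
  assumes T: "linop T"
  shows "(\<lambda>i. (\<Sum>k<n. c ^ k * (T ^^ k) x i) - c * T (\<lambda>i. \<Sum>k<n. c ^ k * (T ^^ k) x i) i) =
    (\<lambda>i. x i - c ^ n * (T ^^ n) x i)"
proof
  fix i
  have "c * T (\<lambda>i. \<Sum>k<n. c ^ k * (T ^^ k) x i) i = (\<Sum>k<n. c ^ Suc k * (T ^^ Suc k) x i)"
    by (simp add: linop_sum[OF T] linopD[OF T] sum_distrib_left mult.assoc)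
  moreover have "(\<Sum>k<n. c ^ k * (T ^^ k) x i) - (\<Sum>k<n. c ^ Suc k * (T ^^ Suc k) x i) = x i - c ^ n * (T ^^ n) x i"
    using sum_lessThan_telescope'[of "\<lambda>k. c ^ k * (T ^^ k) x i" n] by (simp add: sum_subtractf)
  ultimately show "(\<Sum>k<n. c ^ k * (T ^^ k) x i) - c * T (\<lambda>i. \<Sum>k<n. c ^ k * (T ^^ k) x i) i = x i - c ^ n * (T ^^ n) x i"
    by simp
qed

text \<open>Duality, testing against the normalised \<open>C x\<close>. Degeneracy calls for a
  scaling argument: all multiples of a null vector lie in the unit ball, so the image of a null
  vector must be null.\<close>

lemma (in hform) bounded_op_self:
  assumes C: "linop C" and b: "\<And>x y. Re (h x x) \<le> 1 \<Longrightarrow> Re (h y y) \<le> 1 \<Longrightarrow> cmod (h (C x) y) \<le> t" and t: "0 \<le> t"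
  shows "Re (h (C u) (C u)) \<le> t\<^sup>2 * Re (h u u)"
proof -
  have 1: "Re (h (C x) (C x)) \<le> t\<^sup>2" if x: "Re (h x x) \<le> 1" for x
  proof (cases "Re (h (C x) (C x)) = 0")
    case False
    define r where "r = sqrt (Re (h (C x) (C x)))"
    have r: "0 < r" "r\<^sup>2 = Re (h (C x) (C x))"
      using False pos[of "C x"] by (auto simp: r_def)
    define y where "y = (\<lambda>i. of_real (1 / r) * C x i)"
    have rr: "h (C x) (C x) = of_real (r\<^sup>2)" using self_real[of "C x"] r by simp
    have "Re (h y y) \<le> 1"
      unfolding y_def scale_left scale_right rr using r(1) by (simp add: power2_eq_square)
    from b[OF x this] have "r \<le> t"
      unfolding y_def scale_right rr using r(1) by (simp add: norm_mult power2_eq_square norm_divide)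
    then show ?thesis using r by (metis power_mono less_imp_le)
  qed simp
  have 2: "s\<^sup>2 * Re (h (C u) (C u)) \<le> t\<^sup>2" if "s\<^sup>2 * Re (h u u) \<le> 1" for s :: real
    using 1[of "\<lambda>i. of_real s * u i"] that
    by (simp add: linopD[OF C] scale_left scale_right power2_eq_square mult.assoc)
  show ?thesis
  proof (cases "Re (h u u) = 0")
    case True
    have "Re (h (C u) (C u)) = 0"
    proof (rule ccontr)
      assume "Re (h (C u) (C u)) \<noteq> 0"
      then have p: "0 < Re (h (C u) (C u))" using pos[of "C u"] by simp
      define s where "s = sqrt ((t\<^sup>2 + 1) / Re (h (C u) (C u)))"
      have "s\<^sup>2 = (t\<^sup>2 + 1) / Re (h (C u) (C u))"
        using p by (simp add: s_def add_nonneg_nonneg)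
      then show False using 2[of s] True p by simp
    qed
    then show ?thesis using True by simp
  next
    case False
    then have p: "0 < Re (h u u)" using pos[of u] by simp
    define s where "s = sqrt (1 / Re (h u u))"
    have s: "s\<^sup>2 = 1 / Re (h u u)" using p by (simp add: s_def)
    have "1 / Re (h u u) * Re (h (C u) (C u)) \<le> t\<^sup>2" using 2[of s] p unfolding s by simp
    then show ?thesis using p by (simp add: pos_divide_le_eq)
  qed
qed

text \<open>\<open>decay\<close> stands in for a spectrum inside the open unit disc. It removes the
  terms with \<open>T ^^ n\<close> that arise when the circle is replaced by the \<open>n\<close>-th
  roots of unity.\<close>

locale num_radius_contraction = hform ip for ip +
  fixes T :: "(nat \<Rightarrow> complex) \<Rightarrow> nat \<Rightarrow> complex"
  assumes T: "linop T"
    and num_radius: "cmod (ip (T x) x) \<le> Re (ip x x)"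
    and decay: "(\<lambda>n. Re (ip ((T ^^ n) x) ((T ^^ n) x))) \<longlonglongrightarrow> 0"
begin

definition root :: "nat \<Rightarrow> nat \<Rightarrow> complex" where
  "root n j = cis (2 * pi * real j / real n)"

lemma root_norm [simp]: "cmod (root n j) = 1"
  by (simp add: root_def)

lemma root_power: "0 < n \<Longrightarrow> root n j ^ n = 1"
proof -
  assume n: "0 < n"
  have "root n j ^ n = cis (real n * (2 * pi * real j / real n))" unfolding root_def Complex.DeMoivre ..
  also have "\<dots> = cis (2 * pi * real j)" using n by simp
  finally show ?thesis by (simp add: cis_multiple_2pi)
qed

lemma root_cnj: "root n j * cnj (root n j) = 1"
  by (simp add: complex_norm_square[symmetric])

lemma root_orth:
  assumes "i < n" "k < n"
  shows "(\<Sum>j<n. root n j ^ i * cnj (root n j) ^ k) = (if i = k then of_nat n else 0)"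
proof -
  have "(\<Sum>j<n. root n j ^ i * cnj (root n j) ^ k) = (\<Sum>j<n. root n j ^ (i + (n - k)))"
  proof (intro sum.cong refl)
    fix j
    have "root n j ^ (n - k) * root n j ^ k = 1"
      using assms root_power[of n j] by (simp add: power_add[symmetric])
    then have "root n j ^ (n - k) * (root n j ^ k * cnj (root n j) ^ k) = cnj (root n j) ^ k"
      by (simp add: mult.assoc[symmetric])
    then have "cnj (root n j) ^ k = root n j ^ (n - k)"
      by (simp add: power_mult_distrib[symmetric] root_cnj)
    then show "root n j ^ i * cnj (root n j) ^ k = root n j ^ (i + (n - k))"
      by (simp add: power_add)
  qed
  also have "\<dots> = (if n dvd i + (n - k) then of_nat n else 0)"
    unfolding root_def by (rule sum_roots_of_unity) (use assms in simp)
  also have "n dvd i + (n - k) \<longleftrightarrow> i = k"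
  proof
    assume "n dvd i + (n - k)"
    then obtain q where q: "i + (n - k) = n * q" by (elim dvdE)
    have "n * q < n * 2" "0 < n * q" unfolding q[symmetric] using assms by simp_all
    then have "q < 2" "0 < q" by simp_all
    then have "q = 1" by simp
    with q assms show "i = k" by simp
  qed (use assms in auto)
  finally show ?thesis .
qed

definition K :: "nat \<Rightarrow> nat \<Rightarrow> (nat \<Rightarrow> complex) \<Rightarrow> nat \<Rightarrow> complex" where
  "K n j x = (\<lambda>i. \<Sum>k<n. cnj (root n j) ^ k * (T ^^ k) x i)"

definition x0 :: "nat \<Rightarrow> (nat \<Rightarrow> complex) \<Rightarrow> nat \<Rightarrow> complex" where
  "x0 n x = (\<lambda>i. x i - (T ^^ n) x i)"

text \<open>For large \<open>n\<close> this approximates the form of the real part of the inverse of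
  \<open>1 - cnj (root n j) * T\<close>, an operator-valued Poisson-type kernel.\<close>

definition ker :: "nat \<Rightarrow> nat \<Rightarrow> (nat \<Rightarrow> complex) \<Rightarrow> (nat \<Rightarrow> complex) \<Rightarrow> complex" where
  "ker n j x y = (ip (x0 n x) (K n j y) + ip (K n j x) (x0 n y)) / 2"

lemma linop_K: "linop (K n j)"
  unfolding linop_def K_def using linopD[OF linop_funpow[OF T]]
  by (auto simp: algebra_simps sum.distrib sum_distrib_left)

lemma linop_x0: "linop (x0 n)"
  unfolding linop_def x0_def using linopD[OF linop_funpow[OF T]]
  by (auto simp: algebra_simps)

text \<open>Since \<open>K\<close> inverts \<open>1 - cnj (root n j) T\<close> up to the small term in \<open>x0\<close>, positivity of the
  kernel is the bound on the numerical radius.\<close>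

lemma hform_ker: "0 < n \<Longrightarrow> hform (ker n j)"
proof
  fix x y z :: "nat \<Rightarrow> complex" and c
  assume n: "0 < n"
  show "ker n j (\<lambda>i. x i + y i) z = ker n j x z + ker n j y z"
    unfolding ker_def linopD(1)[OF linop_K] linopD(1)[OF linop_x0] add_left by (simp add: field_simps)
  show "ker n j (\<lambda>i. c * x i) z = c * ker n j x z"
    unfolding ker_def linopD(2)[OF linop_K] linopD(2)[OF linop_x0] scale_left by (simp add: field_simps)
  show "ker n j y x = cnj (ker n j x y)"
    unfolding ker_def herm[of "x0 n y"] herm[of "K n j y"] by simp
  define u where "u = K n j x"
  have "cnj (root n j) ^ n = 1" using root_power[OF n, of j] by (metis complex_cnj_one complex_cnj_power)
  then have x0: "x0 n x = (\<lambda>i. u i - cnj (root n j) * T u i)"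
    using telescope_op[OF T, where n=n and c="cnj (root n j)" and x=x] unfolding u_def K_def x0_def by simp
  have "Re (ker n j x x) = Re (ip (x0 n x) u)"
    unfolding ker_def u_def[symmetric] using herm[of u "x0 n x"] by simp
  also have "\<dots> = Re (ip u u) - Re (cnj (root n j) * ip (T u) u)"
    by (simp add: x0 diff_left scale_left)
  finally have "Re (ker n j x x) = Re (ip u u) - Re (cnj (root n j) * ip (T u) u)" .
  moreover have "Re (cnj (root n j) * ip (T u) u) \<le> cmod (cnj (root n j) * ip (T u) u)"
    by (rule complex_Re_le_cmod)
  ultimately show "0 \<le> Re (ker n j x x)"
    using num_radius[of u] by (simp add: norm_mult)
qed

text \<open>Discrete Fourier coefficients of the kernel. Powers of the root select
  \<open>T ^^ i\<close> from \<open>K n j x\<close>; the conjugate half contributes at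
  \<open>i = 0\<close> and otherwise only through the aliased exponent \<open>n - i\<close>, which
  disappears in the limit.\<close>

lemma ker_moment:
  assumes "i < n"
  shows "(\<Sum>j<n. root n j ^ i * ker n j x y) / of_nat n =
    ((if i = 0 then ip (x0 n x) y else ip (x0 n x) ((T ^^ (n - i)) y)) + ip ((T ^^ i) x) (x0 n y)) / 2"
proof -
  have 1: "(\<Sum>j<n. root n j ^ i * ip (K n j x) z) = of_nat n * ip ((T ^^ i) x) z" for z
  proof -
    have "(\<Sum>j<n. root n j ^ i * ip (K n j x) z) = (\<Sum>j<n. \<Sum>k<n. (root n j ^ i * cnj (root n j) ^ k) * ip ((T ^^ k) x) z)"
      by (simp add: K_def sum_left scale_left sum_distrib_left mult.assoc)
    also have "\<dots> = (\<Sum>k<n. (\<Sum>j<n. root n j ^ i * cnj (root n j) ^ k) * ip ((T ^^ k) x) z)"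
      by (subst sum.swap) (simp add: sum_distrib_right)
    also have "\<dots> = (\<Sum>k<n. if k = i then of_nat n * ip ((T ^^ i) x) z else 0)"
      using assms by (intro sum.cong refl) (auto simp: root_orth)
    finally show ?thesis using assms by simp
  qed
  have 2: "(\<Sum>j<n. root n j ^ i * ip z (K n j y)) = of_nat n * (if i = 0 then ip z y else ip z ((T ^^ (n - i)) y))" for z
  proof -
    have "(\<Sum>j<n. root n j ^ i * ip z (K n j y)) = (\<Sum>j<n. \<Sum>k<n. (root n j ^ i * root n j ^ k) * ip z ((T ^^ k) y))"
      by (simp add: K_def sum_right scale_right sum_distrib_left mult.assoc)
    also have "\<dots> = (\<Sum>k<n. (\<Sum>j<n. root n j ^ (i + k)) * ip z ((T ^^ k) y))"
      by (subst sum.swap) (simp add: sum_distrib_right power_add)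
    also have "\<dots> = (\<Sum>k<n. if k = (if i = 0 then 0 else n - i) then of_nat n * ip z ((T ^^ k) y) else 0)"
    proof (intro sum.cong refl)
      fix k assume k: "k \<in> {..<n}"
      have "n dvd i + k \<longleftrightarrow> k = (if i = 0 then 0 else n - i)"
      proof
        assume "n dvd i + k"
        then obtain q where q: "i + k = n * q" by (elim dvdE)
        have "n * q < n * 2" using k assms q[symmetric] by simp
        then have "q = 0 \<or> q = 1" by auto
        then show "k = (if i = 0 then 0 else n - i)" using q assms k by (cases "q = 0") auto
      qed (use assms in auto)
      moreover have "(\<Sum>j<n. root n j ^ (i + k)) = (if n dvd i + k then of_nat n else 0)"
        unfolding root_def by (rule sum_roots_of_unity) (use assms in simp)
      ultimately show "(\<Sum>j<n. root n j ^ (i + k)) * ip z ((T ^^ k) y) =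
         (if k = (if i = 0 then 0 else n - i) then of_nat n * ip z ((T ^^ k) y) else 0)" by simp
    qed
    also have "\<dots> = of_nat n * (if i = 0 then ip z y else ip z ((T ^^ (n - i)) y))"
      using assms by auto
    finally show ?thesis .
  qed
  have "(\<Sum>j<n. root n j ^ i * ker n j x y) = ((\<Sum>j<n. root n j ^ i * ip (x0 n x) (K n j y)) + (\<Sum>j<n. root n j ^ i * ip (K n j x) (x0 n y))) / 2"
  proof -
    have "(\<Sum>j<n. root n j ^ i * ker n j x y) = (\<Sum>j<n. (root n j ^ i * ip (x0 n x) (K n j y) + root n j ^ i * ip (K n j x) (x0 n y)) / 2)"
      by (simp add: ker_def distrib_left)
    then show ?thesis by (simp only: sum_divide_distrib[symmetric] sum.distrib)
  qed
  then show ?thesis unfolding 1 2 using assms by (simp add: field_simps)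
qed

lemma ip_decay: "(\<lambda>n. ip ((T ^^ n) x) z) \<longlonglongrightarrow> 0"
proof (rule Lim_null_comparison)
  show "\<forall>\<^sub>F n in sequentially. cmod (ip ((T ^^ n) x) z) \<le> sqrt (Re (ip ((T ^^ n) x) ((T ^^ n) x))) * sqrt (Re (ip z z))"
    using norm_le by (intro always_eventually allI)
  have "(\<lambda>n. sqrt (Re (ip ((T ^^ n) x) ((T ^^ n) x))) * sqrt (Re (ip z z))) \<longlonglongrightarrow> sqrt 0 * sqrt (Re (ip z z))"
    by (intro tendsto_intros decay)
  then show "(\<lambda>n. sqrt (Re (ip ((T ^^ n) x) ((T ^^ n) x))) * sqrt (Re (ip z z))) \<longlonglongrightarrow> 0" by simp
qed

lemma ip_decay2: "(\<lambda>n. ip ((T ^^ n) x) ((T ^^ (n - i)) y)) \<longlonglongrightarrow> 0"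
proof (rule LIMSEQ_offset[of _ i], rule Lim_null_comparison)
  show "\<forall>\<^sub>F n in sequentially. cmod (ip ((T ^^ (n + i)) x) ((T ^^ (n + i - i)) y)) \<le>
     sqrt (Re (ip ((T ^^ (n + i)) x) ((T ^^ (n + i)) x))) * sqrt (Re (ip ((T ^^ n) y) ((T ^^ n) y)))"
    using norm_le by (intro always_eventually allI) simp
  have "(\<lambda>n. sqrt (Re (ip ((T ^^ (n + i)) x) ((T ^^ (n + i)) x))) * sqrt (Re (ip ((T ^^ n) y) ((T ^^ n) y)))) \<longlonglongrightarrow> sqrt 0 * sqrt 0"
    by (intro tendsto_intros decay LIMSEQ_ignore_initial_segment[OF decay])
  then show "(\<lambda>n. sqrt (Re (ip ((T ^^ (n + i)) x) ((T ^^ (n + i)) x))) * sqrt (Re (ip ((T ^^ n) y) ((T ^^ n) y)))) \<longlonglongrightarrow> 0" by simp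
qed

lemma x0_tendsto: "(\<lambda>n. ip (x0 n x) y) \<longlonglongrightarrow> ip x y" "(\<lambda>n. ip y (x0 n x)) \<longlonglongrightarrow> ip y x"
proof -
  show 1: "(\<lambda>n. ip (x0 n x) y) \<longlonglongrightarrow> ip x y" for x y
    using tendsto_diff[OF tendsto_const[of "ip x y"] ip_decay[of x y]] by (simp add: x0_def diff_left)
  show "(\<lambda>n. ip y (x0 n x)) \<longlonglongrightarrow> ip y x"
    using tendsto_cnj[OF 1[of x y]] by (simp add: herm[of y])
qed

lemma ker_moment_tendsto:
  "(\<lambda>n. (\<Sum>j<n. root n j ^ i * ker n j x y) / of_nat n) \<longlonglongrightarrow>
    ((if i = 0 then ip x y else 0) + ip ((T ^^ i) x) y) / 2"
proof -
  have "(\<lambda>n. ((if i = 0 then ip (x0 n x) y else ip (x0 n x) ((T ^^ (n - i)) y)) + ip ((T ^^ i) x) (x0 n y)) / 2)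
     \<longlonglongrightarrow> ((if i = 0 then ip x y else 0) + ip ((T ^^ i) x) y) / 2"
  proof (intro tendsto_intros x0_tendsto)
    have "(\<lambda>n. ip x ((T ^^ (n - i)) y) - ip ((T ^^ n) x) ((T ^^ (n - i)) y)) \<longlonglongrightarrow> 0 - 0"
    proof (intro tendsto_diff ip_decay2)
      have "(\<lambda>n. ip x ((T ^^ n) y)) \<longlonglongrightarrow> 0"
        using tendsto_cnj[OF ip_decay[of y x]] by (simp add: herm[of x])
      then show "(\<lambda>n. ip x ((T ^^ (n - i)) y)) \<longlonglongrightarrow> 0"
        by (intro LIMSEQ_offset[where k=i and f="\<lambda>n. ip x ((T ^^ (n - i)) y)"]) simp
    qed
    then show "(\<lambda>n. if i = 0 then ip (x0 n x) y else ip (x0 n x) ((T ^^ (n - i)) y)) \<longlonglongrightarrow> (if i = 0 then ip x y else 0)"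
      using x0_tendsto(1)[of x y] by (auto simp: x0_def diff_left)
  qed simp
  then show ?thesis
    by (rule Lim_transform_eventually)
      (use ker_moment[of i] in \<open>auto intro!: eventually_mono[OF eventually_gt_at_top[of i]]\<close>)
qed

text \<open>The average of \<open>p\<close> against the kernels tends to half of the form on the
  left. The extra constant coefficient appears because at \<open>i = 0\<close> both halves of the
  kernel contribute.\<close>

lemma poly_ker_le:
  assumes p: "\<And>z. cmod z \<le> 1 \<Longrightarrow> cmod (poly p z) \<le> 1" and x: "Re (ip x x) \<le> 1" and y: "Re (ip y y) \<le> 1"
  shows "cmod (ip (poly_op T p x) y + coeff p 0 * ip x y) \<le> 2"
proof -
  define S where "S n = (\<Sum>j<n. poly p (root n j) * ker n j x y) / of_nat n" for n
  have S_eq: "S n = (\<Sum>i\<le>degree p. coeff p i * ((\<Sum>j<n. root n j ^ i * ker n j x y) / of_nat n))" for n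
    unfolding S_def poly_altdef sum_distrib_right sum_distrib_left sum_divide_distrib
    by (subst sum.swap) (simp add: mult.assoc)
  have "S \<longlonglongrightarrow> (\<Sum>i\<le>degree p. coeff p i * (((if i = 0 then ip x y else 0) + ip ((T ^^ i) x) y) / 2))"
    unfolding S_eq[abs_def] by (intro tendsto_sum tendsto_mult_left ker_moment_tendsto)
  also have "(\<Sum>i\<le>degree p. coeff p i * (((if i = 0 then ip x y else 0) + ip ((T ^^ i) x) y) / 2)) =
     ((\<Sum>i\<le>degree p. if i = 0 then coeff p 0 * ip x y else 0) + (\<Sum>i\<le>degree p. coeff p i * ip ((T ^^ i) x) y)) / 2"
    unfolding sum.distrib[symmetric] sum_divide_distrib by (intro sum.cong refl) (auto simp: algebra_simps)
  also have "\<dots> = (coeff p 0 * ip x y + ip (poly_op T p x) y) / 2"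
    by (simp add: poly_op_def sum_left scale_left)
  finally have S: "(\<lambda>n. cmod (S n)) \<longlonglongrightarrow> cmod ((coeff p 0 * ip x y + ip (poly_op T p x) y) / 2)"
    by (rule tendsto_norm)
  define B where "B n = (Re (ip (x0 n x) x) + Re (ip (x0 n y) y)) / 2" for n
  have B: "B \<longlonglongrightarrow> (Re (ip x x) + Re (ip y y)) / 2"
    unfolding B_def by (intro tendsto_intros tendsto_Re x0_tendsto) simp
  have diag: "Re ((\<Sum>j<n. ker n j z z) / of_nat n) = Re (ip (x0 n z) z)" if "0 < n" for n z
  proof -
    have "(\<Sum>j<n. ker n j z z) / of_nat n = (ip (x0 n z) z + cnj (ip (x0 n z) z)) / 2"
      using ker_moment[OF that, of z z] herm[of z "x0 n z"] by simp
    then show ?thesis by (simp only:) simp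
  qed
  \<comment> \<open>Cauchy-Schwarz for each positive kernel, with \<open>p\<close> at most 1 on the
    circle; the diagonal kernels average to \<open>B n\<close>, which tends to half the sum of the
    two squared norms.\<close>
  have SB: "cmod (S n) \<le> B n" if n: "0 < n" for n
  proof -
    have "cmod (S n) \<le> (\<Sum>j<n. cmod (poly p (root n j)) * cmod (ker n j x y)) / real n"
      unfolding S_def norm_divide using norm_sum[of "\<lambda>j. poly p (root n j) * ker n j x y" "{..<n}"]
      by (simp add: norm_mult divide_right_mono)
    also have "\<dots> \<le> (\<Sum>j<n. 1 * ((Re (ker n j x x) + Re (ker n j y y)) / 2)) / real n"
      by (intro divide_right_mono sum_mono mult_mono p hform.norm_le_avg hform_ker n) auto
    also have "\<dots> = B n"
      using diag[OF n, of x] diag[OF n, of y]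
      by (simp add: B_def sum_divide_distrib[symmetric] sum.distrib add_divide_distrib)
    finally show ?thesis .
  qed
  have "cmod ((coeff p 0 * ip x y + ip (poly_op T p x) y) / 2) \<le> (Re (ip x x) + Re (ip y y)) / 2"
    by (rule tendsto_le[OF _ B S]) (auto intro!: eventually_mono[OF eventually_gt_at_top[of 0]] SB)
  also have "\<dots> \<le> 1" using x y by simp
  finally show ?thesis by (simp add: norm_divide add.commute)
qed

text \<open>To first order in \<open>\<eta>\<close> this is the disc automorphism \<open>(z - \<eta>) / (1 - cnj \<eta> * z)\<close>.\<close>

lemma disc_variation_le:
  assumes z: "cmod z \<le> 1" and e: "cmod \<eta> \<le> 1 / 2"
  shows "cmod (z - \<eta> + cnj \<eta> * z\<^sup>2) \<le> 1 + 2 * (cmod \<eta>)\<^sup>2"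
proof (rule power2_le_imp_le)
  define r h where "r = cmod z" and "h = cmod \<eta>"
  define w where "w = cnj \<eta> * z"
  have r: "0 \<le> r" "r \<le> 1" "0 \<le> h" "h \<le> 1 / 2" and w: "cmod w = h * r"
    using z e by (auto simp: r_def h_def w_def norm_mult)
  have "z - \<eta> + cnj \<eta> * z\<^sup>2 = z * (1 + w) - \<eta>" by (simp add: w_def power2_eq_square algebra_simps)
  moreover have "(cmod (a - b))\<^sup>2 = (cmod a)\<^sup>2 - 2 * Re (a * cnj b) + (cmod b)\<^sup>2" for a b
    unfolding cmod_power2 by (simp add: power2_eq_square algebra_simps)
  ultimately have "(cmod (z - \<eta> + cnj \<eta> * z\<^sup>2))\<^sup>2 = (cmod (z * (1 + w)))\<^sup>2 - 2 * Re (z * (1 + w) * cnj \<eta>) + h\<^sup>2"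
    unfolding h_def by (simp only:)
  also have "(cmod (z * (1 + w)))\<^sup>2 = r\<^sup>2 * (1 + 2 * Re w + (h * r)\<^sup>2)"
  proof -
    have "(cmod (1 + w))\<^sup>2 = 1 + 2 * Re w + (cmod w)\<^sup>2"
      unfolding cmod_power2 by (simp add: power2_eq_square algebra_simps)
    then show ?thesis by (simp add: norm_mult power_mult_distrib w r_def)
  qed
  also have "z * (1 + w) * cnj \<eta> = w + w\<^sup>2" by (simp add: w_def power2_eq_square algebra_simps)
  also have "Re (w + w\<^sup>2) = Re w + Re (w\<^sup>2)" by simp
  finally have eq: "(cmod (z - \<eta> + cnj \<eta> * z\<^sup>2))\<^sup>2 =
      r\<^sup>2 + r\<^sup>2 * (h * r)\<^sup>2 + h\<^sup>2 - 2 * (1 - r\<^sup>2) * Re w - 2 * Re (w\<^sup>2)"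
    by (simp add: algebra_simps)
  have r2: "r\<^sup>2 \<le> 1" using r by (simp add: power_le_one)
  have hr: "h * r \<le> 1 / 2" using mult_mono[of h "1/2" r 1] r by simp
  have hr2: "(h * r)\<^sup>2 \<le> h\<^sup>2" unfolding power_mult_distrib using r2 by (simp add: mult_left_le)
  have "- Re w \<le> h * r" using abs_Re_le_cmod[of w] w by linarith
  then have "(1 - r\<^sup>2) * (- Re w) \<le> (1 - r\<^sup>2) * (1 / 2)"
    using r2 hr by (intro mult_left_mono) auto
  then have a: "- 2 * (1 - r\<^sup>2) * Re w \<le> 1 - r\<^sup>2" by (simp add: algebra_simps)
  have "- Re (w\<^sup>2) \<le> (h * r)\<^sup>2" using abs_Re_le_cmod[of "w\<^sup>2"] w by (simp add: norm_power)
  then have b: "- 2 * Re (w\<^sup>2) \<le> 2 * h\<^sup>2" using hr2 by simp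
  have c: "r\<^sup>2 * (h * r)\<^sup>2 \<le> h\<^sup>2" using mult_mono[OF r2 hr2] by simp
  have "(cmod (z - \<eta> + cnj \<eta> * z\<^sup>2))\<^sup>2 \<le> 1 + 4 * h\<^sup>2" using eq a b c by linarith
  also have "\<dots> \<le> 1 + 4 * h\<^sup>2 + 4 * (h\<^sup>2)\<^sup>2" by simp
  also have "\<dots> = (1 + 2 * h\<^sup>2)\<^sup>2" by (simp add: power2_eq_square algebra_simps)
  finally show "(cmod (z - \<eta> + cnj \<eta> * z\<^sup>2))\<^sup>2 \<le> (1 + 2 * (cmod \<eta>)\<^sup>2)\<^sup>2"
    by (simp add: h_def)
qed simp

definition admissible :: "complex poly \<Rightarrow> bool" where
  "admissible p \<longleftrightarrow> (\<forall>z. cmod z \<le> 1 \<longrightarrow> cmod (poly p z) \<le> 1)"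

definition poly_values :: "real set" where
  "poly_values = {cmod (ip (poly_op T p x) y) | p x y. admissible p \<and> Re (ip x x) \<le> 1 \<and> Re (ip y y) \<le> 1}"

text \<open>An a priori bound, \<open>2 + 1\<close>, from the kernel estimate and the trivial bound
  on its correction term. It makes the supremum of \<open>poly_values\<close> finite, so that nearly
  extremal triples exist.\<close>

lemma poly_values_le: "v \<in> poly_values \<Longrightarrow> v \<le> 3"
proof -
  assume "v \<in> poly_values"
  then obtain p x y where v: "v = cmod (ip (poly_op T p x) y)" "admissible p" "Re (ip x x) \<le> 1" "Re (ip y y) \<le> 1"
    by (auto simp: poly_values_def)
  have "cmod (coeff p 0) \<le> 1"
    using v(2) by (auto simp: admissible_def poly_0_coeff_0[symmetric])
  moreover have "cmod (ip x y) \<le> 1"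
    by (rule order.trans[OF norm_le_avg]) (use v in simp)
  ultimately have "cmod (coeff p 0 * ip x y) \<le> 1"
    unfolding norm_mult by (simp add: mult_le_one)
  moreover have "cmod (ip (poly_op T p x) y + coeff p 0 * ip x y) \<le> 2"
    using v by (intro poly_ker_le) (auto simp: admissible_def)
  ultimately show "v \<le> 3"
    using norm_triangle_ineq4[of "ip (poly_op T p x) y + coeff p 0 * ip x y" "coeff p 0 * ip x y"] v(1) by simp
qed

text \<open>For a nearly extremal triple \<open>p\<close>, \<open>x\<close>, \<open>y\<close> the variation of \<open>p\<close> by disc automorphisms forces
  \<open>x\<close> and \<open>y\<close> to be nearly orthogonal, so the correction term in the kernel bound is negligible.\<close>

lemma near_extremal:
  assumes t: "\<And>v. v \<in> poly_values \<Longrightarrow> v \<le> t" "2 < t" "t \<le> 3"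
    and s: "0 < s" "s \<le> 1 / 2"
    and p: "admissible p" and x: "Re (ip x x) \<le> 1" and y: "Re (ip y y) \<le> 1"
    and tau: "ip (poly_op T p x) y = of_real \<tau>" "t - s\<^sup>2 < \<tau>"
  shows "t - 2 \<le> 11 * s"
proof -
  define C where "C = poly_op T p"
  have C: "linop C" unfolding C_def by (rule linop_poly_op[OF T])
  have s2: "s\<^sup>2 \<le> 1" using s by (simp add: power_le_one)
  have tau0: "0 < \<tau>" using tau s2 t by linarith
  have tau_le: "\<tau> \<le> t"
  proof -
    have "cmod (ip (poly_op T p x) y) \<in> poly_values"
      unfolding poly_values_def using p x y by blast
    from t(1)[OF this] show ?thesis using tau0 by (simp add: tau(1))
  qed
  have Cb: "cmod (ip (C u) v) \<le> t" if "Re (ip u u) \<le> 1" "Re (ip v v) \<le> 1" for u v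
    using p that by (intro t(1)) (auto simp: poly_values_def C_def)
  have CC: "Re (ip (C u) (C u)) \<le> t\<^sup>2 * Re (ip u u)" for u
    by (rule bounded_op_self[OF C Cb]) (use t in auto)
  \<comment> \<open>The defect form of \<open>t^2\<close> minus adjoint of \<open>C\<close> times
    \<open>C\<close> is positive since \<open>t\<close> bounds \<open>C\<close>. It is nearly null
    at \<open>x\<close>, and its Cauchy-Schwarz inequality carries this over to the pair
    \<open>x\<close>, \<open>y\<close>.\<close>
  interpret D: hform "\<lambda>u v. of_real (t\<^sup>2) * ip u v - ip (C u) (C v)"
  proof
    fix u v z :: "nat \<Rightarrow> complex" and c
    show "of_real (t\<^sup>2) * ip (\<lambda>i. u i + v i) z - ip (C (\<lambda>i. u i + v i)) (C z) =
      of_real (t\<^sup>2) * ip u z - ip (C u) (C z) + (of_real (t\<^sup>2) * ip v z - ip (C v) (C z))"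
      by (simp add: linopD[OF C] add_left algebra_simps)
    show "of_real (t\<^sup>2) * ip (\<lambda>i. c * u i) z - ip (C (\<lambda>i. c * u i)) (C z) = c * (of_real (t\<^sup>2) * ip u z - ip (C u) (C z))"
      by (simp add: linopD[OF C] scale_left algebra_simps)
    show "of_real (t\<^sup>2) * ip v u - ip (C v) (C u) = cnj (of_real (t\<^sup>2) * ip u v - ip (C u) (C v))"
      using herm[of v u] herm[of "C v" "C u"] by simp
    show "0 \<le> Re (of_real (t\<^sup>2) * ip u u - ip (C u) (C u))"
      using CC[of u] by simp
  qed
  \<comment> \<open>The common size of all deviations from exact extremality; the factor 5/2 comes
    from \<open>2 * t \<le> 6 \<le> 25 / 4\<close>.\<close>
  define E where "E = sqrt (2 * t * s\<^sup>2)"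
  have E: "0 \<le> E" "E \<le> 5 / 2 * s"
  proof -
    have "E \<le> sqrt ((5 / 2 * s)\<^sup>2)"
      unfolding E_def using mult_right_mono[of "2 * t" "25 / 4" "s\<^sup>2"] t(3)
      by (intro real_sqrt_le_mono) (simp add: power_mult_distrib power2_eq_square)
    then show "E \<le> 5 / 2 * s" using s by simp
    show "0 \<le> E" using t by (simp add: E_def)
  qed
  have tt: "t\<^sup>2 - \<tau>\<^sup>2 \<le> 2 * t * s\<^sup>2"
  proof -
    have "t\<^sup>2 - \<tau>\<^sup>2 = (t - \<tau>) * (t + \<tau>)" by (simp add: power2_eq_square algebra_simps)
    also have "\<dots> \<le> s\<^sup>2 * (2 * t)" using tau tau_le tau0 by (intro mult_mono) auto
    finally show ?thesis by (simp add: mult_ac)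
  qed
  have "\<tau>\<^sup>2 \<le> Re (ip (C x) (C x)) * Re (ip y y)"
    using cauchy_schwarz[of "C x" y] tau(1) by (simp add: C_def)
  also have "\<dots> \<le> Re (ip (C x) (C x)) * 1"
    using pos[of "C x"] y by (intro mult_left_mono)
  finally have Cx: "\<tau>\<^sup>2 \<le> Re (ip (C x) (C x))" by simp
  have Cx2: "Re (ip (C x) (C x)) \<le> t\<^sup>2"
    using CC[of x] mult_left_mono[OF x, of "t\<^sup>2"] by simp
  have t2x: "t\<^sup>2 * Re (ip x x) \<le> t\<^sup>2" and t2y: "t\<^sup>2 * Re (ip y y) \<le> t\<^sup>2"
    using mult_left_mono[OF x, of "t\<^sup>2"] mult_left_mono[OF y, of "t\<^sup>2"] by simp_all
  have h2: "cmod (of_real (t\<^sup>2) * ip x y - ip (C x) (C y)) \<le> E * t"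
  proof -
    have "cmod (of_real (t\<^sup>2) * ip x y - ip (C x) (C y)) \<le>
      sqrt (t\<^sup>2 * Re (ip x x) - Re (ip (C x) (C x))) * sqrt (t\<^sup>2 * Re (ip y y) - Re (ip (C y) (C y)))"
      using D.norm_le[of x y] by simp
    also have "\<dots> \<le> E * sqrt (t\<^sup>2)"
      unfolding E_def using Cx tt t2x t2y pos[of "C y"] CC[of y] CC[of x] E(1)[unfolded E_def]
      by (intro mult_mono real_sqrt_le_mono) auto
    finally show ?thesis using t by simp
  qed
  \<comment> \<open>For an exactly extremal triple \<open>C x = t y\<close>; the vector
    \<open>e\<close> is the failure of this.\<close>
  define e where "e = (\<lambda>i. C x i - of_real t * y i)"
  have ee: "Re (ip e e) \<le> E\<^sup>2"
  proof -
    have "Re (ip e e) = Re (ip (C x) (C x)) - 2 * t * \<tau> + t\<^sup>2 * Re (ip y y)"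
      unfolding e_def diff_left diff_right scale_left scale_right
      using tau(1) herm[of y "C x"] by (simp add: C_def power2_eq_square)
    also have "\<dots> \<le> 2 * t * (t - \<tau>)" using Cx2 t2y by (simp add: algebra_simps power2_eq_square)
    also have "\<dots> \<le> 2 * t * s\<^sup>2" using tau t by (intro mult_left_mono) auto
    also have "\<dots> = E\<^sup>2" unfolding E_def using t by simp
    finally show ?thesis .
  qed
  have eE: "sqrt (Re (ip e e)) \<le> E" using real_sqrt_le_mono[OF ee] E(1) by simp
  have sy: "sqrt (Re (ip y y)) \<le> 1" using y by simp
  have CeE: "sqrt (Re (ip (C e) (C e))) \<le> t * E"
  proof -
    have "Re (ip (C e) (C e)) \<le> (t * E)\<^sup>2"
      using CC[of e] mult_left_mono[OF ee, of "t\<^sup>2"] by (simp add: power_mult_distrib)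
    from real_sqrt_le_mono[OF this] show ?thesis using t E(1) by simp
  qed
  have CyE: "sqrt (Re (ip (C y) (C y))) \<le> t"
    using real_sqrt_le_mono[OF order.trans[OF CC t2y]] t by simp
  define \<beta> where "\<beta> = ip x y"
  \<comment> \<open>In the exact case
    \<open><C C x, y> = t <C y, y> = <C y, C x> = t^2 <y, x>\<close>. Here each of the three
    equalities holds up to an error of at most \<open>t * E\<close>.\<close>
  have key: "cmod (ip (C (C x)) y - of_real (t\<^sup>2) * cnj \<beta>) \<le> 3 * t * E"
  proof -
    have "C x = (\<lambda>i. e i + of_real t * y i)" by (simp add: e_def)
    then have CCx: "C (C x) = (\<lambda>i. C e i + of_real t * C y i)"
      using linopD[OF C] by metis
    have 1: "ip (C (C x)) y = ip (C e) y + of_real t * ip (C y) y"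
      unfolding CCx add_left scale_left ..
    have 2: "of_real t * ip (C y) y = ip (C y) (C x) - ip (C y) e"
      unfolding e_def diff_right scale_right by simp
    have 3: "ip (C y) (C x) - of_real (t\<^sup>2) * cnj \<beta> = - cnj (of_real (t\<^sup>2) * ip x y - ip (C x) (C y))"
      using herm[of "C y" "C x"] by (simp add: \<beta>_def)
    have eq: "ip (C (C x)) y - of_real (t\<^sup>2) * cnj \<beta> = ip (C e) y - ip (C y) e - cnj (of_real (t\<^sup>2) * ip x y - ip (C x) (C y))"
      unfolding 1 2 using 3 by (simp add: algebra_simps)
    have "cmod (a - b - cnj c) \<le> cmod a + cmod b + cmod c" for a b c
      using norm_triangle_ineq4[of "a - b" "cnj c"] norm_triangle_ineq4[of a b] by simp
    then have "cmod (ip (C (C x)) y - of_real (t\<^sup>2) * cnj \<beta>) \<le>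
      cmod (ip (C e) y) + cmod (ip (C y) e) + cmod (of_real (t\<^sup>2) * ip x y - ip (C x) (C y))"
      unfolding eq .
    moreover have "cmod (ip (C e) y) \<le> t * E * 1"
      by (rule order.trans[OF norm_le], rule mult_mono[OF CeE sy]) (use t E pos in auto)
    moreover have "cmod (ip (C y) e) \<le> t * E"
      by (rule order.trans[OF norm_le], rule mult_mono[OF CyE eE]) (use t E pos in auto)
    ultimately show ?thesis using h2 by (simp add: mult.commute)
  qed
  obtain u where u: "cmod u = 1" "u * \<beta> = of_real (cmod \<beta>)"
  proof (cases "\<beta> = 0")
    case False
    then show ?thesis
      by (intro that[of "cnj \<beta> / of_real (cmod \<beta>)"])
        (auto simp: norm_divide complex_norm_square[symmetric] power2_eq_square mult.commute)
  qed (use that[of 1] in auto)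
  \<comment> \<open>With this phase the first-order change of the value is real and equal to
    \<open>(t^2 - 1) * s * cmod \<beta>\<close>, apart from the error in \<open>key\<close>. The
    normalisation \<open>k\<close> is only of second order in \<open>s\<close>, so maximality of
    \<open>t\<close> forces \<open>cmod \<beta>\<close> to be of order \<open>s\<close>.\<close>
  define \<eta> where "\<eta> = of_real s * u"
  have eta: "cmod \<eta> = s" using u s by (simp add: \<eta>_def norm_mult)
  define g where "g = p + (Polynomial.smult (cnj \<eta>) (p * p) + [:- \<eta>:])"
  define k where "k = 1 + 2 * s\<^sup>2"
  have k: "0 < k" "1 \<le> k" by (auto simp: k_def add_pos_nonneg)
  have "admissible (Polynomial.smult (of_real (1 / k)) g)"
    unfolding admissible_def
  proof (intro allI impI)
    fix z assume "cmod z \<le> 1"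
    then have "cmod (poly p z) \<le> 1" using p by (auto simp: admissible_def)
    from disc_variation_le[OF this, of \<eta>] have "cmod (poly g z) \<le> k"
      using eta s by (simp add: g_def k_def power2_eq_square algebra_simps)
    then show "cmod (poly (Polynomial.smult (of_real (1 / k)) g) z) \<le> 1"
      using k by (simp add: norm_mult norm_divide field_simps)
  qed
  then have "cmod (ip (poly_op T (Polynomial.smult (of_real (1 / k)) g) x) y) \<le> t"
    using x y by (intro t(1)) (auto simp: poly_values_def)
  then have gk: "cmod (ip (poly_op T g x) y) \<le> t * k"
    unfolding poly_op_smult scale_left using k by (simp add: norm_mult norm_divide field_simps)
  have "ip (poly_op T g x) y = of_real \<tau> + (cnj \<eta> * ip (C (C x)) y - \<eta> * \<beta>)"
    unfolding g_def poly_op_add poly_op_smult poly_op_mult[OF T] poly_op_pCons[OF T] add_left scale_left tau(1)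
    using scale_left[of "-\<eta>" x y] by (simp add: C_def \<beta>_def linop_zero[OF T])
  also have "\<dots> = of_real (\<tau> + (t\<^sup>2 - 1) * s * cmod \<beta>) + cnj \<eta> * (ip (C (C x)) y - of_real (t\<^sup>2) * cnj \<beta>)"
  proof -
    have 1: "\<eta> * \<beta> = of_real (s * cmod \<beta>)" by (simp add: \<eta>_def u(2) mult.assoc)
    have "cnj (\<eta> * \<beta>) = of_real (s * cmod \<beta>)" unfolding 1 by simp
    then have 2: "cnj \<eta> * cnj \<beta> = of_real (s * cmod \<beta>)" by simp
    show ?thesis unfolding right_diff_distrib mult.left_commute[of "cnj \<eta>"] 1 2
      by (simp add: algebra_simps)
  qed
  finally have "\<tau> + (t\<^sup>2 - 1) * s * cmod \<beta> = Re (ip (poly_op T g x) y) - Re (cnj \<eta> * (ip (C (C x)) y - of_real (t\<^sup>2) * cnj \<beta>))"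
    by simp
  also have "\<dots> \<le> t * k + s * (3 * t * E)"
  proof -
    have "cmod (cnj \<eta> * (ip (C (C x)) y - of_real (t\<^sup>2) * cnj \<beta>)) \<le> s * (3 * t * E)"
      unfolding norm_mult complex_mod_cnj eta by (rule mult_left_mono[OF key]) (use s in simp)
    then show ?thesis
      using complex_Re_le_cmod[of "ip (poly_op T g x) y"] gk
        abs_Re_le_cmod[of "cnj \<eta> * (ip (C (C x)) y - of_real (t\<^sup>2) * cnj \<beta>)"] by linarith
  qed
  finally have "(t\<^sup>2 - 1) * s * cmod \<beta> \<le> t * k + s * (3 * t * E) - \<tau>" by simp
  also have "\<dots> \<le> s * (s + 2 * t * s + 3 * t * E)"
    using tau by (simp add: k_def power2_eq_square algebra_simps)
  finally have "s * ((t\<^sup>2 - 1) * cmod \<beta>) \<le> s * (s + 2 * t * s + 3 * t * E)" by (simp add: mult_ac)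
  then have "(t\<^sup>2 - 1) * cmod \<beta> \<le> s + 2 * t * s + 3 * t * E"
    using s by simp
  also have "\<dots> \<le> s + 2 * 3 * s + 3 * 3 * (5 / 2 * s)"
    using t s E by (intro add_mono mult_mono) auto
  finally have "(t\<^sup>2 - 1) * cmod \<beta> \<le> 30 * s" using s by simp
  moreover have "3 * cmod \<beta> \<le> (t\<^sup>2 - 1) * cmod \<beta>"
    using power_mono[of 2 t 2] t by (intro mult_right_mono) auto
  ultimately have beta: "cmod \<beta> \<le> 10 * s" by simp
  have "cmod (coeff p 0) \<le> 1"
    using p by (auto simp: admissible_def poly_0_coeff_0[symmetric])
  then have "cmod (coeff p 0 * \<beta>) \<le> cmod \<beta>"
    unfolding norm_mult by (simp add: mult_left_le_one_le)
  moreover have "cmod (of_real \<tau> + coeff p 0 * \<beta>) \<le> 2"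
    using poly_ker_le[of p x y] p x y tau(1) by (auto simp: admissible_def \<beta>_def)
  ultimately have "\<tau> \<le> 2 + cmod \<beta>"
    using norm_triangle_ineq4[of "of_real \<tau> + coeff p 0 * \<beta>" "coeff p 0 * \<beta>"] tau0 by simp
  then have "t - 2 \<le> s\<^sup>2 + 10 * s" using tau beta by linarith
  moreover have "s\<^sup>2 \<le> s" using s by (simp add: power2_eq_square mult_left_le)
  ultimately show ?thesis by simp
qed

theorem poly_op_le:
  assumes p: "\<And>z. cmod z \<le> 1 \<Longrightarrow> cmod (poly p z) \<le> 1" and x: "Re (ip x x) \<le> 1" and y: "Re (ip y y) \<le> 1"
  shows "cmod (ip (poly_op T p x) y) \<le> 2"
proof (rule ccontr)
  assume "\<not> ?thesis"
  then have gt: "2 < cmod (ip (poly_op T p x) y)" by simp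
  have mem: "cmod (ip (poly_op T p x) y) \<in> poly_values"
    using assms by (auto simp: poly_values_def admissible_def)
  have bdd: "bdd_above poly_values" using poly_values_le by (intro bdd_aboveI)
  define t where "t = Sup poly_values"
  have t_ge: "v \<le> t" if "v \<in> poly_values" for v
    unfolding t_def by (rule cSup_upper[OF that bdd])
  have t2: "2 < t" using t_ge[OF mem] gt by simp
  have t3: "t \<le> 3" unfolding t_def using mem poly_values_le by (intro cSup_least) auto
  \<comment> \<open>The divisor 12 makes \<open>12 * s \<le> t - 2\<close>, against
    \<open>t - 2 \<le> 11 * s\<close> from \<open>near_extremal\<close>.\<close>
  define s where "s = min (1 / 2) ((t - 2) / 12)"
  have s: "0 < s" "s \<le> 1 / 2" "12 * s \<le> t - 2" using t2 by (auto simp: s_def min_def)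
  have "t - s\<^sup>2 < Sup poly_values" using s by (simp add: t_def)
  then obtain v where v: "v \<in> poly_values" "t - s\<^sup>2 < v"
    using less_cSup_iff[OF _ bdd] mem by blast
  then obtain q a b where q: "v = cmod (ip (poly_op T q a) b)" "admissible q" "Re (ip a a) \<le> 1" "Re (ip b b) \<le> 1"
    by (auto simp: poly_values_def)
  have "s\<^sup>2 \<le> 1" using s by (simp add: power_le_one)
  then have v0: "0 < v" using v t2 by linarith
  define c where "c = cnj (ip (poly_op T q a) b) / of_real v"
  have c: "cmod c = 1" using v0 q(1) by (simp add: c_def norm_divide)
  have "ip (poly_op T (Polynomial.smult c q) a) b = of_real v"
    unfolding poly_op_smult scale_left c_def using v0
    by (simp add: q(1) complex_norm_square[symmetric] power2_eq_square mult.commute)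
  moreover have "admissible (Polynomial.smult c q)"
    using q(2) c by (auto simp: admissible_def norm_mult)
  ultimately have "t - 2 \<le> 11 * s"
    using near_extremal[of t s "Polynomial.smult c q" a b v] t_ge t2 t3 s q v by blast
  with s show False by simp
qed

end

section \<open>Spectral constants of matrices\<close>

lemma holomorphic_on_det:
  assumes M: "\<And>z. M z \<in> carrier_mat n n" and h: "\<And>i j. i < n \<Longrightarrow> j < n \<Longrightarrow> (\<lambda>z. M z $$ (i, j)) holomorphic_on S"
  shows "(\<lambda>z. det (M z)) holomorphic_on S"
  unfolding det_def'[OF M]
proof (intro holomorphic_intros)
  fix p i assume "p \<in> {p. p permutes {0..<n}}" "i \<in> {0..<n}"
  then show "(\<lambda>z. M z $$ (i, p i)) holomorphic_on S"
    by (intro h) (auto dest: permutes_in_image[of p "{0..<n}" i])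
qed

definition pencil :: "complex Matrix.mat \<Rightarrow> complex \<Rightarrow> complex Matrix.mat" where
  "pencil A z = z \<cdot>\<^sub>m 1\<^sub>m (dim_row A) - A"

lemma pencil_carrier: "A \<in> carrier_mat n n \<Longrightarrow> pencil A z \<in> carrier_mat n n"
  by (auto simp: pencil_def)

lemma pencil_index: "A \<in> carrier_mat n n \<Longrightarrow> i < n \<Longrightarrow> j < n \<Longrightarrow> pencil A z $$ (i, j) = (if i = j then z else 0) - A $$ (i, j)"
  by (auto simp: pencil_def)

lemma det_pencil: "A \<in> carrier_mat n n \<Longrightarrow> det (pencil A z) = 0 \<longleftrightarrow> z \<in> spectrum A"
proof -
  assume A: "A \<in> carrier_mat n n"
  have "char_matrix A z = (-1) \<cdot>\<^sub>m pencil A z"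
    using A by (intro eq_matI) (auto simp: char_matrix_def pencil_def)
  then have "det (char_matrix A z) = (-1) ^ n * det (pencil A z)"
    using pencil_carrier[OF A, of z] by simp
  then show ?thesis
    using eigenvalue_det[OF A, of z] by (simp add: spectrum_def)
qed

lemma resolvent_inverse:
  assumes A: "A \<in> carrier_mat n n" and z: "z \<notin> spectrum A"
  shows "resolvent A z \<in> carrier_mat n n" "pencil A z * resolvent A z = 1\<^sub>m n" "resolvent A z * pencil A z = 1\<^sub>m n"
proof -
  note P = pencil_carrier[OF A, of z]
  have "det (pencil A z) \<noteq> 0" using det_pencil[OF A] z by simp
  from det_non_zero_imp_unit[OF P this, of n]
  have "mat_inverse (pencil A z) \<noteq> None" using mat_inverse(1)[OF P, of n] by blast
  then obtain B where B: "mat_inverse (pencil A z) = Some B" by auto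
  then have "resolvent A z = B" by (simp add: resolvent_def pencil_def)
  with mat_inverse(2)[OF P B] show "resolvent A z \<in> carrier_mat n n"
    "pencil A z * resolvent A z = 1\<^sub>m n" "resolvent A z * pencil A z = 1\<^sub>m n" by auto
qed

lemma resolvent_unique:
  assumes A: "A \<in> carrier_mat n n" and S: "S \<in> carrier_mat n n" and PS: "pencil A z * S = 1\<^sub>m n"
  shows "z \<notin> spectrum A" "resolvent A z = S"
proof -
  note P = pencil_carrier[OF A, of z]
  have "det (pencil A z) * det S = 1" using det_mult[OF P S] PS by simp
  then have "det (pencil A z) \<noteq> 0" by auto
  then show z: "z \<notin> spectrum A" using det_pencil[OF A] by simp
  note R = resolvent_inverse[OF A z]
  have "resolvent A z = resolvent A z * (pencil A z * S)" using R PS by simp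
  also have "\<dots> = (resolvent A z * pencil A z) * S" using R P S by (intro assoc_mult_mat[symmetric]) auto
  also have "\<dots> = S" using R S by simp
  finally show "resolvent A z = S" .
qed

text \<open>Cramer's rule, which exhibits the entries as quotients of polynomials in
  \<open>z\<close> and so yields their holomorphy off the spectrum.\<close>

lemma resolvent_adj:
  assumes A: "A \<in> carrier_mat n n" and z: "z \<notin> spectrum A" and ij: "i < n" "j < n"
  shows "resolvent A z $$ (i, j) = cofactor (pencil A z) j i / det (pencil A z)"
proof -
  note P = pencil_carrier[OF A, of z]
  have d: "det (pencil A z) \<noteq> 0" using det_pencil[OF A] z by simp
  define S where "S = (1 / det (pencil A z)) \<cdot>\<^sub>m adj_mat (pencil A z)"
  have S: "S \<in> carrier_mat n n" using adj_mat(1)[OF P] by (simp add: S_def)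
  have "pencil A z * S = (1 / det (pencil A z)) \<cdot>\<^sub>m (pencil A z * adj_mat (pencil A z))"
    unfolding S_def using P adj_mat(1)[OF P] by (intro mult_smult_distrib) auto
  also have "\<dots> = 1\<^sub>m n" unfolding adj_mat(2)[OF P] using d by (intro eq_matI) auto
  finally have "resolvent A z = S" by (rule resolvent_unique(2)[OF A S])
  then show ?thesis using ij P by (simp add: S_def adj_mat_def)
qed

lemma holomorphic_resolvent:
  assumes A: "A \<in> carrier_mat n n" and ij: "i < n" "j < n"
  shows "(\<lambda>z. resolvent A z $$ (i, j)) holomorphic_on (- spectrum A)"
proof -
  note P = pencil_carrier[OF A]
  have ent: "(\<lambda>z. pencil A z $$ (k, l)) holomorphic_on S" if "k < n" "l < n" for k l S
    using that by (cases "k = l") (auto simp: pencil_index[OF A] intro!: holomorphic_intros)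
  have "(\<lambda>z. det (mat_delete (pencil A z) j i)) holomorphic_on - spectrum A"
  proof (rule holomorphic_on_det[where n="n - 1"])
    show "mat_delete (pencil A z) j i \<in> carrier_mat (n - 1) (n - 1)" for z
      by (rule mat_delete_carrier[OF P])
    fix k l assume kl: "k < n - 1" "l < n - 1"
    have "mat_delete (pencil A z) j i $$ (k, l) = pencil A z $$ (if k < j then k else Suc k, if l < i then l else Suc l)" for z
      using kl P[of z] by (auto simp: mat_delete_def)
    then show "(\<lambda>z. mat_delete (pencil A z) j i $$ (k, l)) holomorphic_on - spectrum A"
      using kl by (simp only:) (rule ent; auto)
  qed
  then have "(\<lambda>z. cofactor (pencil A z) j i / det (pencil A z)) holomorphic_on - spectrum A"
    unfolding cofactor_def
    by (intro holomorphic_intros holomorphic_on_det[OF P ent]) (auto simp: det_pencil[OF A])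
  then show ?thesis
    by (rule holomorphic_transform) (use resolvent_adj[OF A _ ij] in auto)
qed

text \<open>The Neumann series, driven by bounds on the entries of the powers: its sum is a right
  inverse of the pencil, which excludes \<open>z\<close> from the spectrum and identifies the
  resolvent.\<close>

lemma resolvent_neumann:
  assumes A: "A \<in> carrier_mat n n"
    and bd: "\<And>k i j. i < n \<Longrightarrow> j < n \<Longrightarrow> cmod ((A ^\<^sub>m k) $$ (i, j)) \<le> C * \<theta> ^ k" and th: "0 < \<theta>" "\<theta> < cmod z"
  shows "z \<notin> spectrum A"
    and "i < n \<Longrightarrow> j < n \<Longrightarrow> (\<lambda>k. (A ^\<^sub>m k) $$ (i, j) / z ^ Suc k) sums (resolvent A z $$ (i, j))"
proof -
  have z0: "z \<noteq> 0" using th by auto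
  have sm: "summable (\<lambda>k. (A ^\<^sub>m k) $$ (i, j) / z ^ Suc k)" if "i < n" "j < n" for i j
  proof (rule summable_comparison_test')
    show "summable (\<lambda>k. C / cmod z * (\<theta> / cmod z) ^ k)"
      using th by (intro summable_mult summable_geometric) (auto simp: divide_less_eq_1)
    show "norm ((A ^\<^sub>m k) $$ (i, j) / z ^ Suc k) \<le> C / cmod z * (\<theta> / cmod z) ^ k" if "0 \<le> k" for k
      using bd[OF \<open>i < n\<close> \<open>j < n\<close>, of k] z0
      by (simp add: norm_divide norm_mult norm_power power_divide divide_right_mono)
  qed
  define S where "S = Matrix.mat n n (\<lambda>(i, j). \<Sum>k. (A ^\<^sub>m k) $$ (i, j) / z ^ Suc k)"
  have S: "S \<in> carrier_mat n n" by (simp add: S_def)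
  have Ak: "A ^\<^sub>m k \<in> carrier_mat n n" for k using A by simp
  have "pencil A z * S = 1\<^sub>m n"
  proof (rule eq_matI)
    fix i j assume "i < dim_row (1\<^sub>m n)" "j < dim_col (1\<^sub>m n)"
    then have ij: "i < n" "j < n" by auto
    have "(pencil A z * S) $$ (i, j) = (\<Sum>l<n. pencil A z $$ (i, l) * S $$ (l, j))"
      using ij pencil_carrier[OF A, of z] S by (simp add: scalar_prod_def atLeast0LessThan)
    also have "\<dots> = (\<Sum>l<n. (if l = i then z * S $$ (i, j) else 0) - A $$ (i, l) * S $$ (l, j))"
      using ij by (intro sum.cong refl) (auto simp: pencil_index[OF A] algebra_simps)
    also have "\<dots> = z * S $$ (i, j) - (\<Sum>l<n. A $$ (i, l) * S $$ (l, j))"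
      using ij by (simp add: sum_subtractf)
    also have "(\<Sum>l<n. A $$ (i, l) * S $$ (l, j)) = (\<Sum>k. \<Sum>l<n. A $$ (i, l) * ((A ^\<^sub>m k) $$ (l, j) / z ^ Suc k))"
    proof -
      have "A $$ (i, l) * S $$ (l, j) = (\<Sum>k. A $$ (i, l) * ((A ^\<^sub>m k) $$ (l, j) / z ^ Suc k))" if "l < n" for l
        using suminf_mult[OF sm[OF that ij(2)], of "A $$ (i, l)"] ij that by (simp add: S_def)
      then have "(\<Sum>l<n. A $$ (i, l) * S $$ (l, j)) = (\<Sum>l<n. \<Sum>k. A $$ (i, l) * ((A ^\<^sub>m k) $$ (l, j) / z ^ Suc k))"
        by (intro sum.cong refl) auto
      also have "\<dots> = (\<Sum>k. \<Sum>l<n. A $$ (i, l) * ((A ^\<^sub>m k) $$ (l, j) / z ^ Suc k))"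
        by (intro suminf_sum[symmetric] summable_mult sm) (use ij in auto)
      finally show ?thesis .
    qed
    also have "(\<lambda>k. \<Sum>l<n. A $$ (i, l) * ((A ^\<^sub>m k) $$ (l, j) / z ^ Suc k)) = (\<lambda>k. (A ^\<^sub>m Suc k) $$ (i, j) / z ^ Suc k)"
    proof
      fix k
      have "A ^\<^sub>m Suc k = A * A ^\<^sub>m k"
      proof (induction k)
        case (Suc k)
        have "A ^\<^sub>m Suc (Suc k) = (A * A ^\<^sub>m k) * A" using Suc by simp
        also have "\<dots> = A * (A ^\<^sub>m k * A)" using A Ak[of k] by (intro assoc_mult_mat) auto
        finally show ?case by simp
      qed (use A in simp)
      then have "(A ^\<^sub>m Suc k) $$ (i, j) = (\<Sum>l<n. A $$ (i, l) * (A ^\<^sub>m k) $$ (l, j))"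
        using ij A Ak[of k] by (simp add: scalar_prod_def atLeast0LessThan del: pow_mat.simps)
      then show "(\<Sum>l<n. A $$ (i, l) * ((A ^\<^sub>m k) $$ (l, j) / z ^ Suc k)) = (A ^\<^sub>m Suc k) $$ (i, j) / z ^ Suc k"
        by (simp add: sum_divide_distrib del: pow_mat.simps)
    qed
    also have "z * S $$ (i, j) = (\<Sum>k. (A ^\<^sub>m k) $$ (i, j) / z ^ k)"
      using ij z0 suminf_mult[OF sm[OF ij], of z] by (simp add: S_def)
    also have "\<dots> = (A ^\<^sub>m 0) $$ (i, j) + (\<Sum>k. (A ^\<^sub>m Suc k) $$ (i, j) / z ^ Suc k)"
    proof -
      have "summable (\<lambda>k. (A ^\<^sub>m k) $$ (i, j) / z ^ k)"
        using summable_mult[OF sm[OF ij], of z] z0 by simp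
      from suminf_split_head[OF this] show ?thesis by (simp del: pow_mat.simps(2))
    qed
    finally show "(pencil A z * S) $$ (i, j) = 1\<^sub>m n $$ (i, j)" using ij A by simp
  qed (use pencil_carrier[OF A, of z] S in auto)
  from resolvent_unique[OF A S this] show "z \<notin> spectrum A"
    and "i < n \<Longrightarrow> j < n \<Longrightarrow> (\<lambda>k. (A ^\<^sub>m k) $$ (i, j) / z ^ Suc k) sums (resolvent A z $$ (i, j))"
    using sm[of i j] by (auto simp: S_def summable_sums)
qed

text \<open>The small circles around the eigenvalues are traded, through residues, for one circle
  about 0 of radius between \<open>\<theta>\<close> and \<open>r\<close>. There the Neumann series
  converges uniformly, and Cauchy's formula turns each term into a Taylor coefficient.\<close>

theorem holo_calculus_power_series:
  assumes A: "A \<in> carrier_mat n n"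
    and bd: "\<And>k i j. i < n \<Longrightarrow> j < n \<Longrightarrow> cmod ((A ^\<^sub>m k) $$ (i, j)) \<le> C * \<theta> ^ k" and th: "0 < \<theta>" "\<theta> < r"
    and U: "open U" "ball 0 r \<subseteq> U" and f: "f holomorphic_on U" and ij: "i < n" "j < n"
  shows "(\<lambda>k. (deriv ^^ k) f 0 / fact k * (A ^\<^sub>m k) $$ (i, j)) sums (holo_calculus U f A $$ (i, j))"
proof -
  define r1 where "r1 = (\<theta> + r) / 2"
  have r1: "\<theta> < r1" "r1 < r" "0 < r1" using th by (auto simp: r1_def)
  have fin: "finite (spectrum A)" by (rule card_finite_spectrum(1)[OF A])
  have sp: "spectrum A \<subseteq> cball 0 \<theta>"
    using resolvent_neumann(1)[OF A bd th(1)] by (force simp: not_le[symmetric])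
  then have spU: "spectrum A \<subseteq> U" using U(2) th by force
  define g where "g z = f z * resolvent A z $$ (i, j)" for z
  have g: "g holomorphic_on U - spectrum A"
    unfolding g_def
    by (intro holomorphic_on_mult holomorphic_on_subset[OF f] holomorphic_on_subset[OF holomorphic_resolvent[OF A ij]]) auto
  define \<rho> where "\<rho> = (SOME r. admissible_radius U A r)"
  have rho: "admissible_radius U A \<rho>"
    unfolding \<rho>_def by (rule someI_ex, rule ex_admissible_radius[OF A U(1) spU])
  have c1: "contour_integral (circlepath \<nu> \<rho>) g = 2 * pi * \<i> * residue g \<nu>" if nu: "\<nu> \<in> spectrum A" for \<nu>
  proof (rule contour_integral_unique, rule base_residue)
    show "open (U - (spectrum A - {\<nu>}))"
      using U(1) fin by (intro open_Diff finite_imp_closed) auto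
    show "\<nu> \<in> U - (spectrum A - {\<nu>})" using nu spU by auto
    show "0 < \<rho>" using rho by (auto simp: admissible_radius_def)
    show "g holomorphic_on U - (spectrum A - {\<nu>}) - {\<nu>}"
      by (rule holomorphic_on_subset[OF g]) auto
    show "cball \<nu> \<rho> \<subseteq> U - (spectrum A - {\<nu>})"
    proof
      fix x assume x: "x \<in> cball \<nu> \<rho>"
      have "x \<notin> spectrum A - {\<nu>}"
      proof
        assume xs: "x \<in> spectrum A - {\<nu>}"
        then have "cball \<nu> \<rho> \<inter> cball x \<rho> = {}" using rho nu unfolding admissible_radius_def by blast
        moreover have "x \<in> cball x \<rho>" using \<open>0 < \<rho>\<close> by simp
        ultimately show False using x by blast
      qed
      moreover have "cball \<nu> \<rho> \<subseteq> U" using rho nu unfolding admissible_radius_def by blast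
      ultimately show "x \<in> U - (spectrum A - {\<nu>})" using x by blast
    qed
  qed
  have c2: "contour_integral (circlepath 0 r1) g = 2 * pi * \<i> * (\<Sum>\<nu>\<in>spectrum A. residue g \<nu>)"
  proof -
    have "contour_integral (circlepath 0 r1) g = 2 * pi * \<i> * (\<Sum>\<nu>\<in>spectrum A. winding_number (circlepath 0 r1) \<nu> * residue g \<nu>)"
    proof (rule Residue_theorem[where S="ball 0 r"])
      show "g holomorphic_on ball 0 r - spectrum A"
        by (rule holomorphic_on_subset[OF g]) (use U(2) in auto)
      show "path_image (circlepath 0 r1) \<subseteq> ball 0 r - spectrum A"
        using r1 sp by auto
      show "\<forall>z. z \<notin> ball 0 r \<longrightarrow> winding_number (circlepath 0 r1) z = 0"
        using r1 by (auto intro!: winding_number_zero_outside[where s="cball 0 r1"])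
    qed (use fin in auto)
    also have "(\<Sum>\<nu>\<in>spectrum A. winding_number (circlepath 0 r1) \<nu> * residue g \<nu>) = (\<Sum>\<nu>\<in>spectrum A. residue g \<nu>)"
    proof (intro sum.cong refl)
      fix \<nu> assume "\<nu> \<in> spectrum A"
      then have "cmod (\<nu> - 0) < r1" using sp r1 by auto
      then show "winding_number (circlepath 0 r1) \<nu> * residue g \<nu> = residue g \<nu>"
        by (simp add: winding_number_circlepath)
    qed
    finally show ?thesis .
  qed
  have hol: "holo_calculus U f A $$ (i, j) = contour_integral (circlepath 0 r1) g / (2 * of_real pi * \<i>)"
  proof -
    have "holo_calculus U f A $$ (i, j) = (\<Sum>\<nu>\<in>spectrum A. contour_integral (circlepath \<nu> \<rho>) g) / (2 * of_real pi * \<i>)"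
      using A ij by (simp add: holo_calculus_def Let_def \<rho>_def g_def[abs_def])
    also have "(\<Sum>\<nu>\<in>spectrum A. contour_integral (circlepath \<nu> \<rho>) g) = contour_integral (circlepath 0 r1) g"
      unfolding c2 sum_distrib_left by (intro sum.cong refl c1)
    finally show ?thesis .
  qed
  have fcont: "continuous_on (cball 0 r1) f"
    by (rule continuous_on_subset[OF holomorphic_on_imp_continuous_on[OF f]]) (use r1 U in force)
  have fhol: "f holomorphic_on ball 0 r1"
    by (rule holomorphic_on_subset[OF f]) (use r1 U in force)
  define S where "S m z = (\<Sum>k<m. f z * ((A ^\<^sub>m k) $$ (i, j) / z ^ Suc k))" for m z
  have trm: "((\<lambda>z. f z * ((A ^\<^sub>m k) $$ (i, j) / z ^ Suc k)) has_contour_integral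
      (A ^\<^sub>m k) $$ (i, j) * (2 * pi * \<i> / fact k * (deriv ^^ k) f 0)) (circlepath 0 r1)" for k
  proof -
    have "((\<lambda>u. f u / (u - 0) ^ Suc k) has_contour_integral ((2 * pi * \<i>) / (fact k) * (deriv ^^ k) f 0)) (circlepath 0 r1)"
      by (rule Cauchy_has_contour_integral_higher_derivative_circlepath[OF fcont fhol]) (use r1 in simp)
    from has_contour_integral_lmul[OF this, of "(A ^\<^sub>m k) $$ (i, j)"]
    show ?thesis by (simp add: field_simps)
  qed
  have S: "(S m has_contour_integral (\<Sum>k<m. (A ^\<^sub>m k) $$ (i, j) * (2 * pi * \<i> / fact k * (deriv ^^ k) f 0))) (circlepath 0 r1)" for m
    unfolding S_def by (intro has_contour_integral_sum trm) simp
  have "compact (f ` sphere 0 r1)"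
    by (intro compact_continuous_image continuous_on_subset[OF fcont]) auto
  then have "bounded (f ` sphere 0 r1)" by (rule compact_imp_bounded)
  then obtain B where "\<forall>x\<in>f ` sphere 0 r1. cmod x \<le> B" unfolding bounded_iff ..
  then have B: "\<And>z. z \<in> sphere 0 r1 \<Longrightarrow> cmod (f z) \<le> B" by blast
  have "of_real r1 \<in> sphere (0::complex) r1" using r1 by simp
  from order.trans[OF norm_ge_zero B[OF this]] have B0: "0 \<le> B" .
  have "uniform_limit (sphere 0 r1) (\<lambda>m z. \<Sum>k<m. f z * ((A ^\<^sub>m k) $$ (i, j) / z ^ Suc k))
     (\<lambda>z. \<Sum>k. f z * ((A ^\<^sub>m k) $$ (i, j) / z ^ Suc k)) sequentially"
  proof (rule Weierstrass_m_test)
    show "summable (\<lambda>k. B * C / r1 * (\<theta> / r1) ^ k)"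
      using r1 th by (intro summable_mult summable_geometric) (auto simp: divide_less_eq_1)
    fix k z assume z: "z \<in> sphere (0::complex) r1"
    then have "cmod z = r1" by simp
    then have "norm (f z * ((A ^\<^sub>m k) $$ (i, j) / z ^ Suc k)) = cmod (f z) * (cmod ((A ^\<^sub>m k) $$ (i, j)) / r1 ^ Suc k)"
      by (simp add: norm_mult norm_divide norm_power)
    also have "\<dots> \<le> B * (C * \<theta> ^ k / r1 ^ Suc k)"
      using B[OF z] bd[OF ij, of k] r1 B0 by (intro mult_mono divide_right_mono) auto
    finally show "norm (f z * ((A ^\<^sub>m k) $$ (i, j) / z ^ Suc k)) \<le> B * C / r1 * (\<theta> / r1) ^ k"
      by (simp add: power_divide)
  qed
  moreover have "(\<Sum>k. f z * ((A ^\<^sub>m k) $$ (i, j) / z ^ Suc k)) = g z" if "z \<in> sphere 0 r1" for z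
  proof -
    have "\<theta> < cmod z" using that r1 by simp
    from resolvent_neumann(2)[OF A bd th(1) this ij]
    have "(\<lambda>k. (A ^\<^sub>m k) $$ (i, j) / z ^ Suc k) sums resolvent A z $$ (i, j)" .
    from sums_mult[OF this, of "f z"] show ?thesis by (simp add: g_def sums_iff)
  qed
  ultimately have ul: "uniform_limit (sphere 0 r1) S g sequentially"
    unfolding S_def[abs_def] by (subst uniform_limit_cong'[symmetric]) auto
  have "(\<lambda>m. contour_integral (circlepath 0 r1) (S m)) \<longlonglongrightarrow> contour_integral (circlepath 0 r1) g"
    by (rule contour_integral_uniform_limit_circlepath[OF _ ul])
      (use r1 has_contour_integral_integrable[OF S] in \<open>auto intro: always_eventually\<close>)
  then have "(\<lambda>m. (\<Sum>k<m. (A ^\<^sub>m k) $$ (i, j) * (2 * pi * \<i> / fact k * (deriv ^^ k) f 0)) / (2 * of_real pi * \<i>)) \<longlonglongrightarrow>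
     contour_integral (circlepath 0 r1) g / (2 * of_real pi * \<i>)"
    unfolding contour_integral_unique[OF S] by (intro tendsto_intros) auto
  moreover have "(\<Sum>k<m. (A ^\<^sub>m k) $$ (i, j) * (2 * pi * \<i> / fact k * (deriv ^^ k) f 0)) / (2 * of_real pi * \<i>) =
      (\<Sum>k<m. (deriv ^^ k) f 0 / fact k * (A ^\<^sub>m k) $$ (i, j))" for m
    unfolding sum_divide_distrib by (intro sum.cong refl) simp
  ultimately show ?thesis unfolding sums_def hol by simp
qed

section \<open>Quadratic forms and traces of matrices given as index functions\<close>

definition ip :: "nat \<Rightarrow> (nat \<Rightarrow> complex) \<Rightarrow> (nat \<Rightarrow> complex) \<Rightarrow> complex" where
  "ip N x y = (\<Sum>i<N. x i * cnj (y i))"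

definition mv :: "nat \<Rightarrow> (nat \<Rightarrow> nat \<Rightarrow> complex) \<Rightarrow> (nat \<Rightarrow> complex) \<Rightarrow> nat \<Rightarrow> complex" where
  "mv N A x i = (\<Sum>j<N. A i j * x j)"

lemma ip_cong: "(\<And>i. i < N \<Longrightarrow> x i = x' i) \<Longrightarrow> (\<And>i. i < N \<Longrightarrow> y i = y' i) \<Longrightarrow> ip N x y = ip N x' y'"
  unfolding ip_def by (intro sum.cong) auto

lemma ip_self: "ip N x x = of_real (\<Sum>i<N. (cmod (x i))\<^sup>2)"
  unfolding ip_def of_real_sum complex_norm_square ..

global_interpretation ip: hform "ip N" for N
proof
  show "ip N (\<lambda>i. x i + y i) z = ip N x z + ip N y z" for x y z
    by (simp add: ip_def algebra_simps sum.distrib)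
  show "ip N (\<lambda>i. c * x i) z = c * ip N x z" for c x z
    by (simp add: ip_def sum_distrib_left mult.assoc)
  show "ip N y x = cnj (ip N x y)" for x y
    by (simp add: ip_def mult.commute)
  show "0 \<le> Re (ip N x x)" for x
    by (simp add: ip_self sum_nonneg)
qed

lemma linop_mv: "linop (mv N A)"
  unfolding linop_def mv_def by (auto simp: algebra_simps sum.distrib sum_distrib_left)

lemma mv_cong: "(\<And>i. i < N \<Longrightarrow> x i = x' i) \<Longrightarrow> mv N A x = mv N A x'"
  unfolding mv_def by (intro ext sum.cong) auto

definition adjoint_on :: "nat \<Rightarrow> (nat \<Rightarrow> nat \<Rightarrow> complex) \<Rightarrow> (nat \<Rightarrow> nat \<Rightarrow> complex) \<Rightarrow> bool" where
  "adjoint_on N A B \<longleftrightarrow> (\<forall>i<N. \<forall>j<N. B j i = cnj (A i j))"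

lemma ip_adjoint: "adjoint_on N A B \<Longrightarrow> ip N (mv N A x) y = ip N x (mv N B y)"
proof -
  assume "adjoint_on N A B"
  then have 1: "cnj (B j i) = A i j" if "i < N" "j < N" for i j using that by (auto simp: adjoint_on_def)
  have "ip N (mv N A x) y = (\<Sum>i<N. \<Sum>j<N. A i j * x j * cnj (y i))"
    by (simp add: ip_def mv_def sum_distrib_right)
  also have "\<dots> = (\<Sum>j<N. \<Sum>i<N. A i j * x j * cnj (y i))" by (rule sum.swap)
  also have "\<dots> = (\<Sum>j<N. x j * (\<Sum>i<N. cnj (B j i) * cnj (y i)))"
    unfolding sum_distrib_left by (intro sum.cong refl) (simp add: 1 mult_ac)
  also have "\<dots> = ip N x (mv N B y)" by (simp add: ip_def mv_def)
  finally show ?thesis .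
qed

text \<open>A power is a word over a one-letter alphabet, so that facts on words and on their
  adjoints apply to it.\<close>

definition mpow :: "nat \<Rightarrow> (nat \<Rightarrow> nat \<Rightarrow> complex) \<Rightarrow> nat \<Rightarrow> nat \<Rightarrow> nat \<Rightarrow> complex" where
  "mpow N A k = word_mat N (\<lambda>_ :: unit. A) (replicate k ())"

lemma mv_word_Nil: "i < N \<Longrightarrow> mv N (word_mat N L []) v i = v i"
proof -
  assume i: "i < N"
  have "mv N (word_mat N L []) v i = (\<Sum>j<N. if j = i then v j else 0)"
    unfolding mv_def by (intro sum.cong) auto
  then show ?thesis using i by simp
qed

lemma mv_word_Cons: "mv N (word_mat N L (x # u)) v = mv N (L x) (mv N (word_mat N L u) v)"
  unfolding mv_def word_mat.simps sum_distrib_right sum_distrib_left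
  by (intro ext, subst sum.swap) (simp add: mult.assoc)

lemma mv_word_append:
  "i < N \<Longrightarrow> mv N (word_mat N L (u @ w)) v i = mv N (word_mat N L u) (mv N (word_mat N L w) v) i"
proof (induction u arbitrary: i)
  case Nil
  then show ?case by (simp only: append_Nil mv_word_Nil)
next
  case (Cons x u)
  have "mv N (L x) (mv N (word_mat N L (u @ w)) v) = mv N (L x) (mv N (word_mat N L u) (mv N (word_mat N L w) v))"
    by (rule mv_cong) (rule Cons.IH)
  then show ?case by (simp only: append_Cons mv_word_Cons)
qed

lemma mv_mpow: "i < N \<Longrightarrow> mv N (mpow N A k) v i = (mv N A ^^ k) v i"
proof (induction k arbitrary: i)
  case 0
  then show ?case unfolding mpow_def by (simp only: replicate_0 mv_word_Nil funpow_0)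
next
  case (Suc k)
  have "mv N A (mv N (mpow N A k) v) = mv N A ((mv N A ^^ k) v)"
    by (rule mv_cong) (rule Suc.IH)
  then show ?case by (simp only: mpow_def replicate_Suc mv_word_Cons funpow.simps o_apply)
qed

lemma adjoint_on_word_rev:
  assumes "\<And>x. adjoint_on N (L x) (L (s x))"
  shows "adjoint_on N (word_mat N L w) (word_mat N L (rev (map s w)))"
proof (induction w)
  case Nil
  then show ?case by (auto simp: adjoint_on_def)
next
  case (Cons x w)
  show ?case unfolding adjoint_on_def
  proof (intro allI impI)
    fix i j assume ij: "i < N" "j < N"
    have "word_mat N L (rev (map s (x # w))) j i = (\<Sum>k<N. word_mat N L (rev (map s w)) j k * word_mat N L [s x] k i)"
      using ij by (simp add: word_mat_append del: word_mat.simps)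
    also have "\<dots> = (\<Sum>k<N. cnj (word_mat N L w k j) * cnj (L x i k))"
    proof (intro sum.cong refl arg_cong2[where f="(*)"])
      fix k assume "k \<in> {..<N}"
      then have k: "k < N" by simp
      show "word_mat N L (rev (map s w)) j k = cnj (word_mat N L w k j)"
        using Cons k ij by (auto simp: adjoint_on_def)
      have "word_mat N L [s x] k i = (\<Sum>l<N. if l = i then L (s x) k l else 0)"
        unfolding word_mat.simps by (intro sum.cong refl) auto
      also have "\<dots> = L (s x) k i" using ij by simp
      also have "\<dots> = cnj (L x i k)" using assms[of x] k ij by (auto simp: adjoint_on_def)
      finally show "word_mat N L [s x] k i = cnj (L x i k)" .
    qed
    finally show "word_mat N L (rev (map s (x # w))) j i = cnj (word_mat N L (x # w) i j)"
      by (simp add: mult.commute)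
  qed
qed

lemma adjoint_on_mpow: "adjoint_on N A A \<Longrightarrow> adjoint_on N (mpow N A k) (mpow N A k)"
  using adjoint_on_word_rev[of N "\<lambda>_. A" "\<lambda>x. x" "replicate k ()"] by (simp add: mpow_def)

lemma mpow_2: "mpow N A 2 i j = (\<Sum>k<N. A i k * A k j)" if "i < N" "j < N" for N A i j
proof -
  have "word_mat N (\<lambda>_ :: unit. A) [()] k j = A k j" for k
  proof -
    have "word_mat N (\<lambda>_ :: unit. A) [()] k j = (\<Sum>l<N. if l = j then A k l else 0)"
      unfolding word_mat.simps by (intro sum.cong refl) auto
    then show ?thesis using that by simp
  qed
  then show ?thesis by (simp add: mpow_def numeral_2_eq_2 del: word_mat.simps(1))
qed

lemma word_mat_concat:
  "i < N \<Longrightarrow> word_mat N L (concat (replicate k w)) i j = mpow N (word_mat N L w) k i j"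
proof (induction k arbitrary: i)
  case (Suc k)
  have "word_mat N L (concat (replicate (Suc k) w)) i j = (\<Sum>l<N. word_mat N L w i l * word_mat N L (concat (replicate k w)) l j)"
    using Suc.prems by (simp only: replicate_Suc concat.simps word_mat_append)
  also have "\<dots> = (\<Sum>l<N. word_mat N L w i l * mpow N (word_mat N L w) k l j)"
    by (intro sum.cong refl arg_cong2[where f="(*)"] Suc.IH) simp
  also have "\<dots> = mpow N (word_mat N L w) (Suc k) i j"
    by (simp only: mpow_def replicate_Suc word_mat.simps)
  finally show ?case .
qed (simp add: mpow_def)

lemma mpow_mpow: "i < N \<Longrightarrow> mpow N (mpow N A l) k i j = mpow N A (l * k) i j"
proof -
  assume "i < N"
  have "concat (replicate k (replicate l ())) = replicate (l * k) ()"
    by (induction k) (simp_all add: replicate_add)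
  then show ?thesis
    using word_mat_concat[OF \<open>i < N\<close>, of "\<lambda>_. A" k "replicate l ()" j] by (simp add: mpow_def)
qed

definition mtrace :: "nat \<Rightarrow> (nat \<Rightarrow> nat \<Rightarrow> complex) \<Rightarrow> real" where
  "mtrace N A = Re (\<Sum>i<N. A i i)"

lemma mtrace_cong: "(\<And>i. i < N \<Longrightarrow> A i i = B i i) \<Longrightarrow> mtrace N A = mtrace N B"
  unfolding mtrace_def by (intro arg_cong[where f=Re] sum.cong) auto

lemma frobenius:
  assumes A: "adjoint_on N A A"
  shows "mtrace N (mpow N A 2) = (\<Sum>i<N. \<Sum>j<N. (cmod (A i j))\<^sup>2)"
proof -
  have "(\<Sum>i<N. mpow N A 2 i i) = (\<Sum>i<N. \<Sum>k<N. of_real ((cmod (A i k))\<^sup>2))"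
  proof (intro sum.cong refl)
    fix i assume "i \<in> {..<N}"
    then have i: "i < N" by simp
    show "mpow N A 2 i i = (\<Sum>k<N. of_real ((cmod (A i k))\<^sup>2))"
      unfolding mpow_2[OF i i]
    proof (intro sum.cong refl)
      fix k assume "k \<in> {..<N}"
      then have eq: "A k i = cnj (A i k)" using A i unfolding adjoint_on_def by blast
      show "A i k * A k i = of_real ((cmod (A i k))\<^sup>2)" unfolding eq complex_norm_square ..
    qed
  qed
  then show ?thesis by (simp add: mtrace_def)
qed

lemma norm_mv_le_frobenius:
  assumes v: "Re (ip N v v) = 1"
  shows "Re (ip N (mv N A v) (mv N A v)) \<le> (\<Sum>i<N. \<Sum>j<N. (cmod (A i j))\<^sup>2)"
proof -
  have "(cmod (mv N A v i))\<^sup>2 \<le> (\<Sum>j<N. (cmod (A i j))\<^sup>2)" for i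
  proof -
    have "mv N A v i = ip N (A i) (\<lambda>j. cnj (v j))" by (simp add: mv_def ip_def)
    moreover have "Re (ip N (\<lambda>j. cnj (v j)) (\<lambda>j. cnj (v j))) = 1" using v by (simp add: ip_self)
    ultimately show ?thesis
      using ip.cauchy_schwarz[of N "A i" "\<lambda>j. cnj (v j)"] by (simp add: ip_self)
  qed
  then show ?thesis by (simp add: ip_self sum_mono)
qed

text \<open>Cauchy-Schwarz bounds \<open><A v, v>^2\<close> by \<open><A^2 v, v>\<close>, and the
  induction passes from \<open>A\<close> to \<open>A^2\<close>; at the end the Hilbert-Schmidt norm
  is the trace of the square. Hence the exponents that are powers of two.\<close>

lemma quadratic_form_power_le:
  assumes "adjoint_on N A A" and v: "Re (ip N v v) = 1"
  shows "Re (ip N (mv N A v) v) ^ 2 ^ Suc j \<le> mtrace N (mpow N A (2 ^ Suc j))"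
  using assms(1)
proof (induction j arbitrary: A)
  case 0
  have "(Re (ip N (mv N A v) v))\<^sup>2 \<le> (cmod (ip N (mv N A v) v))\<^sup>2"
    using abs_Re_le_cmod by (rule power2_le_iff_abs_le[THEN iffD2, rotated]) simp
  also have "\<dots> \<le> Re (ip N (mv N A v) (mv N A v))"
    using ip.cauchy_schwarz[of N "mv N A v" v] v by simp
  also have "\<dots> \<le> mtrace N (mpow N A 2)"
    unfolding frobenius[OF 0] by (rule norm_mv_le_frobenius[OF v])
  finally show ?case by simp
next
  case (Suc j)
  define B where "B = mpow N A 2"
  have B: "adjoint_on N B B" unfolding B_def by (rule adjoint_on_mpow[OF Suc.prems])
  have "(Re (ip N (mv N A v) v))\<^sup>2 \<le> (cmod (ip N (mv N A v) v))\<^sup>2"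
    using abs_Re_le_cmod by (rule power2_le_iff_abs_le[THEN iffD2, rotated]) simp
  also have "\<dots> \<le> Re (ip N (mv N A v) (mv N A v))"
    using ip.cauchy_schwarz[of N "mv N A v" v] v by simp
  also have "ip N (mv N A v) (mv N A v) = ip N (mv N A (mv N A v)) v"
    using ip_adjoint[OF Suc.prems, of "mv N A v" v] by simp
  also have "\<dots> = ip N (mv N B v) v"
    by (rule ip_cong) (auto simp: B_def mv_mpow numeral_2_eq_2)
  finally have "(Re (ip N (mv N A v) v))\<^sup>2 ^ 2 ^ Suc j \<le> Re (ip N (mv N B v) v) ^ 2 ^ Suc j"
    by (intro power_mono) auto
  also have "\<dots> \<le> mtrace N (mpow N B (2 ^ Suc j))" by (rule Suc.IH[OF B])
  also have "\<dots> = mtrace N (mpow N A (2 ^ Suc (Suc j)))"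
    unfolding B_def by (intro mtrace_cong) (simp add: mpow_mpow)
  finally show ?case by (simp add: power_mult[symmetric])
qed

text \<open>Positivity makes \<open><A u, v>\<close> a form of its own, whose Cauchy-Schwarz
  inequality turns the bound on diagonal values into an operator bound. The trace of the power
  \<open>2 * K\<close> is then the sum of the squared norms of the \<open>N\<close> columns of the
  power \<open>K\<close>.\<close>

lemma mtrace_power_le:
  assumes A: "adjoint_on N A A" and lo: "\<And>v. 0 \<le> Re (ip N (mv N A v) v)"
    and hi: "\<And>v. Re (ip N v v) = 1 \<Longrightarrow> Re (ip N (mv N A v) v) \<le> t" and t: "0 \<le> t"
  shows "mtrace N (mpow N A (2 * K)) \<le> real N * t ^ (2 * K)"
proof -
  interpret T: hform "\<lambda>u v. ip N (mv N A u) v"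
  proof
    fix x y z :: "nat \<Rightarrow> complex" and c
    show "ip N (mv N A (\<lambda>i. x i + y i)) z = ip N (mv N A x) z + ip N (mv N A y) z"
      by (simp add: linopD[OF linop_mv] ip.add_left)
    show "ip N (mv N A (\<lambda>i. c * x i)) z = c * ip N (mv N A x) z"
      by (simp add: linopD[OF linop_mv] ip.scale_left)
    show "ip N (mv N A y) x = cnj (ip N (mv N A x) y)"
      unfolding ip_adjoint[OF A, of y x] by (rule ip.herm)
  qed (rule lo)
  have hi': "Re (ip N (mv N A v) v) \<le> t * Re (ip N v v)" for v
  proof (cases "Re (ip N v v) = 0")
    case True
    then have "(cmod (ip N (mv N A v) v))\<^sup>2 \<le> 0"
      using ip.cauchy_schwarz[of N "mv N A v" v] by simp
    then show ?thesis using True by simp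
  next
    case False
    define r where "r = sqrt (Re (ip N v v))"
    have r: "0 < r" "r * r = Re (ip N v v)"
      using False ip.pos[of N v] by (auto simp: r_def)
    define w where "w = (\<lambda>i. of_real (1 / r) * v i)"
    have w: "ip N w w = of_real (1 / (r * r)) * ip N v v" "ip N (mv N A w) w = of_real (1 / (r * r)) * ip N (mv N A v) v"
      unfolding w_def linopD[OF linop_mv] ip.scale_left ip.scale_right by simp_all
    have "Re (of_real (1 / (r * r)) * z) = Re z / Re (ip N v v)" for z unfolding r(2) by simp
    moreover have "0 < Re (ip N v v)" unfolding r(2)[symmetric] using r(1) by simp
    ultimately show ?thesis using hi[of w] r unfolding w by (simp add: pos_divide_le_eq)
  qed
  have step: "Re (ip N (mv N A u) (mv N A u)) \<le> t\<^sup>2 * Re (ip N u u)" for u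
  proof -
    have b: "cmod (ip N (mv N A x) y) \<le> t" if "Re (ip N x x) \<le> 1" "Re (ip N y y) \<le> 1" for x y
    proof -
      have "cmod (ip N (mv N A x) y) \<le> (Re (ip N (mv N A x) x) + Re (ip N (mv N A y) y)) / 2"
        by (rule T.norm_le_avg)
      also have "\<dots> \<le> (t * 1 + t * 1) / 2"
        using hi'[of x] hi'[of y] mult_left_mono[OF that(1) t] mult_left_mono[OF that(2) t] by simp
      finally show ?thesis by simp
    qed
    show ?thesis by (rule ip.bounded_op_self[OF linop_mv b t])
  qed
  have pw: "Re (ip N ((mv N A ^^ k) u) ((mv N A ^^ k) u)) \<le> t ^ (2 * k) * Re (ip N u u)" for k u
  proof (induction k)
    case (Suc k)
    have "Re (ip N ((mv N A ^^ Suc k) u) ((mv N A ^^ Suc k) u)) \<le> t\<^sup>2 * Re (ip N ((mv N A ^^ k) u) ((mv N A ^^ k) u))"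
      using step[of "(mv N A ^^ k) u"] by simp
    also have "\<dots> \<le> t\<^sup>2 * (t ^ (2 * k) * Re (ip N u u))" by (intro mult_left_mono Suc) simp
    finally show ?case by (simp add: power2_eq_square mult_ac)
  qed simp
  define e :: "nat \<Rightarrow> nat \<Rightarrow> complex" where "e i = (\<lambda>j. of_bool (j = i))" for i
  have col: "mv N B (e i) j = B j i" if "i < N" for B i j
  proof -
    have "mv N B (e i) j = (\<Sum>k<N. if k = i then B j k else 0)"
      unfolding mv_def e_def by (intro sum.cong refl) auto
    then show ?thesis using that by simp
  qed
  have "mtrace N (mpow N A (2 * K)) = mtrace N (mpow N (mpow N A K) 2)"
    by (intro mtrace_cong) (simp add: mpow_mpow mult.commute)
  also have "\<dots> = (\<Sum>i<N. \<Sum>j<N. (cmod (mpow N A K i j))\<^sup>2)"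
    by (rule frobenius[OF adjoint_on_mpow[OF A]])
  also have "\<dots> = (\<Sum>j<N. \<Sum>i<N. (cmod (mpow N A K i j))\<^sup>2)" by (rule sum.swap)
  also have "\<dots> \<le> (\<Sum>j<N. t ^ (2 * K))"
  proof (intro sum_mono)
    fix j assume "j \<in> {..<N}"
    then have j: "j < N" by simp
    have "(\<Sum>i<N. (cmod (mpow N A K i j))\<^sup>2) = Re (ip N (mv N (mpow N A K) (e j)) (mv N (mpow N A K) (e j)))"
      by (simp add: ip_self col[OF j])
    also have "ip N (mv N (mpow N A K) (e j)) (mv N (mpow N A K) (e j)) = ip N ((mv N A ^^ K) (e j)) ((mv N A ^^ K) (e j))"
      by (rule ip_cong) (auto simp: mv_mpow)
    also have "Re \<dots> \<le> t ^ (2 * K) * Re (ip N (e j) (e j))" by (rule pw)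
    also have "Re (ip N (e j) (e j)) = 1"
    proof -
      have "(\<Sum>i<N. (cmod (e j i))\<^sup>2) = (\<Sum>i<N. if i = j then 1 else 0)"
        by (intro sum.cong) (auto simp: e_def)
      then show ?thesis using j by (simp add: ip_self)
    qed
    finally show "(\<Sum>i<N. (cmod (mpow N A K i j))\<^sup>2) \<le> t ^ (2 * K)" by simp
  qed
  finally show ?thesis by simp
qed

section \<open>The numerical range and the spectral constant\<close>

definition nrange :: "nat \<Rightarrow> (nat \<Rightarrow> nat \<Rightarrow> complex) \<Rightarrow> complex set" where
  "nrange N A = {ip N (mv N A v) v | v. Re (ip N v v) = 1}"

lemma nrange_scaled: "0 < Re (ip N v v) \<Longrightarrow> ip N (mv N A v) v / ip N v v \<in> nrange N A"
proof -
  assume p: "0 < Re (ip N v v)"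
  define r where "r = sqrt (Re (ip N v v))"
  have r: "0 < r" "r * r = Re (ip N v v)" using p by (auto simp: r_def)
  define w where "w = (\<lambda>i. of_real (1 / r) * v i)"
  have vv: "ip N v v = of_real (r * r)" using ip.self_real[of N v] r by simp
  have "ip N w w = of_real (1 / (r * r)) * ip N v v" "ip N (mv N A w) w = of_real (1 / (r * r)) * ip N (mv N A v) v"
    unfolding w_def linopD[OF linop_mv] ip.scale_left ip.scale_right by simp_all
  then have "Re (ip N w w) = 1" "ip N (mv N A v) v / ip N v v = ip N (mv N A w) w"
    using r(1) unfolding vv by simp_all
  then show ?thesis unfolding nrange_def by (intro CollectI exI[of _ w]) simp
qed

text \<open>The Toeplitz-Hausdorff theorem. After an affine normalisation two points of the numerical
  range become 0 and 1; the relative phase of the two vectors is then chosen so that the quadratic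
  form is real along the segment joining them, and the intermediate value theorem applies.\<close>

theorem convex_nrange: "convex (nrange N A)"
proof (rule convexI)
  fix a b and u v :: real
  assume ab: "a \<in> nrange N A" "b \<in> nrange N A" and uv: "0 \<le> u" "0 \<le> v" "u + v = 1"
  obtain x y where x: "Re (ip N x x) = 1" "a = ip N (mv N A x) x" and y: "Re (ip N y y) = 1" "b = ip N (mv N A y) y"
    using ab by (auto simp: nrange_def)
  show "u *\<^sub>R a + v *\<^sub>R b \<in> nrange N A"
  proof (cases "a = b")
    case True
    then have "u *\<^sub>R a + v *\<^sub>R b = a" using uv by (metis scaleR_left_distrib scaleR_one)
    then show ?thesis using ab by simp
  next
    case False
    define g where "g w z = (ip N (mv N A w) z - a * ip N w z) / (b - a)" for w z
    have g_add: "g (\<lambda>i. w i + z i) t = g w t + g z t" "g t (\<lambda>i. w i + z i) = g t w + g t z" for w z t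
      by (simp_all add: g_def linopD[OF linop_mv] ip.add_left ip.add_right add_divide_distrib[symmetric] algebra_simps)
    have g_scale: "g (\<lambda>i. c * w i) t = c * g w t" "g t (\<lambda>i. c * w i) = cnj c * g t w" for c w t
      by (simp_all add: g_def linopD[OF linop_mv] ip.scale_left ip.scale_right algebra_simps)
    have gx: "g x x = 0" using x ip.self_real[of N x] by (simp add: g_def)
    have gy: "g y y = 1" using y ip.self_real[of N y] False by (simp add: g_def)
    obtain c where c: "cmod c = 1" "Im (c * g x y + cnj c * g y x) = 0"
    proof -
      define d where "d = g x y - cnj (g y x)"
      have Im: "Im (c * g x y + cnj c * g y x) = Im (c * d)" for c by (simp add: d_def algebra_simps)
      show ?thesis
      proof (cases "d = 0")
        case False
        have "cnj d / of_real (cmod d) * d = of_real ((cmod d)\<^sup>2) / of_real (cmod d)"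
          unfolding complex_norm_square by simp
        then have "Im (cnj d / of_real (cmod d) * d) = 0" by (simp flip: of_real_power of_real_divide)
        moreover have "cmod (cnj d / of_real (cmod d)) = 1" using False by (simp add: norm_divide)
        ultimately show ?thesis using that[of "cnj d / of_real (cmod d)"] Im by metis
      qed (use that[of 1] Im[of 1] in simp)
    qed
    have cc: "c * cnj c = 1" using c(1) by (simp add: complex_norm_square[symmetric])
    define p where "p t = (\<lambda>i. of_real (1 - t) * (c * x i) + of_real t * y i)" for t :: real
    define s where "s = Re (c * g x y + cnj c * g y x)"
    have s: "c * g x y + cnj c * g y x = of_real s" using c(2) by (simp add: s_def complex_eq_iff)
    have gp: "g (p t) (p t) = of_real (t * (1 - t) * s + t\<^sup>2)" for t
    proof -
      have "g (p t) (p t) = of_real ((1 - t) * (1 - t)) * (c * cnj c) * g x x +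
         of_real (t * (1 - t)) * (c * g x y + cnj c * g y x) + of_real (t * t) * g y y"
        unfolding p_def g_add g_scale by (simp add: algebra_simps)
      then show ?thesis by (simp add: gx gy s power2_eq_square)
    qed
    define n where "n t = Re (ip N (p t) (p t))" for t
    have n: "ip N (p t) (p t) = of_real (n t)" for t using ip.self_real by (simp add: n_def)
    \<comment> \<open>A zero of the path would make \<open>c * x\<close> and \<open>y\<close>
      proportional with factors of equal modulus, so both would give the same value of the quadratic
      form, against \<open>a \<noteq> b\<close>.\<close>
    have n_pos: "0 < n t" if t: "0 \<le> t" "t \<le> 1" for t
    proof (rule ccontr)
      assume "\<not> 0 < n t"
      then have "n t = 0" using ip.pos[of N "p t"] by (simp add: n_def)
      then have "cmod (p t i) = 0" if "i < N" for i
        using that by (simp add: n_def ip_self sum_nonneg_eq_0_iff)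
      then have pz: "of_real (1 - t) * (c * x i) = - of_real t * y i" if "i < N" for i
        using that by (simp add: p_def add_eq_0_iff)
      have e1: "ip N (mv N A (\<lambda>i. of_real (1 - t) * (c * x i))) (\<lambda>i. of_real (1 - t) * (c * x i)) =
        ip N (mv N A (\<lambda>i. - of_real t * y i)) (\<lambda>i. - of_real t * y i)"
        using mv_cong[of N, OF pz] by (intro ip_cong pz) simp
      have e2: "ip N (\<lambda>i. of_real (1 - t) * (c * x i)) (\<lambda>i. of_real (1 - t) * (c * x i)) = ip N (\<lambda>i. - of_real t * y i) (\<lambda>i. - of_real t * y i)"
        by (intro ip_cong pz)
      have xx: "ip N x x = 1" and yy: "ip N y y = 1"
        using x(1) y(1) ip.self_real[of N x] ip.self_real[of N y] by simp_all
      have e2': "(1 - t)\<^sup>2 = t\<^sup>2"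
      proof -
        have "of_real ((1 - t)\<^sup>2) * (c * cnj c) * ip N x x = of_real (t\<^sup>2) * ip N y y"
          using e2 unfolding ip.scale_left ip.scale_right by (simp add: power2_eq_square mult_ac)
        then have "complex_of_real ((1 - t)\<^sup>2) = of_real (t\<^sup>2)" by (simp add: cc xx yy)
        then show ?thesis by (simp only: of_real_eq_iff)
      qed
      have "of_real ((1 - t)\<^sup>2) * (c * cnj c) * a = of_real (t\<^sup>2) * b"
        using e1 unfolding linopD[OF linop_mv] ip.scale_left ip.scale_right x y
        by (simp add: power2_eq_square mult_ac)
      then have "of_real (t\<^sup>2) * (a - b) = 0" by (simp add: cc e2' algebra_simps)
      then have "t = 0" using False by simp
      with e2' show False by simp
    qed
    define f where "f t = (t * (1 - t) * s + t\<^sup>2) / n t" for t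
    have cont_n: "continuous_on {0..1} n"
    proof -
      have "n = (\<lambda>t. \<Sum>i<N. (cmod (p t i))\<^sup>2)"
        by (simp add: fun_eq_iff n_def ip_self)
      then show ?thesis unfolding p_def by (simp only:) (intro continuous_intros)
    qed
    have "continuous_on {0..1} f"
      unfolding f_def by (intro continuous_intros cont_n) (use n_pos in force)
    moreover have "f 0 = 0" by (simp add: f_def)
    moreover have "f 1 = 1"
    proof -
      have "n 1 = 1" using y(1) by (simp add: n_def p_def)
      then show ?thesis by (simp add: f_def)
    qed
    ultimately obtain t where t: "0 \<le> t" "t \<le> 1" "f t = v"
      using IVT'[of f 0 v 1] uv by auto
    have "ip N (mv N A (p t)) (p t) / ip N (p t) (p t) = a + (b - a) * (g (p t) (p t) / of_real (n t))"
      using n_pos[OF t(1,2)] False by (simp add: g_def n field_simps)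
    also have "g (p t) (p t) / of_real (n t) = of_real v"
      unfolding gp t(3)[symmetric] f_def by simp
    also have "a + (b - a) * of_real v = u *\<^sub>R a + v *\<^sub>R b"
    proof -
      have u: "u = 1 - v" using uv by simp
      show ?thesis unfolding u by (simp add: scaleR_conv_of_real algebra_simps)
    qed
    finally show ?thesis
      using nrange_scaled[of N "p t" A] n_pos[OF t(1,2)] by (simp add: n)
  qed
qed

lemma summable_index_geometric:
  assumes "0 \<le> x" "x < (1 :: real)"
  shows "summable (\<lambda>k. real k * x ^ k)"
proof (rule summable_comparison_test')
  show "summable (\<lambda>k. real (Suc k) * x ^ k)"
    by (rule sums_summable[OF geometric_deriv_sums]) (use assms in simp)
  show "norm (real k * x ^ k) \<le> real (Suc k) * x ^ k" for k
    using assms by (simp add: mult_right_mono)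
qed

lemma numerical_range_eq: "A \<in> carrier_mat n n \<Longrightarrow> numerical_range A = nrange n (\<lambda>i j. A $$ (i, j))"
proof -
  assume A: "A \<in> carrier_mat n n"
  define a where "a = (\<lambda>i j. A $$ (i, j))"
  have norm: "cvec_norm v = 1 \<longleftrightarrow> Re (ip n (\<lambda>i. v $ i) (\<lambda>i. v $ i)) = 1" if "v \<in> carrier_vec n" for v
    using that by (simp add: cvec_norm_def L2_set_def ip_self)
  have val: "(A *\<^sub>v v) \<bullet>c v = ip n (mv n a (\<lambda>i. v $ i)) (\<lambda>i. v $ i)" if "v \<in> carrier_vec n" for v
    using A that unfolding ip_def mv_def a_def
    by (simp add: scalar_prod_def atLeast0LessThan)
  show ?thesis unfolding a_def[symmetric]
  proof (intro equalityI subsetI)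
    fix z assume "z \<in> numerical_range A"
    then obtain v where v: "v \<in> carrier_vec n" "cvec_norm v = 1" "z = (A *\<^sub>v v) \<bullet>c v"
      using A by (auto simp: numerical_range_def)
    then show "z \<in> nrange n a"
      unfolding nrange_def by (intro CollectI exI[of _ "\<lambda>i. v $ i"]) (simp add: norm val)
  next
    fix z assume "z \<in> nrange n a"
    then obtain x where x: "z = ip n (mv n a x) x" "Re (ip n x x) = 1" by (auto simp: nrange_def)
    define v where "v = Matrix.vec n x"
    have v: "v \<in> carrier_vec n" by (simp add: v_def)
    have vx: "v $ i = x i" if "i < n" for i using that by (simp add: v_def)
    have e: "mv n a (\<lambda>i. v $ i) = mv n a x" by (rule mv_cong) (rule vx)
    have "ip n (\<lambda>i. v $ i) (\<lambda>i. v $ i) = ip n x x" by (intro ip_cong vx)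
    moreover have "ip n (mv n a (\<lambda>i. v $ i)) (\<lambda>i. v $ i) = z" unfolding e x(1) by (intro ip_cong vx refl)
    ultimately show "z \<in> numerical_range A"
      unfolding numerical_range_def
      by (intro CollectI exI[of _ v]) (use A v x(2) norm[OF v] val[OF v] in auto)
  qed
qed

lemma funpow_mv_entry:
  assumes A: "A \<in> carrier_mat n n"
  shows "i < n \<Longrightarrow> (mv n (\<lambda>i j. A $$ (i, j)) ^^ k) x i = (\<Sum>j<n. (A ^\<^sub>m k) $$ (i, j) * x j)"
proof (induction k arbitrary: x)
  case 0
  have "(\<Sum>j<n. (A ^\<^sub>m 0) $$ (i, j) * x j) = (\<Sum>j<n. if j = i then x j else 0)"
    using A 0 by (intro sum.cong) auto
  then show ?case using 0 by simp
next
  case (Suc k)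
  have Ak: "A ^\<^sub>m k \<in> carrier_mat n n" using A by simp
  have "(mv n (\<lambda>i j. A $$ (i, j)) ^^ Suc k) x i = (mv n (\<lambda>i j. A $$ (i, j)) ^^ k) (mv n (\<lambda>i j. A $$ (i, j)) x) i"
    by (simp add: funpow_swap1)
  also have "\<dots> = (\<Sum>j<n. (A ^\<^sub>m k) $$ (i, j) * (\<Sum>l<n. A $$ (j, l) * x l))"
    unfolding Suc.IH[OF Suc.prems] mv_def ..
  also have "\<dots> = (\<Sum>l<n. (\<Sum>j<n. (A ^\<^sub>m k) $$ (i, j) * A $$ (j, l)) * x l)"
    unfolding sum_distrib_left sum_distrib_right by (subst sum.swap) (simp add: mult.assoc)
  also have "\<dots> = (\<Sum>l<n. (A ^\<^sub>m Suc k) $$ (i, l) * x l)"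
    using Suc.prems A Ak by (intro sum.cong refl) (simp add: scalar_prod_def atLeast0LessThan)
  finally show ?case .
qed

lemma one_minus_power_le: "0 \<le> x \<Longrightarrow> x \<le> 1 \<Longrightarrow> 1 - x ^ k \<le> real k * (1 - x)" for x :: real
  using Bernoulli_inequality[of "x - 1" k] by (simp add: algebra_simps)

lemma norm_le_of_ip:
  assumes "\<And>y. Re (ip n y y) \<le> 1 \<Longrightarrow> cmod (ip n u y) \<le> B" and "0 \<le> B"
  shows "sqrt (Re (ip n u u)) \<le> B"
proof (cases "Re (ip n u u) = 0")
  case False
  define r where "r = sqrt (Re (ip n u u))"
  have r: "0 < r" "r * r = Re (ip n u u)"
    using False ip.pos[of n u] by (auto simp: r_def)
  define y where "y = (\<lambda>i. of_real (1 / r) * u i)"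
  have uu: "ip n u u = of_real (r * r)" using ip.self_real[of n u] r by simp
  have "Re (ip n y y) \<le> 1" unfolding y_def ip.scale_left ip.scale_right uu using r(1) by simp
  from assms(1)[OF this] have "r \<le> B"
    unfolding y_def ip.scale_right uu using r(1) by (simp add: norm_mult norm_divide)
  then show ?thesis by (simp add: r_def)
qed (use assms in simp)

text \<open>If \<open>M\<close> bounds \<open>f\<close> on the numerical range, then
  \<open>f (r' * z)\<close> is bounded by \<open>M\<close> on the unit disc. Inserting
  \<open>T = A / \<rho>\<close>, whose numerical radius is at most 1, gives \<open>f (q A)\<close>
  with \<open>q = r' / \<rho>\<close>, of norm at most \<open>2 * M\<close>. The difference between
  \<open>f (A)\<close> and \<open>f (q A)\<close> is summed over Taylor coefficients of size
  \<open>M / r' ^ k\<close> against powers of size \<open>C * \<theta> ^ k\<close>, using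
  \<open>1 - q ^ k \<le> k * (1 - q)\<close>.\<close>

theorem spectral_constant_le:
  assumes A: "A \<in> carrier_mat n n"
    and a_def: "a = (\<lambda>i j. A $$ (i, j))"
    and pw: "\<And>k u v. Re (ip n u u) \<le> 1 \<Longrightarrow> Re (ip n v v) \<le> 1 \<Longrightarrow> cmod (ip n ((mv n a ^^ k) u) v) \<le> C * \<theta> ^ k"
    and w: "\<And>v. cmod (ip n (mv n a v) v) \<le> \<rho> * Re (ip n v v)"
    and disc: "ball 0 r \<subseteq> nrange n a"
    and th: "0 < \<theta>" "\<theta> < r'" "r' < r" "r' \<le> \<rho>"
  shows "spectral_constant (numerical_range A) A \<le> ennreal (2 + C * (1 - r' / \<rho>) * (\<Sum>k. real k * (\<theta> / r') ^ k))"
proof -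
  define B where "B = 2 + C * (1 - r' / \<rho>) * (\<Sum>k. real k * (\<theta> / r') ^ k)"
  have pos: "0 < r'" "0 < \<rho>" "0 < r" using th by auto
  have C0: "0 \<le> C" using order.trans[OF norm_ge_zero pw[of "\<lambda>i. 0" "\<lambda>i. 0" 0]] by simp
  have sum1: "summable (\<lambda>k. real k * (\<theta> / r') ^ k)"
    by (rule summable_index_geometric) (use th pos in simp_all)
  define \<Omega> where "\<Omega> = numerical_range A"
  have Om: "\<Omega> = nrange n a" by (simp add: \<Omega>_def numerical_range_eq[OF A] a_def)
  have ball: "ball 0 r \<subseteq> interior \<Omega>" using disc by (intro interior_maximal) (auto simp: Om)
  have ent: "cmod ((A ^\<^sub>m k) $$ (i, j)) \<le> C * \<theta> ^ k" if ij: "i < n" "j < n" for i j k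
  proof -
    define e where "e l = (\<lambda>i. of_bool (i = l) :: complex)" for l :: nat
    have ee: "Re (ip n (e l) (e l)) \<le> 1" if "l < n" for l
    proof -
      have "(\<Sum>i<n. (cmod (e l i))\<^sup>2) = (\<Sum>i<n. if i = l then 1 else 0)"
        by (intro sum.cong) (auto simp: e_def)
      then show ?thesis using that by (simp add: ip_self)
    qed
    have col: "(mv n a ^^ k) (e j) l = (A ^\<^sub>m k) $$ (l, j)" if "l < n" for l
    proof -
      have "(mv n a ^^ k) (e j) l = (\<Sum>m<n. if m = j then (A ^\<^sub>m k) $$ (l, m) else 0)"
        unfolding a_def funpow_mv_entry[OF A that] e_def by (intro sum.cong refl) auto
      then show ?thesis using ij by simp
    qed
    have "ip n ((mv n a ^^ k) (e j)) (e i) = (\<Sum>l<n. if l = i then (A ^\<^sub>m k) $$ (l, j) else 0)"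
      unfolding ip_def by (intro sum.cong refl) (simp add: col, simp add: e_def)
    then have "ip n ((mv n a ^^ k) (e j)) (e i) = (A ^\<^sub>m k) $$ (i, j)" using ij by simp
    then show ?thesis using pw[OF ee ee, OF ij(2,1), of k] by simp
  qed
  have sp: "spectrum A \<subseteq> interior \<Omega>"
  proof
    fix z assume "z \<in> spectrum A"
    then have "cmod z \<le> \<theta>" using resolvent_neumann(1)[OF A ent th(1)] by force
    then show "z \<in> interior \<Omega>" using ball th by (intro subsetD[OF ball]) simp
  qed
  have main: "op_norm2 (holo_calculus (interior \<Omega>) f A) \<le> B * M"
    if f: "f holomorphic_on interior \<Omega>" and M: "\<And>z. z \<in> \<Omega> \<Longrightarrow> cmod (f z) \<le> M" for f M
  proof -
    have fM: "cmod (f z) \<le> M" if "cmod z < r" for z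
      using M disc that by (auto simp: Om)
    have M0: "0 \<le> M" using order.trans[OF norm_ge_zero fM[of 0]] pos by simp
    define c where "c k = (deriv ^^ k) f 0 / fact k" for k
    define F where "F = holo_calculus (interior \<Omega>) f A"
    have F: "F \<in> carrier_mat n n" using A by (simp add: F_def holo_calculus_def Let_def)
    have Fs: "(\<lambda>k. c k * (A ^\<^sub>m k) $$ (i, j)) sums (F $$ (i, j))" if "i < n" "j < n" for i j
      unfolding c_def F_def
      by (rule holo_calculus_power_series[OF A ent th(1) _ open_interior ball f that]) (use th in auto)
    \<comment> \<open>Cauchy's estimate on this larger radius gives the Taylor series at radius
      \<open>r'\<close> a geometric tail, so its partial sums \<open>P m\<close> exceed the bound
      \<open>M\<close> on the unit disc by at most \<open>\<delta> m\<close>, which tends to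
      0.\<close>
    define r2 where "r2 = (r' + r) / 2"
    have r2: "r' < r2" "r2 < r" "0 < r2" using th pos by (auto simp: r2_def)
    have hol: "f holomorphic_on ball 0 r" by (rule holomorphic_on_subset[OF f ball])
    have c_le: "cmod (c k) \<le> M / r2 ^ k" for k
    proof -
      have "norm ((deriv ^^ k) f 0) \<le> fact k * M / r2 ^ k"
        by (rule Cauchy_inequality) (use r2 fM in \<open>auto intro!: holomorphic_on_subset[OF hol]
          continuous_on_subset[OF holomorphic_on_imp_continuous_on[OF hol]] simp: dist_norm\<close>)
      then show ?thesis by (simp add: c_def norm_divide field_simps)
    qed
    define x where "x = r' / r2"
    have x: "0 < x" "x < 1" using r2 pos by (auto simp: x_def)
    have cx: "cmod (c k * of_real (r' ^ k)) \<le> M * x ^ k" for k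
    proof -
      have "cmod (c k * of_real (r' ^ k)) = cmod (c k) * r' ^ k" using pos by (simp add: norm_mult norm_power)
      also have "\<dots> \<le> M / r2 ^ k * r' ^ k" using c_le[of k] pos by (intro mult_right_mono) auto
      finally show ?thesis by (simp add: x_def power_divide)
    qed
    define P where "P m = (\<Sum>k\<le>m. Polynomial.monom (c k * of_real (r' ^ k)) k)" for m
    have coeffP: "coeff (P m) k = (if k \<le> m then c k * of_real (r' ^ k) else 0)" for m k
      by (simp add: P_def coeff_sum)
    have degP: "degree (P m) \<le> m" for m by (rule degree_le) (simp add: coeffP)
    have polyP: "poly (P m) z = (\<Sum>k\<le>m. c k * (of_real r' * z) ^ k)" for m z
      by (simp add: P_def poly_sum poly_monom power_mult_distrib mult.assoc)
    define \<delta> where "\<delta> m = M * (x ^ Suc m / (1 - x))" for m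
    have P_le: "cmod (poly (P m) z) \<le> M + \<delta> m" if z: "cmod z \<le> 1" for m z
    proof -
      have rz: "cmod (of_real r' * z) < r"
      proof -
        have "r' * cmod z \<le> r' * 1" using z th by (intro mult_left_mono) auto
        then have "r' * cmod z < r" using th by linarith
        moreover have "cmod (of_real r' * z) = r' * cmod z" using th by (simp add: norm_mult)
        ultimately show ?thesis by simp
      qed
      have s: "(\<lambda>k. c k * (of_real r' * z) ^ k) sums f (of_real r' * z)"
        using holomorphic_power_series[OF hol, of "of_real r' * z"] rz by (simp add: c_def)
      have b: "cmod (c k * (of_real r' * z) ^ k) \<le> M * x ^ k" for k
      proof -
        have "cmod (c k * (of_real r' * z) ^ k) = cmod (c k * of_real (r' ^ k)) * cmod z ^ k"
          by (simp add: norm_mult norm_power power_mult_distrib)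
        also have "\<dots> \<le> M * x ^ k * 1"
          using cx[of k] z M0 x by (intro mult_mono power_le_one) auto
        finally show ?thesis by simp
      qed
      have sg: "(\<lambda>k. M * x ^ (k + Suc m)) sums \<delta> m"
        using sums_mult[OF geometric_sums[of x], of "M * x ^ Suc m"] x
        by (simp add: \<delta>_def power_add mult_ac)
      have t: "(\<lambda>k. c (k + Suc m) * (of_real r' * z) ^ (k + Suc m)) sums (f (of_real r' * z) - poly (P m) z)"
        using sums_split_initial_segment[OF s, of "Suc m"] by (simp only: polyP lessThan_Suc_atMost)
      have "cmod (f (of_real r' * z) - poly (P m) z) \<le> \<delta> m"
        by (rule norm_sums_le[OF t sg b])
      then show ?thesis
        using norm_triangle_ineq4[of "f (of_real r' * z)" "f (of_real r' * z) - poly (P m) z"] fM[OF rz] by simp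
    qed
    have \<delta>0: "0 \<le> \<delta> m" for m using M0 x by (simp add: \<delta>_def)
    have \<delta>_lim: "\<delta> \<longlonglongrightarrow> 0"
    proof -
      have "(\<lambda>m. M * (x ^ Suc m / (1 - x))) \<longlonglongrightarrow> M * (0 / (1 - x))"
        using x by (intro tendsto_intros LIMSEQ_Suc LIMSEQ_power_zero) auto
      then show ?thesis by (simp add: \<delta>_def[abs_def])
    qed
    define T where "T = (\<lambda>v i. of_real (1 / \<rho>) * mv n a v i)"
    have T: "linop T"
      unfolding linop_def T_def linopD[OF linop_mv] by (auto simp: algebra_simps)
    have Tk: "(T ^^ k) v = (\<lambda>i. of_real (1 / \<rho> ^ k) * (mv n a ^^ k) v i)" for k v
    proof (induction k)
      case (Suc k)
      show ?case unfolding funpow.simps o_apply Suc unfolding T_def linopD[OF linop_mv]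
        by (simp add: mult_ac)
    qed simp
    interpret num_radius_contraction "ip n" T
    proof
      show "linop T" by (rule T)
      show "cmod (ip n (T v) v) \<le> Re (ip n v v)" for v
      proof -
        have "ip n (T v) v = of_real (1 / \<rho>) * ip n (mv n a v) v" unfolding T_def ip.scale_left ..
        then have "cmod (ip n (T v) v) = cmod (ip n (mv n a v) v) / \<rho>"
          using pos by (simp add: norm_mult norm_divide)
        then show ?thesis using w[of v] pos by (simp add: pos_divide_le_eq mult.commute)
      qed
      show "(\<lambda>k. Re (ip n ((T ^^ k) v) ((T ^^ k) v))) \<longlonglongrightarrow> 0" for v
      proof (rule real_tendsto_sandwich[where f="\<lambda>_. 0" and h="\<lambda>k. C\<^sup>2 * Re (ip n v v) * ((\<theta> / \<rho>)\<^sup>2) ^ k"])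
        show "\<forall>\<^sub>F k in sequentially. Re (ip n ((T ^^ k) v) ((T ^^ k) v)) \<le> C\<^sup>2 * Re (ip n v v) * ((\<theta> / \<rho>)\<^sup>2) ^ k"
        proof (intro always_eventually allI)
          fix k
          have "Re (ip n ((mv n a ^^ k) v) ((mv n a ^^ k) v)) \<le> (C * \<theta> ^ k)\<^sup>2 * Re (ip n v v)"
            by (rule ip.bounded_op_self[OF linop_funpow[OF linop_mv] pw]) (use C0 th in auto)
          moreover have "Re (ip n ((T ^^ k) v) ((T ^^ k) v)) = Re (ip n ((mv n a ^^ k) v) ((mv n a ^^ k) v)) / (\<rho> ^ k)\<^sup>2"
            unfolding Tk ip.scale_left ip.scale_right by (simp add: power2_eq_square)
          ultimately have *: "Re (ip n ((T ^^ k) v) ((T ^^ k) v)) \<le> (C * \<theta> ^ k)\<^sup>2 * Re (ip n v v) / (\<rho> ^ k)\<^sup>2"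
            by (simp add: divide_right_mono)
          show "Re (ip n ((T ^^ k) v) ((T ^^ k) v)) \<le> C\<^sup>2 * Re (ip n v v) * ((\<theta> / \<rho>)\<^sup>2) ^ k"
          proof -
            have e: "(x ^ k)\<^sup>2 = (x\<^sup>2) ^ k" for x :: real
              unfolding power_mult[symmetric] by (simp only: mult.commute)
            have "C\<^sup>2 * Re (ip n v v) * ((\<theta> / \<rho>)\<^sup>2) ^ k = (C * \<theta> ^ k)\<^sup>2 * Re (ip n v v) / (\<rho> ^ k)\<^sup>2"
              unfolding power_mult_distrib e power_divide by simp
            with * show ?thesis by simp
          qed
        qed
        have "\<bar>\<theta> / \<rho>\<bar> < 1" using th by simp
        then have "(\<theta> / \<rho>)\<^sup>2 < 1" by (simp only: abs_square_less_1)
        then have "(\<lambda>k. C\<^sup>2 * Re (ip n v v) * ((\<theta> / \<rho>)\<^sup>2) ^ k) \<longlonglongrightarrow> C\<^sup>2 * Re (ip n v v) * 0"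
          by (intro tendsto_intros LIMSEQ_power_zero) auto
        then show "(\<lambda>k. C\<^sup>2 * Re (ip n v v) * ((\<theta> / \<rho>)\<^sup>2) ^ k) \<longlonglongrightarrow> 0" by simp
      qed (simp_all add: ip.pos)
    qed
    have bound: "cmod (ip n (mv n (\<lambda>i j. F $$ (i, j)) u) y) \<le> B * M"
      if u: "Re (ip n u u) \<le> 1" and y: "Re (ip n y y) \<le> 1" for u y
    proof -
      define s where "s k = ip n ((mv n a ^^ k) u) y" for k
      have s_le: "cmod (s k) \<le> C * \<theta> ^ k" for k unfolding s_def by (rule pw[OF u y])
      have total: "(\<lambda>k. c k * s k) sums ip n (mv n (\<lambda>i j. F $$ (i, j)) u) y"
      proof -
        have "(\<lambda>k. \<Sum>i<n. (\<Sum>j<n. c k * (A ^\<^sub>m k) $$ (i, j) * u j) * cnj (y i)) sums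
          (\<Sum>i<n. (\<Sum>j<n. F $$ (i, j) * u j) * cnj (y i))"
          by (intro sums_sum sums_mult2 Fs) auto
        moreover have "(\<Sum>i<n. (\<Sum>j<n. c k * (A ^\<^sub>m k) $$ (i, j) * u j) * cnj (y i)) = c k * s k" for k
          unfolding s_def ip_def a_def sum_distrib_left
          by (intro sum.cong refl) (simp add: funpow_mv_entry[OF A] sum_distrib_left sum_distrib_right mult.assoc)
        ultimately show ?thesis by (simp add: ip_def mv_def)
      qed
      define q where "q = r' / \<rho>"
      have q: "0 \<le> q" "q \<le> 1" using th pos by (auto simp: q_def)
      have term_le: "cmod (c k * s k) * r'^k \<le> M * (C * \<theta> ^ k)" for k
      proof -
        have "cmod (c k) * r' ^ k \<le> M"
          using cx[of k] mult_left_le[of "x ^ k" M] power_le_one[of x k] x M0 pos by (simp add: norm_mult norm_power)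
        from mult_mono[OF this s_le[of k] M0] show ?thesis by (simp add: norm_mult mult_ac)
      qed
      have term_le': "cmod (c k * s k) \<le> M * C * (\<theta> / r') ^ k" for k
        using term_le[of k] pos by (simp add: power_divide field_simps)
      \<comment> \<open>\<open>poly_op_le\<close> wants a polynomial bounded by 1, so
        \<open>P m\<close> is divided by \<open>M + \<delta> m\<close>; if that number is 0, all
        coefficients vanish.\<close>
      have part: "cmod (\<Sum>k\<le>m. of_real (q ^ k) * (c k * s k)) \<le> 2 * (M + \<delta> m)" for m
      proof (cases "M + \<delta> m = 0")
        case True
        then have M_eq: "M = 0" using M0 \<delta>0[of m] by linarith
        then have "c k = 0" for k using c_le[of k] by simp
        then show ?thesis using True by simp
      next
        case False
        then have p: "0 < M + \<delta> m" using M0 \<delta>0[of m] by linarith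
        define Q where "Q = Polynomial.smult (of_real (1 / (M + \<delta> m))) (P m)"
        have "cmod (poly Q z) \<le> 1" if "cmod z \<le> 1" for z
          using P_le[OF that, of m] p by (simp add: Q_def norm_mult norm_divide divide_le_eq del: of_real_add of_real_divide)
        from poly_op_le[OF this u y] have "cmod (ip n (poly_op T Q u) y) \<le> 2" .
        then have "cmod (ip n (poly_op T (P m) u) y) \<le> 2 * (M + \<delta> m)"
          using p unfolding Q_def poly_op_smult ip.scale_left
          by (simp add: norm_mult norm_divide divide_le_eq del: of_real_add of_real_divide)
        also have "ip n (poly_op T (P m) u) y = (\<Sum>k\<le>m. of_real (q ^ k) * (c k * s k))"
          unfolding poly_op_altdef[OF degP] ip.sum_left ip.scale_left Tk
          by (intro sum.cong refl) (simp add: coeffP s_def q_def power_divide mult_ac)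
        finally show ?thesis .
      qed
      have smb: "summable (\<lambda>k. M * C * (\<theta> / r') ^ k)"
        using th pos by (intro summable_mult summable_geometric) auto
      have sq: "summable (\<lambda>k. of_real (q ^ k) * (c k * s k))"
      proof (rule summable_comparison_test'[OF smb])
        fix k
        have "norm (of_real (q ^ k) * (c k * s k)) = q ^ k * cmod (c k * s k)" using q by (simp add: norm_mult norm_power)
        also have "\<dots> \<le> 1 * (M * C * (\<theta> / r') ^ k)"
          using term_le'[of k] q by (intro mult_mono power_le_one) auto
        finally show "norm (of_real (q ^ k) * (c k * s k)) \<le> M * C * (\<theta> / r') ^ k" by simp
      qed
      have lim: "(\<lambda>m. cmod (\<Sum>k\<le>m. of_real (q ^ k) * (c k * s k))) \<longlonglongrightarrow> cmod (\<Sum>k. of_real (q ^ k) * (c k * s k))"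
        by (intro tendsto_norm summable_LIMSEQ'[OF sq])
      have lim2: "(\<lambda>m. 2 * (M + \<delta> m)) \<longlonglongrightarrow> 2 * (M + 0)" by (intro tendsto_intros \<delta>_lim)
      have one: "cmod (\<Sum>k. of_real (q ^ k) * (c k * s k)) \<le> 2 * M"
        using LIMSEQ_le[OF lim lim2] part by auto
      have diff: "(\<lambda>k. of_real (1 - q ^ k) * (c k * s k)) sums (ip n (mv n (\<lambda>i j. F $$ (i, j)) u) y - (\<Sum>k. of_real (q ^ k) * (c k * s k)))"
        using sums_diff[OF total summable_sums[OF sq]] by (simp add: algebra_simps)
      have dsum: "(\<lambda>k. M * C * (1 - q) * (real k * (\<theta> / r') ^ k)) sums (M * C * (1 - q) * (\<Sum>k. real k * (\<theta> / r') ^ k))"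
        by (intro sums_mult summable_sums sum1)
      have two: "cmod (ip n (mv n (\<lambda>i j. F $$ (i, j)) u) y - (\<Sum>k. of_real (q ^ k) * (c k * s k))) \<le> M * C * (1 - q) * (\<Sum>k. real k * (\<theta> / r') ^ k)"
      proof (rule norm_sums_le[OF diff dsum])
        fix k
        have "norm (of_real (1 - q ^ k) * (c k * s k)) = (1 - q ^ k) * cmod (c k * s k)"
          using q power_le_one[of q k] by (simp only: norm_mult norm_of_real) simp
        also have "\<dots> \<le> (real k * (1 - q)) * (M * C * (\<theta> / r') ^ k)"
          using term_le'[of k] q one_minus_power_le[OF q, of k] by (intro mult_mono) auto
        finally show "norm (of_real (1 - q ^ k) * (c k * s k)) \<le> M * C * (1 - q) * (real k * (\<theta> / r') ^ k)"
          by (simp add: mult_ac)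
      qed
      show ?thesis
        using norm_triangle_ineq[of "ip n (mv n (\<lambda>i j. F $$ (i, j)) u) y - (\<Sum>k. of_real (q ^ k) * (c k * s k))" "\<Sum>k. of_real (q ^ k) * (c k * s k)"]
          one two by (simp add: B_def q_def algebra_simps)
    qed
    have BM: "0 \<le> B * M" using order.trans[OF norm_ge_zero bound[of "\<lambda>_. 0" "\<lambda>_. 0"]] by simp
    show ?thesis unfolding F_def[symmetric] op_norm2_def
    proof (rule cSUP_least)
      show "{v \<in> carrier_vec (dim_col F). cvec_norm v \<le> 1} \<noteq> {}"
        by (auto intro!: exI[of _ "0\<^sub>v (dim_col F)"] simp: cvec_norm_def L2_set_def)
      fix v assume "v \<in> {v \<in> carrier_vec (dim_col F). cvec_norm v \<le> 1}"
      then have v: "v \<in> carrier_vec n" "cvec_norm v \<le> 1" using F by auto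
      have u: "Re (ip n (\<lambda>i. v $ i) (\<lambda>i. v $ i)) \<le> 1"
        using v by (simp add: cvec_norm_def L2_set_def ip_self)
      have "cvec_norm (F *\<^sub>v v) = sqrt (Re (ip n (mv n (\<lambda>i j. F $$ (i, j)) (\<lambda>i. v $ i)) (mv n (\<lambda>i j. F $$ (i, j)) (\<lambda>i. v $ i))))"
        using F v by (simp add: cvec_norm_def L2_set_def ip_self mv_def scalar_prod_def atLeast0LessThan)
      also have "\<dots> \<le> B * M" by (rule norm_le_of_ip[OF bound[OF u] BM])
      finally show "cvec_norm (F *\<^sub>v v) \<le> B * M" .
    qed
  qed
  have "ennreal (op_norm2 (holo_calculus (interior \<Omega>) f A)) / (SUP z\<in>\<Omega>. ennreal (cmod (f z))) \<le> ennreal B"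
    if f: "f \<in> spectral_test_functions \<Omega>" for f
  proof (cases "(SUP z\<in>\<Omega>. ennreal (cmod (f z)))")
    case (real M)
    have fM: "cmod (f z) \<le> M" if "z \<in> \<Omega>" for z
      using SUP_upper[OF that, of "\<lambda>z. ennreal (cmod (f z))"] real by (simp add: ennreal_le_iff)
    obtain z where "z \<in> \<Omega>" "f z \<noteq> 0" using f by (auto simp: spectral_test_functions_def)
    then have M: "0 < M" using fM[of z] by (meson less_le_trans zero_less_norm_iff)
    have "op_norm2 (holo_calculus (interior \<Omega>) f A) \<le> B * M"
      by (rule main) (use f fM in \<open>auto simp: spectral_test_functions_def\<close>)
    then have "ennreal (op_norm2 (holo_calculus (interior \<Omega>) f A)) / ennreal M \<le> ennreal (B * M) / ennreal M"
      by (intro divide_right_mono_ennreal ennreal_leI)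
    also have "\<dots> = ennreal B"
    proof (cases "0 \<le> B")
      case True
      then show ?thesis using M by (simp add: divide_ennreal)
    next
      case False
      then show ?thesis using M by (simp add: ennreal_neg mult_nonpos_nonneg)
    qed
    finally show ?thesis using real by simp
  next
    \<comment> \<open>A quotient with infinite denominator is 0 in \<open>ennreal\<close>.\<close>
    case top
    show ?thesis unfolding top by simp
  qed
  then show ?thesis
    unfolding spectral_constant_def \<Omega>_def[symmetric] B_def[symmetric] using sp by (auto intro!: SUP_least)
qed

section \<open>From trace bounds to norms and to the shape of the numerical range\<close>

definition gletters :: "(nat \<Rightarrow> nat \<Rightarrow> complex) \<Rightarrow> bool \<Rightarrow> nat \<Rightarrow> nat \<Rightarrow> complex" where
  "gletters a x i j = (if x then a i j else cnj (a j i))"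

text \<open>Hermitian part of \<open>c * a\<close>; for a unit number \<open>c\<close> its quadratic
  form measures the extent of the numerical range in the direction \<open>cnj c\<close>.\<close>

definition rotated_part :: "complex \<Rightarrow> (nat \<Rightarrow> nat \<Rightarrow> complex) \<Rightarrow> nat \<Rightarrow> nat \<Rightarrow> complex" where
  "rotated_part c a i j = (c * a i j + cnj c * cnj (a j i)) / 2"

definition power_word :: "nat \<Rightarrow> bool list" where
  "power_word m = replicate m True @ replicate m False"

lemma adjoint_gletters: "adjoint_on N (gletters a x) (gletters a (\<not> x))"
  by (auto simp: adjoint_on_def gletters_def)

lemma mv_replicate: "i < N \<Longrightarrow> mv N (word_mat N L (replicate m x)) v i = (mv N (L x) ^^ m) v i"
proof (induction m arbitrary: i)
  case 0
  then show ?case by (simp only: replicate_0 mv_word_Nil funpow_0)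
next
  case (Suc m)
  have "mv N (L x) (mv N (word_mat N L (replicate m x)) v) = mv N (L x) ((mv N (L x) ^^ m) v)"
    by (rule mv_cong) (rule Suc.IH)
  then show ?case by (simp only: replicate_Suc mv_word_Cons funpow.simps o_apply)
qed

lemma ip_eq_0_iff: "Re (ip N v v) = 0 \<longleftrightarrow> (\<forall>i<N. v i = 0)"
  by (auto simp: ip_self sum_nonneg_eq_0_iff)

lemma normalize:
  assumes "Re (ip N v v) \<noteq> 0"
  obtains s w where "0 < s" "Re (ip N w w) = 1" "v = (\<lambda>i. of_real s * w i)" "s\<^sup>2 = Re (ip N v v)"
proof -
  define s where "s = sqrt (Re (ip N v v))"
  have s: "0 < s" "s\<^sup>2 = Re (ip N v v)" using assms ip.pos[of N v] by (auto simp: s_def)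
  define w where "w = (\<lambda>i. of_real (1 / s) * v i)"
  have v: "v = (\<lambda>i. of_real s * w i)" using s by (simp add: w_def)
  have "ip N v v = of_real (s\<^sup>2) * ip N w w"
    by (subst (1 2) v) (simp only: ip.scale_left ip.scale_right, simp add: power2_eq_square)
  then have "Re (ip N v v) = s\<^sup>2 * Re (ip N w w)" by simp
  then have "s\<^sup>2 * Re (ip N w w) = s\<^sup>2 * 1" using s(2) by simp
  then have "Re (ip N w w) = 1" using s(1) by (simp del: mult_1_right)
  then show ?thesis using that s v by blast
qed

lemma mv_norm_scale:
  assumes "\<And>v. Re (ip N v v) = 1 \<Longrightarrow> Re (ip N (mv N B v) (mv N B v)) \<le> y\<^sup>2"
  shows "Re (ip N (mv N B v) (mv N B v)) \<le> y\<^sup>2 * Re (ip N v v)"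
proof (cases "Re (ip N v v) = 0")
  case True
  then have "mv N B v = (\<lambda>i. 0)" using ip_eq_0_iff[of N v] unfolding mv_def by (intro ext sum.neutral) auto
  then show ?thesis using True by simp
next
  case False
  then obtain s w where w: "0 < s" "Re (ip N w w) = 1" "v = (\<lambda>i. of_real s * w i)" "s\<^sup>2 = Re (ip N v v)"
    by (rule normalize)
  have "Re (ip N (mv N B v) (mv N B v)) = s\<^sup>2 * Re (ip N (mv N B w) (mv N B w))"
    unfolding w(3) linopD[OF linop_mv] ip.scale_left ip.scale_right by (simp add: power2_eq_square)
  then show ?thesis using mult_left_mono[OF assms[OF w(2)], of "s\<^sup>2"] w(4) ip.pos[of N v] by (simp add: mult.commute)
qed

text \<open>\<open>power_word m\<close> is \<open>P\<close> times its adjoint, where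
  \<open>P\<close> is the \<open>m\<close>-th power of \<open>a\<close>, so its quadratic form is
  the squared norm of the adjoint of \<open>P\<close> applied to the vector. The trace bounds that
  form, and duality carries the resulting norm bound back to \<open>P\<close>.\<close>

lemma power_norm_le:
  assumes tr: "mtrace N (word_mat N (gletters a) (concat (replicate (2 ^ Suc j) (power_word m)))) \<le> (y\<^sup>2) ^ 2 ^ Suc j"
    and y: "0 \<le> y"
  shows "Re (ip N ((mv N a ^^ m) u) ((mv N a ^^ m) u)) \<le> y\<^sup>2 * Re (ip N u u)"
proof -
  define L where "L = gletters a"
  define P where "P = word_mat N L (replicate m True)"
  define P' where "P' = word_mat N L (replicate m False)"
  have adj: "adjoint_on N P P'"
    using adjoint_on_word_rev[of N L Not "replicate m True"] adjoint_gletters[of N a]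
    by (simp add: P_def P'_def L_def map_replicate)
  define Q where "Q = word_mat N L (power_word m)"
  have Q: "adjoint_on N Q Q"
    using adjoint_on_word_rev[of N L Not "power_word m"] adjoint_gletters[of N a]
    by (simp add: Q_def L_def power_word_def)
  have P'1: "Re (ip N (mv N P' v) (mv N P' v)) \<le> y\<^sup>2" if v: "Re (ip N v v) = 1" for v
  proof -
    have "ip N (mv N Q v) v = ip N (mv N P (mv N P' v)) v"
      by (rule ip_cong) (simp_all add: Q_def power_word_def P_def P'_def mv_word_append)
    then have e: "ip N (mv N Q v) v = ip N (mv N P' v) (mv N P' v)"
      by (simp add: ip_adjoint[OF adj])
    have "Re (ip N (mv N Q v) v) ^ 2 ^ Suc j \<le> mtrace N (mpow N Q (2 ^ Suc j))"
      by (rule quadratic_form_power_le[OF Q v])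
    also have "\<dots> = mtrace N (word_mat N L (concat (replicate (2 ^ Suc j) (power_word m))))"
      unfolding Q_def by (rule mtrace_cong) (simp only: word_mat_concat)
    also have "\<dots> \<le> (y\<^sup>2) ^ 2 ^ Suc j" using tr by (simp add: L_def)
    finally have "Re (ip N (mv N Q v) v) ^ 2 ^ Suc j \<le> (y\<^sup>2) ^ 2 ^ Suc j" .
    then have "Re (ip N (mv N Q v) v) \<le> y\<^sup>2"
      by (subst (asm) power_mono_iff) (simp_all add: e ip.pos)
    then show ?thesis by (simp add: e)
  qed
  have b: "cmod (ip N ((mv N a ^^ m) u) v) \<le> y" if "Re (ip N u u) \<le> 1" "Re (ip N v v) \<le> 1" for u v
  proof -
    have "ip N ((mv N a ^^ m) u) v = ip N (mv N P u) v"
    proof (rule ip_cong)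
      show "(mv N a ^^ m) u i = mv N P u i" if "i < N" for i
        using mv_replicate[OF that, of L m True u] by (simp add: P_def L_def gletters_def[abs_def])
    qed simp
    also have "\<dots> = ip N u (mv N P' v)" by (rule ip_adjoint[OF adj])
    finally have "cmod (ip N ((mv N a ^^ m) u) v) \<le> sqrt (Re (ip N u u)) * sqrt (Re (ip N (mv N P' v) (mv N P' v)))"
      using ip.norm_le by simp
    also have "\<dots> \<le> 1 * sqrt (y\<^sup>2 * Re (ip N v v))"
      using that mv_norm_scale[OF P'1, of v] ip.pos by (intro mult_mono real_sqrt_le_mono) auto
    also have "\<dots> \<le> 1 * sqrt (y\<^sup>2)"
      using mult_left_mono[OF that(2), of "y\<^sup>2"] by (intro mult_left_mono real_sqrt_le_mono) auto
    finally show ?thesis using y by simp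
  qed
  show ?thesis by (rule ip.bounded_op_self[OF linop_funpow[OF linop_mv] b y])
qed

lemma funpow_norm_le:
  assumes "\<And>u. Re (ip N (T u) (T u)) \<le> y\<^sup>2 * Re (ip N u u)"
  shows "Re (ip N ((T ^^ q) u) ((T ^^ q) u)) \<le> (y ^ q)\<^sup>2 * Re (ip N u u)"
proof (induction q)
  case (Suc q)
  have "Re (ip N ((T ^^ Suc q) u) ((T ^^ Suc q) u)) \<le> y\<^sup>2 * Re (ip N ((T ^^ q) u) ((T ^^ q) u))"
    using assms[of "(T ^^ q) u"] by simp
  also have "\<dots> \<le> y\<^sup>2 * ((y ^ q)\<^sup>2 * Re (ip N u u))" by (intro mult_left_mono Suc) simp
  finally show ?case by (simp add: power_mult_distrib mult.assoc)
qed simp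

text \<open>The powers are controlled in blocks of ten, ten being large enough for the asymptotic norm
  bound 11 of the tenth power to lie below \<open>(13 / 10) ^ 10\<close> with \<open>13 / 10 < sqrt 2\<close>.\<close>

lemma all_powers_le:
  assumes 1: "\<And>u. Re (ip N (mv N a u) (mv N a u)) \<le> 3\<^sup>2 * Re (ip N u u)"
    and 10: "\<And>u. Re (ip N ((mv N a ^^ 10) u) ((mv N a ^^ 10) u)) \<le> ((13 / 10) ^ 10)\<^sup>2 * Re (ip N u u)"
    and u: "Re (ip N u u) \<le> 1" and v: "Re (ip N v v) \<le> 1"
  shows "cmod (ip N ((mv N a ^^ k) u) v) \<le> 3 ^ 10 * (13 / 10) ^ k"
proof -
  define q s where "q = k div 10" and "s = k mod 10"
  have k: "k = 10 * q + s" "s < 10" by (simp_all add: q_def s_def)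
  define w where "w = (mv N a ^^ s) u"
  have "(mv N a ^^ k) u = ((mv N a ^^ 10) ^^ q) w"
    by (simp add: k funpow_add funpow_mult w_def)
  then have "Re (ip N ((mv N a ^^ k) u) ((mv N a ^^ k) u)) \<le> (((13 / 10) ^ 10) ^ q)\<^sup>2 * Re (ip N w w)"
    using funpow_norm_le[of N "mv N a ^^ 10", OF 10] by simp
  also have "\<dots> \<le> (((13 / 10) ^ 10) ^ q)\<^sup>2 * ((3 ^ s)\<^sup>2 * Re (ip N u u))"
    unfolding w_def by (intro mult_left_mono funpow_norm_le[of N "mv N a", OF 1]) simp
  also have "\<dots> \<le> (((13 / 10) ^ 10) ^ q)\<^sup>2 * ((3 ^ s)\<^sup>2 * 1)"
    by (intro mult_left_mono u) simp_all
  also have "\<dots> = (((13 / 10) ^ 10) ^ q * 3 ^ s)\<^sup>2" by (simp add: power_mult_distrib)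
  finally have "Re (ip N ((mv N a ^^ k) u) ((mv N a ^^ k) u)) \<le> (((13 / 10) ^ 10) ^ q * 3 ^ s)\<^sup>2" .
  from real_sqrt_le_mono[OF this]
  have "sqrt (Re (ip N ((mv N a ^^ k) u) ((mv N a ^^ k) u))) \<le> ((13 / 10) ^ 10) ^ q * 3 ^ s"
    unfolding real_sqrt_abs by (simp only: abs_mult power_abs abs_numeral abs_divide)
  \<comment> \<open>The incomplete block of fewer than ten factors costs at most
    \<open>3 ^ 10\<close>, the constant that reappears in the error of the spectral
    constant.\<close>
  also have "\<dots> \<le> (13 / 10) ^ k * 3 ^ 10"
  proof (rule mult_mono)
    show "((13 / 10) ^ 10) ^ q \<le> (13 / 10 :: real) ^ k"
      unfolding power_mult[symmetric] by (rule power_increasing) (simp_all add: k)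
    show "(3 :: real) ^ s \<le> 3 ^ 10" by (rule power_increasing) (use k in simp_all)
  qed simp_all
  finally have "sqrt (Re (ip N ((mv N a ^^ k) u) ((mv N a ^^ k) u))) \<le> 3 ^ 10 * (13 / 10) ^ k"
    by (simp add: mult.commute)
  moreover have "cmod (ip N ((mv N a ^^ k) u) v) \<le> sqrt (Re (ip N ((mv N a ^^ k) u) ((mv N a ^^ k) u))) * sqrt (Re (ip N v v))"
    by (rule ip.norm_le)
  moreover have "\<dots> \<le> sqrt (Re (ip N ((mv N a ^^ k) u) ((mv N a ^^ k) u))) * 1"
    using v ip.pos by (intro mult_left_mono) auto
  ultimately show ?thesis by simp
qed

lemma adjoint_rotated_part: "adjoint_on N (rotated_part c a) (rotated_part c a)"
  by (auto simp: adjoint_on_def rotated_part_def add.commute)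

lemma rotated_part_form: "ip N (mv N (rotated_part c a) v) v = of_real (Re (c * ip N (mv N a v) v))"
proof -
  have adj: "adjoint_on N a (\<lambda>i j. cnj (a j i))" by (simp add: adjoint_on_def)
  have "mv N (rotated_part c a) v = (\<lambda>i. (c / 2) * mv N a v i + (cnj c / 2) * mv N (\<lambda>i j. cnj (a j i)) v i)"
    unfolding mv_def rotated_part_def sum_distrib_left sum.distrib[symmetric]
    by (intro ext sum.cong refl) (simp add: field_simps)
  then have "ip N (mv N (rotated_part c a) v) v = c / 2 * ip N (mv N a v) v + cnj c / 2 * ip N (mv N (\<lambda>i j. cnj (a j i)) v) v"
    by (simp only: ip.add_left ip.scale_left)
  also have "ip N (mv N (\<lambda>i j. cnj (a j i)) v) v = cnj (ip N (mv N a v) v)"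
    using ip_adjoint[OF adj, of v v] ip.herm[of N "mv N (\<lambda>i j. cnj (a j i)) v" v] by simp
  also have "c / 2 * ip N (mv N a v) v + cnj c / 2 * cnj (ip N (mv N a v) v) = (c * ip N (mv N a v) v + cnj (c * ip N (mv N a v) v)) / 2"
    by (simp add: field_simps)
  also have "\<dots> = of_real (Re (c * ip N (mv N a v) v))"
    unfolding complex_add_cnj by simp
  finally show ?thesis .
qed

text \<open>Adding 2 makes a rotated part positive semidefinite once the numerical radius is at most
  2, so that a large even moment can only come from the upper edge.\<close>

definition shifted :: "(nat \<Rightarrow> nat \<Rightarrow> complex) \<Rightarrow> nat \<Rightarrow> nat \<Rightarrow> complex" where
  "shifted h i j = h i j + (if i = j then 2 else 0)"

lemma mv_shifted: "i < N \<Longrightarrow> mv N (shifted h) v i = mv N h v i + 2 * v i"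
proof -
  assume i: "i < N"
  have "mv N (shifted h) v i = (\<Sum>j<N. h i j * v j + (if j = i then 2 * v j else 0))"
    unfolding mv_def shifted_def by (intro sum.cong) (auto simp: algebra_simps)
  then show ?thesis using i by (simp add: sum.distrib mv_def)
qed

lemma shifted_form: "ip N (mv N (shifted h) v) v = ip N (mv N h v) v + 2 * ip N v v"
proof -
  have "ip N (mv N (shifted h) v) v = ip N (\<lambda>i. mv N h v i + 2 * v i) v"
    by (rule ip_cong) (simp_all add: mv_shifted)
  then show ?thesis by (simp only: ip.add_left ip.scale_left)
qed

lemma adjoint_shifted: "adjoint_on N h h \<Longrightarrow> adjoint_on N (shifted h) (shifted h)"
  unfolding adjoint_on_def
proof (intro allI impI)
  fix i j assume h: "\<forall>i<N. \<forall>j<N. h j i = cnj (h i j)" and "i < N" "j < N"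
  then have e: "h j i = cnj (h i j)" by blast
  show "shifted h j i = cnj (shifted h i j)" unfolding shifted_def e by simp
qed

text \<open>Traces are controlled only in the directions of the net \<open>D\<close>. From above
  they bound the numerical radius. From below they yield, in each direction, a point of the
  numerical range far out; by convexity a point of the inner disc that is missing could be separated
  by a line, which contradicts this.\<close>

theorem deterministic_criterion:
  fixes e :: real
  assumes A: "A \<in> carrier_mat N N" and a: "a = (\<lambda>i j. A $$ (i, j))" and N: "0 < N"
    and V0: "mtrace N (word_mat N (gletters a) (concat (replicate (2 ^ Suc j) (power_word 1)))) \<le> (3\<^sup>2) ^ 2 ^ Suc j"
    and V1: "mtrace N (word_mat N (gletters a) (concat (replicate (2 ^ Suc j) (power_word 10)))) \<le> (((13 / 10) ^ 10)\<^sup>2) ^ 2 ^ Suc j"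
    and V2: "\<And>c. c \<in> D \<Longrightarrow> mtrace N (mpow N (rotated_part c a) (2 ^ Suc j)) \<le> (sqrt 2 + e) ^ 2 ^ Suc j"
    and V3: "\<And>c. c \<in> D \<Longrightarrow> real N * (2 + sqrt 2 - e) ^ (2 * K) < mtrace N (mpow N (shifted (rotated_part c a)) (2 * K))"
    and D1: "\<And>c. c \<in> D \<Longrightarrow> cmod c = 1" and D: "\<And>u. cmod u = 1 \<Longrightarrow> \<exists>c\<in>D. cmod (u - c) \<le> e"
    and e: "0 < e" "e < 1" and rho: "\<rho> = (sqrt 2 + e) / (1 - e)" "\<rho> \<le> 2"
    and r: "r = sqrt 2 - e - e * \<rho>" and r': "13 / 10 < r'" "r' < r"
  shows "spectral_constant (numerical_range A) A \<le> ennreal (2 + 3 ^ 10 * (1 - r' / \<rho>) * (\<Sum>k. real k * ((13 / 10) / r') ^ k))"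
proof -
  have n1: "Re (ip N (mv N a u) (mv N a u)) \<le> 3\<^sup>2 * Re (ip N u u)" for u
    using power_norm_le[OF V0, of u] by simp
  have n10: "Re (ip N ((mv N a ^^ 10) u) ((mv N a ^^ 10) u)) \<le> ((13 / 10) ^ 10)\<^sup>2 * Re (ip N u u)" for u
    by (rule power_norm_le[OF V1]) simp
  have s2: "1 < sqrt 2" by simp
  have up: "Re (c * ip N (mv N a v) v) \<le> sqrt 2 + e" if "c \<in> D" "Re (ip N v v) = 1" for c v
  proof (rule ccontr)
    assume n: "\<not> ?thesis"
    have "Re (ip N (mv N (rotated_part c a) v) v) ^ 2 ^ Suc j \<le> (sqrt 2 + e) ^ 2 ^ Suc j"
      by (rule order.trans[OF quadratic_form_power_le[OF adjoint_rotated_part that(2)] V2[OF that(1)]])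
    moreover have "(sqrt 2 + e) ^ 2 ^ Suc j < Re (c * ip N (mv N a v) v) ^ 2 ^ Suc j"
      using n e by (intro power_strict_mono) auto
    ultimately show False by (simp add: rotated_part_form)
  qed
  \<comment> \<open>The direction of the value \<open>z\<close> is replaced by a net point at the
    price \<open>e * cmod z\<close>; solving for \<open>cmod z\<close> produces the denominator
    \<open>1 - e\<close> of \<open>\<rho>\<close>.\<close>
  have w1: "cmod (ip N (mv N a v) v) \<le> \<rho>" if v: "Re (ip N v v) = 1" for v
  proof -
    define z where "z = ip N (mv N a v) v"
    have "cmod z * (1 - e) \<le> sqrt 2 + e"
    proof (cases "z = 0")
      case True
      then show ?thesis using e s2 by simp
    next
      case False
      define u where "u = cnj z / of_real (cmod z)"
      have u: "cmod u = 1" using False by (simp add: u_def norm_divide)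
      have "u * z = of_real ((cmod z)\<^sup>2) / of_real (cmod z)"
        unfolding complex_norm_square u_def by simp
      then have uz: "Re (u * z) = cmod z" using False by (simp add: power2_eq_square)
      obtain c where c: "c \<in> D" "cmod (u - c) \<le> e" using D[OF u] by blast
      have "Re ((u - c) * z) \<le> cmod ((u - c) * z)" by (rule complex_Re_le_cmod)
      also have "\<dots> \<le> e * cmod z" unfolding norm_mult using c by (intro mult_right_mono) auto
      finally have "cmod z - Re (c * z) \<le> e * cmod z" using uz by (simp add: left_diff_distrib)
      moreover have "Re (c * z) \<le> sqrt 2 + e" using up[OF c(1) v] by (simp add: z_def)
      ultimately show ?thesis by (simp add: algebra_simps)
    qed
    then show ?thesis using e unfolding rho z_def[symmetric] by (simp add: pos_le_divide_eq)
  qed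
  have rho0: "0 < \<rho>" unfolding rho(1) using e s2 by (intro divide_pos_pos add_pos_pos) auto
  have w: "cmod (ip N (mv N a v) v) \<le> \<rho> * Re (ip N v v)" for v
  proof (cases "Re (ip N v v) = 0")
    case True
    have "ip N (mv N a v) v = ip N (mv N a v) (\<lambda>i. 0)"
      by (rule ip_cong) (use True in \<open>auto simp: ip_eq_0_iff\<close>)
    then show ?thesis using True by (simp add: ip_def)
  next
    case False
    then obtain s w where w: "0 < s" "Re (ip N w w) = 1" "v = (\<lambda>i. of_real s * w i)" "s\<^sup>2 = Re (ip N v v)"
      by (rule normalize)
    have "ip N (mv N a v) v = of_real (s\<^sup>2) * ip N (mv N a w) w"
      unfolding w(3) linopD[OF linop_mv] ip.scale_left ip.scale_right by (simp add: power2_eq_square)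
    then have "cmod (ip N (mv N a v) v) = s\<^sup>2 * cmod (ip N (mv N a w) w)"
      by (simp add: norm_mult norm_power)
    then show ?thesis using mult_left_mono[OF w1[OF w(2)], of "s\<^sup>2"] w(4) ip.pos[of N v] by (simp add: mult.commute)
  qed
  \<comment> \<open>Otherwise all values of the shifted part on unit vectors would lie between 0 and
    \<open>2 + sqrt 2 - e\<close>, and its trace of order \<open>2 * K\<close> would fall below
    \<open>V3\<close>.\<close>
  have low: "\<exists>v. Re (ip N v v) = 1 \<and> sqrt 2 - e < Re (c * ip N (mv N a v) v)" if c: "c \<in> D" "cmod c = 1" for c
  proof (rule ccontr)
    assume n: "\<not> ?thesis"
    define T where "T = shifted (rotated_part c a)"
    have form: "Re (ip N (mv N T v) v) = Re (c * ip N (mv N a v) v) + 2 * Re (ip N v v)" for v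
      unfolding T_def shifted_form rotated_part_form by simp
    have "mtrace N (mpow N T (2 * K)) \<le> real N * (2 + sqrt 2 - e) ^ (2 * K)"
    proof (rule mtrace_power_le)
      show "adjoint_on N T T" unfolding T_def by (intro adjoint_shifted adjoint_rotated_part)
      show "0 \<le> Re (ip N (mv N T v) v)" for v
      proof -
        have "\<bar>Re (c * ip N (mv N a v) v)\<bar> \<le> cmod (c * ip N (mv N a v) v)" by (rule abs_Re_le_cmod)
        also have "\<dots> \<le> \<rho> * Re (ip N v v)" using w[of v] c(2) by (simp add: norm_mult)
        also have "\<dots> \<le> 2 * Re (ip N v v)" using rho(2) ip.pos by (intro mult_right_mono)
        finally show ?thesis unfolding form by linarith
      qed
      show "Re (ip N (mv N T v) v) \<le> 2 + sqrt 2 - e" if "Re (ip N v v) = 1" for v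
        using n that unfolding form by force
      show "0 \<le> 2 + sqrt 2 - e" using e s2 by linarith
    qed
    with V3[OF c(1)] show False unfolding T_def by linarith
  qed
  \<comment> \<open>The normal of the separating line is approximated by a net point, which costs
    \<open>e * \<rho>\<close>; together with the loss \<open>e\<close> in \<open>low\<close> this is
    the radius \<open>r\<close>.\<close>
  have disc: "ball 0 r \<subseteq> nrange N a"
  proof (rule ccontr)
    assume "\<not> ?thesis"
    then obtain z where z: "z \<in> ball 0 r" "z \<notin> nrange N a" by blast
    have ne: "nrange N a \<noteq> {}"
    proof -
      define e0 :: "nat \<Rightarrow> complex" where "e0 = (\<lambda>i. of_bool (i = 0))"
      have "(\<Sum>i<N. (cmod (e0 i))\<^sup>2) = (\<Sum>i<N. if i = 0 then 1 else 0)"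
        by (intro sum.cong) (auto simp: e0_def)
      then have "Re (ip N e0 e0) = 1" using N by (simp add: ip_self)
      then show ?thesis by (auto simp: nrange_def)
    qed
    obtain p b where p: "p \<noteq> 0" "\<forall>x\<in>nrange N a. p \<bullet> x \<le> b" "\<forall>x\<in>{z}. b \<le> p \<bullet> x"
      using separating_hyperplane_sets[OF convex_nrange[of N a] convex_singleton[of z] ne] z by auto
    define u where "u = cnj p / of_real (cmod p)"
    have u: "cmod u = 1" using p by (simp add: u_def norm_divide)
    have inner: "Re (u * x) = (p \<bullet> x) / cmod p" for x
      by (simp add: u_def inner_complex_def add_divide_distrib)
    obtain c where c: "c \<in> D" "cmod (u - c) \<le> e" using D[OF u] by blast
    from low[OF c(1) D1[OF c(1)]]
    obtain v where v: "Re (ip N v v) = 1" "sqrt 2 - e < Re (c * ip N (mv N a v) v)" by blast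
    define x where "x = ip N (mv N a v) v"
    have xW: "x \<in> nrange N a" using v(1) by (auto simp: nrange_def x_def)
    have "Re ((c - u) * x) \<le> cmod ((c - u) * x)" by (rule complex_Re_le_cmod)
    also have "\<dots> \<le> e * \<rho>"
      unfolding norm_mult using c w1[OF v(1)] e by (intro mult_mono) (auto simp: x_def norm_minus_commute)
    finally have "Re (c * x) - e * \<rho> \<le> Re (u * x)" by (simp add: left_diff_distrib)
    then have "r < Re (u * x)" using v(2) unfolding r x_def by linarith
    also have "Re (u * x) \<le> Re (u * z)"
      unfolding inner using p xW by (intro divide_right_mono) force+
    also have "\<dots> \<le> cmod (u * z)" by (rule complex_Re_le_cmod)
    also have "\<dots> = cmod z" using u by (simp add: norm_mult)
    finally show False using z by simp
  qed
  have "r' \<le> \<rho>"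
  proof -
    have "0 \<le> e * \<rho>" using e rho0 by simp
    then have "r \<le> sqrt 2 + e" using e unfolding r by linarith
    moreover have "sqrt 2 + e \<le> \<rho>"
    proof -
      have "0 \<le> e * (sqrt 2 + e)" using e s2 by (intro mult_nonneg_nonneg add_nonneg_nonneg) auto
      then have "(sqrt 2 + e) * (1 - e) \<le> sqrt 2 + e" by (simp only: right_diff_distrib mult_1_right) (simp add: mult.commute)
      then show ?thesis unfolding rho(1) using e by (simp add: pos_le_divide_eq)
    qed
    ultimately show ?thesis using r' by linarith
  qed
  then show ?thesis
    using spectral_constant_le[OF A a all_powers_le[OF n1 n10] w disc _ r'] by simp
qed

section \<open>Almost sure asymptotics\<close>

text \<open>Supplies the moment order \<open>k = 2 ^ Suc (j N)\<close>. The bound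
  \<open>k ^ 4 \<le> N\<close> keeps the crossing terms small, while \<open>N < 16 * k ^ 4\<close>
  lets a geometric factor \<open>x ^ k\<close> with \<open>x < 1\<close> beat every power of
  \<open>N\<close>.\<close>

lemma ex_dyadic_exponent: "\<exists>j. \<forall>N\<ge>16 :: nat. (2 ^ Suc (j N)) ^ 4 \<le> N \<and> N < 16 * (2 ^ Suc (j N)) ^ (4 :: nat)"
proof -
  have "\<exists>j. (2 ^ Suc j) ^ 4 \<le> N \<and> N < 16 * (2 ^ Suc j) ^ 4" if N: "16 \<le> N" for N :: nat
  proof -
    obtain n where n: "16 ^ n \<le> N" "N < 16 ^ (n + 1)" using ex_power_ivl1[of 16 N] N by auto
    have "n \<noteq> 0" using n N by (intro notI) simp
    then obtain j where j: "n = Suc j" by (cases n) auto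
    have "(2 ^ n) ^ 4 = (16 :: nat) ^ n" by (simp flip: power_mult add: mult.commute[of n]) (simp add: power_mult)
    then show ?thesis using n unfolding j by (intro exI[of _ j]) simp
  qed
  then show ?thesis by metis
qed

lemma power_times_geometric_bounded:
  assumes "0 < x" "x < (1::real)"
  shows "\<exists>D. \<forall>n. real n ^ p * x ^ n \<le> D"
proof -
  have "(\<lambda>n. real n ^ p * x ^ n) \<longlonglongrightarrow> 0" using assms by real_asymp
  then have "Bseq (\<lambda>n. real n ^ p * x ^ n)" by (intro convergent_imp_Bseq convergentI)
  then obtain D where "\<forall>n. norm (real n ^ p * x ^ n) \<le> D" by (auto simp: Bseq_def)
  then show ?thesis by (intro exI[of _ D]) (auto dest: abs_le_D1)
qed

text \<open>Under the growth condition on \<open>k\<close>, a bound on \<open>N ^ 3 * x ^ k\<close>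
  reduces to one on \<open>k ^ 12 * x ^ k\<close>. The target \<open>1 / N^2\<close> is
  summable.\<close>

lemma geometric_tail_le:
  assumes "0 < x" "x < (1::real)"
  shows "\<exists>D. \<forall>N k. 1 \<le> N \<longrightarrow> real N \<le> 16 * real k ^ 4 \<longrightarrow> real N * x ^ k \<le> D / real N ^ 2"
proof -
  obtain D where D: "real n ^ 12 * x ^ n \<le> D" for n using power_times_geometric_bounded[OF assms] by blast
  have "real N * x ^ k \<le> 16 ^ 3 * D / real N ^ 2" if N: "1 \<le> N" "real N \<le> 16 * real k ^ 4" for N k
  proof -
    have "real N ^ 3 \<le> (16 * real k ^ 4) ^ 3" using N by (intro power_mono) auto
    also have "\<dots> = 16 ^ 3 * real k ^ 12" by (simp add: power_mult_distrib flip: power_mult)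
    finally have "real N ^ 3 * x ^ k \<le> 16 ^ 3 * real k ^ 12 * x ^ k" using assms by (intro mult_right_mono) auto
    also have "\<dots> \<le> 16 ^ 3 * D" using D[of k] by simp
    finally have "real N ^ 3 * x ^ k \<le> 16 ^ 3 * D" .
    moreover have "real N ^ 3 = real N * real N ^ 2" by (simp add: power_def numeral_eq_Suc)
    ultimately show ?thesis using N by (simp add: field_simps)
  qed
  then show ?thesis by blast
qed

lemma (in prob_space) AE_eventually_of_tail:
  assumes meas: "\<And>N. N0 \<le> N \<Longrightarrow> B N \<in> sets M" and le: "\<And>N. N0 \<le> N \<Longrightarrow> prob (B N) \<le> D / real N ^ 2"
  shows "AE \<omega> in M. \<forall>\<^sub>F N in sequentially. \<omega> \<notin> B N"
proof -
  define A where "A N = (if N0 \<le> N then B N else {})" for N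
  have "AE \<omega> in M. eventually (\<lambda>N. \<omega> \<in> space M - A N) sequentially"
  proof (rule borel_cantelli_AE1)
    show "A N \<in> sets M" for N using meas by (auto simp: A_def)
    show "emeasure M (A N) < \<infinity>" for N by (simp add: emeasure_eq_measure)
    show "summable (\<lambda>N. prob (A N))"
    proof (rule summable_comparison_test'[where N=N0])
      show "summable (\<lambda>N. D * inverse (real N ^ 2))"
        by (intro summable_mult inverse_power_summable) simp
      show "norm (prob (A N)) \<le> D * inverse (real N ^ 2)" if "N0 \<le> N" for N
        using le[OF that] that by (simp add: A_def divide_inverse)
    qed
  qed
  then show ?thesis
  proof (rule AE_mp, intro AE_I2 impI)
    fix \<omega> assume "eventually (\<lambda>N. \<omega> \<in> space M - A N) sequentially"
    then show "\<forall>\<^sub>F N in sequentially. \<omega> \<notin> B N"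
      using eventually_ge_at_top[of N0] by eventually_elim (auto simp: A_def)
  qed
qed

lemma mtrace_ntrace: "0 < N \<Longrightarrow> mtrace N B = real N * Re (ntrace N B)"
  by (simp add: mtrace_def ntrace_def)

lemma mtrace_mpow_nonneg:
  assumes "adjoint_on N A A"
  shows "0 \<le> mtrace N (mpow N A (2 * K))"
proof -
  have "mtrace N (mpow N A (2 * K)) = mtrace N (mpow N (mpow N A K) 2)"
    by (intro mtrace_cong) (simp add: mpow_mpow mult.commute)
  then show ?thesis using frobenius[OF adjoint_on_mpow[OF assms]] by (simp add: sum_nonneg)
qed

context gaussian_letters begin

lemma integrable_mtrace: "integrable M (\<lambda>\<omega>. mtrace N (word_mat N (L \<omega>) w))"
  and expectation_mtrace: "expectation (\<lambda>\<omega>. mtrace N (word_mat N (L \<omega>) w)) =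
    real N * Re (\<integral>\<omega>. word_traces N (L \<omega>) [w] \<partial>M)"
proof -
  have e: "(\<lambda>\<omega>. mtrace N (word_mat N (L \<omega>) w)) = (\<lambda>\<omega>. real N * Re (word_traces N (L \<omega>) [w]))"
    using N_pos by (simp add: mtrace_ntrace word_traces_def fun_eq_iff)
  show "integrable M (\<lambda>\<omega>. mtrace N (word_mat N (L \<omega>) w))"
    unfolding e by (intro integrable_mult_right integrable_Re integrable_traces)
  show "expectation (\<lambda>\<omega>. mtrace N (word_mat N (L \<omega>) w)) = real N * Re (\<integral>\<omega>. word_traces N (L \<omega>) [w] \<partial>M)"
    unfolding e by (simp add: integral_Re[OF integrable_traces])
qed

text \<open>Markov's inequality; the factor \<open>N\<close> appears because the trace is not
  normalised.\<close>

lemma mtrace_tail: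
  assumes nn: "\<And>\<omega>. 0 \<le> mtrace N (word_mat N (L \<omega>) w)"
    and le: "Re (\<integral>\<omega>. word_traces N (L \<omega>) [w] \<partial>M) \<le> 2 * x ^ k" and y: "0 < y"
  shows "{\<omega> \<in> space M. y ^ k \<le> mtrace N (word_mat N (L \<omega>) w)} \<in> sets M"
    and "prob {\<omega> \<in> space M. y ^ k \<le> mtrace N (word_mat N (L \<omega>) w)} \<le> 2 * (real N * (x / y) ^ k)"
proof -
  note [measurable] = borel_measurable_integrable[OF integrable_mtrace]
  show "{\<omega> \<in> space M. y ^ k \<le> mtrace N (word_mat N (L \<omega>) w)} \<in> sets M" by measurable
  have "prob {\<omega> \<in> space M. y ^ k \<le> mtrace N (word_mat N (L \<omega>) w)} \<le> expectation (\<lambda>\<omega>. mtrace N (word_mat N (L \<omega>) w)) / y ^ k"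
    by (rule integral_Markov_inequality_measure[OF integrable_mtrace, where A="{}"]) (use y nn in auto)
  also have "\<dots> \<le> (real N * (2 * x ^ k)) / y ^ k"
    unfolding expectation_mtrace using le y by (intro divide_right_mono mult_left_mono) auto
  finally show "prob {\<omega> \<in> space M. y ^ k \<le> mtrace N (word_mat N (L \<omega>) w)} \<le> 2 * (real N * (x / y) ^ k)"
    by (simp add: power_divide mult_ac)
qed

end

text \<open>Pascal's rule, arranged as the induction step for expanding a power of
  \<open>h + 2\<close>.\<close>

lemma binomial_shift_sum:
  fixes f :: "nat \<Rightarrow> complex"
  shows "(\<Sum>k\<le>Suc n. of_nat (Suc n choose k) * 2 ^ (Suc n - k) * f k) =
    (\<Sum>k\<le>n. of_nat (n choose k) * 2 ^ (n - k) * f (Suc k)) + 2 * (\<Sum>k\<le>n. of_nat (n choose k) * 2 ^ (n - k) * f k)"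
proof -
  have b: "(\<Sum>k\<le>n. of_nat (Suc n choose Suc k) * 2 ^ (n - k) * f (Suc k)) =
    (\<Sum>k\<le>n. of_nat (n choose k) * 2 ^ (n - k) * f (Suc k)) + (\<Sum>k\<le>n. of_nat (n choose Suc k) * 2 ^ (n - k) * f (Suc k))"
    unfolding sum.distrib[symmetric] by (intro sum.cong refl) (simp add: distrib_right)
  have "2 * (\<Sum>k\<le>n. of_nat (n choose k) * 2 ^ (n - k) * f k) = (\<Sum>k\<le>Suc n. of_nat (n choose k) * 2 ^ (Suc n - k) * f k)"
    unfolding sum_distrib_left by (simp add: Suc_diff_le mult_ac binomial_eq_0)
  also have "\<dots> = 2 ^ Suc n * f 0 + (\<Sum>k\<le>n. of_nat (n choose Suc k) * 2 ^ (n - k) * f (Suc k))"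
    by (subst sum.atMost_Suc_shift) simp
  finally have "(\<Sum>k\<le>n. of_nat (n choose k) * 2 ^ (n - k) * f (Suc k)) + 2 * (\<Sum>k\<le>n. of_nat (n choose k) * 2 ^ (n - k) * f k) =
    2 ^ Suc n * f 0 + (\<Sum>k\<le>n. of_nat (Suc n choose Suc k) * 2 ^ (n - k) * f (Suc k))"
    unfolding b by (simp only: ac_simps)
  also have "\<dots> = (\<Sum>k\<le>Suc n. of_nat (Suc n choose k) * 2 ^ (Suc n - k) * f k)"
    by (subst sum.atMost_Suc_shift) simp
  finally show ?thesis ..
qed

lemma mpow_shifted:
  "i < N \<Longrightarrow> mpow N (shifted h) n i j = (\<Sum>k\<le>n. of_nat (n choose k) * 2 ^ (n - k) * mpow N h k i j)"
proof (induction n arbitrary: i)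
  case 0
  then show ?case by (simp add: mpow_def)
next
  case (Suc n)
  have Suc_mpow: "mpow N B (Suc m) i j = (\<Sum>l<N. B i l * mpow N B m l j)" for B m
    by (simp only: mpow_def replicate_Suc word_mat.simps)
  have "mpow N (shifted h) (Suc n) i j = (\<Sum>l<N. h i l * mpow N (shifted h) n l j + (if l = i then 2 * mpow N (shifted h) n l j else 0))"
    unfolding Suc_mpow by (intro sum.cong refl) (auto simp: shifted_def algebra_simps)
  also have "\<dots> = (\<Sum>l<N. h i l * mpow N (shifted h) n l j) + 2 * mpow N (shifted h) n i j"
    using Suc.prems by (simp add: sum.distrib)
  also have "(\<Sum>l<N. h i l * mpow N (shifted h) n l j) = (\<Sum>l<N. \<Sum>k\<le>n. of_nat (n choose k) * 2 ^ (n - k) * (h i l * mpow N h k l j))"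
    by (intro sum.cong refl) (simp add: Suc.IH sum_distrib_left mult_ac)
  also have "\<dots> = (\<Sum>k\<le>n. of_nat (n choose k) * 2 ^ (n - k) * mpow N h (Suc k) i j)"
    unfolding Suc_mpow sum_distrib_left by (rule sum.swap)
  finally show ?case unfolding binomial_shift_sum Suc.IH[OF Suc.prems] .
qed

lemma mtrace_shifted:
  assumes "0 < N"
  shows "mtrace N (mpow N (shifted h) n) = real N * (\<Sum>k\<le>n. real (n choose k) * 2 ^ (n - k) * Re (ntrace N (mpow N h k)))"
proof -
  have "(\<Sum>i<N. mpow N (shifted h) n i i) = (\<Sum>k\<le>n. of_nat (n choose k) * 2 ^ (n - k) * (\<Sum>i<N. mpow N h k i i))"
    unfolding sum_distrib_left by (subst sum.swap) (simp add: mpow_shifted)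
  also have "\<dots> = (\<Sum>k\<le>n. of_nat (n choose k) * 2 ^ (n - k) * (of_nat N * ntrace N (mpow N h k)))"
    using assms by (simp add: ntrace_def)
  also have "\<dots> = (\<Sum>k\<le>n. of_real (real N * (real (n choose k) * 2 ^ (n - k))) * ntrace N (mpow N h k))"
    by (intro sum.cong refl) (simp add: mult_ac)
  finally show ?thesis unfolding mtrace_def by (simp add: sum_distrib_left mult.assoc)
qed

section \<open>The Ginibre ensemble as Gaussian letters, and upper trace bounds\<close>

locale ginibre_space = std_gaussians M Z for M :: "'a measure" and Z :: "nat \<times> nat + nat \<times> nat \<Rightarrow> 'a \<Rightarrow> real"
begin

definition gin :: "nat \<Rightarrow> 'a \<Rightarrow> nat \<Rightarrow> nat \<Rightarrow> complex" where
  "gin N \<omega> i j = (of_real (Z (Inl (i, j)) \<omega>) + \<i> * of_real (Z (Inr (i, j)) \<omega>)) / of_real (sqrt (2 * real N))"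

definition lfG :: "nat \<Rightarrow> bool \<Rightarrow> nat \<Rightarrow> nat \<Rightarrow> (complex \<times> (nat \<times> nat + nat \<times> nat)) list" where
  "lfG N x i j = (let s = of_real (sqrt (2 * real N)) in
     if x then [(1 / s, Inl (i, j)), (\<i> / s, Inr (i, j))] else [(1 / s, Inl (j, i)), (- \<i> / s, Inr (j, i))])"

definition lfH :: "nat \<Rightarrow> complex \<Rightarrow> nat \<Rightarrow> nat \<Rightarrow> (complex \<times> (nat \<times> nat + nat \<times> nat)) list" where
  "lfH N c i j = (let s = 2 * of_real (sqrt (2 * real N)) in
     [(c / s, Inl (i, j)), (\<i> * c / s, Inr (i, j)), (cnj c / s, Inl (j, i)), (- \<i> * cnj c / s, Inr (j, i))])"

lemma lin_lfG: "lin (lfG N x i j) \<omega> = gletters (gin N \<omega>) x i j"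
  by (simp add: lfG_def gletters_def gin_def Let_def add_divide_distrib diff_divide_distrib)

lemma lin_lfH: "lin (lfH N c i j) \<omega> = rotated_part c (gin N \<omega>) i j"
proof -
  define s x y x' y' where "s = complex_of_real (sqrt (2 * real N))" and "x = complex_of_real (Z (Inl (i, j)) \<omega>)"
    and "y = complex_of_real (Z (Inr (i, j)) \<omega>)" and "x' = complex_of_real (Z (Inl (j, i)) \<omega>)"
    and "y' = complex_of_real (Z (Inr (j, i)) \<omega>)"
  have "lin (lfH N c i j) \<omega> = c / (2 * s) * x + (\<i> * c / (2 * s) * y + (cnj c / (2 * s) * x' + (- \<i> * cnj c / (2 * s)) * y'))"
    by (simp add: lin_def lfH_def Let_def s_def x_def y_def x'_def y'_def)
  also have "\<dots> = (c * ((x + \<i> * y) / s) + cnj c * ((x' - \<i> * y') / s)) / 2"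
  proof -
    define t where "t = 1 / s"
    have t: "a / (2 * s) = a * t / 2" "a / s = a * t" for a by (simp_all add: t_def)
    show ?thesis unfolding t by (simp add: algebra_simps add_divide_distrib diff_divide_distrib)
  qed
  also have "\<dots> = rotated_part c (gin N \<omega>) i j"
    by (simp add: rotated_part_def gin_def s_def x_def y_def x'_def y'_def)
  finally show ?thesis .
qed

lemma sqrt_sq: "complex_of_real (sqrt (2 * real N)) * complex_of_real (sqrt (2 * real N)) = 2 * of_nat N"
proof -
  have "sqrt (2 * real N) * sqrt (2 * real N) = 2 * real N" by simp
  then have "complex_of_real (sqrt (2 * real N) * sqrt (2 * real N)) = of_real (2 * real N)" by (rule arg_cong)
  then show ?thesis by (simp only: of_real_mult of_real_of_nat_eq of_real_numeral)
qed

text \<open>Between two entries of \<open>G\<close> the real and the imaginary contributions cancel;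
  between \<open>G\<close> and its adjoint they add up to \<open>1 / N\<close>. So only unlike
  letters are correlated, as the count for words with few runs requires.\<close>

lemma gaussian_letters_G: "0 < N \<Longrightarrow> gaussian_letters M Z N (\<lambda>x y. of_bool (x \<noteq> y)) (lfG N)"
proof
  fix x y i j k l
  define s where "s = complex_of_real (sqrt (2 * real N))"
  have s: "s * s = 2 * of_nat N" unfolding s_def by (rule sqrt_sq)
  assume "0 < N"
  then have s0: "s \<noteq> 0" using s by auto
  show "lcov (lfG N x i j) (lfG N y k l) = of_real (of_bool (x \<noteq> y)) / of_nat N * of_bool (j = k \<and> i = l)"
  proof -
    have "1 / (s * s) + 1 / (s * s) = 1 / of_nat N" unfolding s using \<open>0 < N\<close> by (simp add: field_simps)
    then show ?thesis
      by (cases x; cases y) (auto simp: lfG_def lcov_def Let_def s_def[symmetric])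
  qed
qed auto

text \<open>The contributions with \<open>c * c\<close> and with its conjugate cancel, and the mixed
  ones carry \<open>c * cnj c = 1\<close>, so the covariance does not depend on the
  direction.\<close>

lemma gaussian_letters_H: "0 < N \<Longrightarrow> cmod c = 1 \<Longrightarrow> gaussian_letters M Z N (\<lambda>_ _ :: unit. 1 / 2) (\<lambda>_. lfH N c)"
proof
  fix x y :: unit and i j k l :: nat
  define s where "s = complex_of_real (sqrt (2 * real N))"
  have s: "s * s = 2 * of_nat N" unfolding s_def by (rule sqrt_sq)
  assume N: "0 < N" and c: "cmod c = 1"
  have cc: "c * cnj c = 1" using c by (simp add: complex_norm_square[symmetric])
  define t where "t = 1 / (2 * s * (2 * s))"
  have t: "4 * t = 1 / 2 / of_nat N"
  proof -
    have "t = 1 / (4 * (s * s))" by (simp add: t_def)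
    then show ?thesis unfolding s using N by (simp add: field_simps)
  qed
  have p: "a / (2 * s) * (b / (2 * s)) = a * b * t" for a b by (simp add: t_def)
  have e: "lcov (lfH N c i j) (lfH N c k l) =
     (c * c + (\<i> * c) * (\<i> * c)) * t * of_bool (k = i \<and> l = j) +
     (c * cnj c + (\<i> * c) * (- \<i> * cnj c)) * t * of_bool (l = i \<and> k = j) +
     (cnj c * c + (- \<i> * cnj c) * (\<i> * c)) * t * of_bool (k = j \<and> l = i) +
     (cnj c * cnj c + (- \<i> * cnj c) * (- \<i> * cnj c)) * t * of_bool (l = j \<and> k = i)"
    unfolding lfH_def lcov_def Let_def s_def[symmetric] by (simp only: list.map sum_list.Cons sum_list.Nil case_prod_conv p)
      (simp add: algebra_simps)
  have "lcov (lfH N c i j) (lfH N c k l) = 4 * t * (c * cnj c) * of_bool (j = k \<and> i = l)"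
  proof -
    have z: "c * c + (\<i> * c) * (\<i> * c) = 0" "cnj c * cnj c + (- \<i> * cnj c) * (- \<i> * cnj c) = 0"
      "c * cnj c + (\<i> * c) * (- \<i> * cnj c) = 2 * (c * cnj c)" "cnj c * c + (- \<i> * cnj c) * (\<i> * c) = 2 * (c * cnj c)"
      by (simp_all add: algebra_simps)
    have b: "(l = i \<and> k = j) = (j = k \<and> i = l)" "(k = j \<and> l = i) = (j = k \<and> i = l)" by auto
    show ?thesis unfolding e z b by (simp only: mult_zero_left add_0_left add_0_right) (simp add: algebra_simps)
  qed
  then show "lcov (lfH N c i j) (lfH N c k l) = of_real (1 / 2) / of_nat N * of_bool (j = k \<and> i = l)"
    unfolding cc t by simp
qed auto

end

text \<open>Common core of the upper bounds: a moment bound \<open>2 * x ^ k\<close> obtained from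
  the recursion alone, Markov's inequality at a level \<open>y > x\<close>, and
  Borel-Cantelli.\<close>

lemma (in std_gaussians) AE_eventually_trace_less:
  assumes gl: "\<And>N. start \<le> N \<Longrightarrow> gaussian_letters M Z N c (Lf N)"
    and A: "\<And>N \<omega> x i j. lin (Lf N x i j) \<omega> = A N \<omega> x i j"
    and nn: "\<And>N \<omega>. 0 \<le> mtrace N (word_mat N (A N \<omega>) (w N))"
    and k: "\<And>N. start \<le> N \<Longrightarrow> real N \<le> 16 * real (k N) ^ 4"
    and le: "\<And>N \<alpha>. start \<le> N \<Longrightarrow> schwinger_dyson c (1 / real N ^ 2) \<alpha> \<Longrightarrow> \<alpha> [w N] \<le> 2 * x ^ k N"
    and xy: "0 < x" "x < y"
  shows "AE \<omega> in M. \<forall>\<^sub>F N in sequentially. mtrace N (word_mat N (A N \<omega>) (w N)) < y ^ k N"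
proof -
  obtain D where D: "\<forall>N k. 1 \<le> N \<longrightarrow> real N \<le> 16 * real k ^ 4 \<longrightarrow> real N * (x / y) ^ k \<le> D / real N ^ 2"
    using geometric_tail_le[of "x / y"] xy by auto
  define B where "B N = {\<omega> \<in> space M. y ^ k N \<le> mtrace N (word_mat N (A N \<omega>) (w N))}" for N
  have B: "B N \<in> sets M" "prob (B N) \<le> (2 * D) / real N ^ 2" if N: "start \<le> N" for N
  proof -
    interpret g: gaussian_letters M Z N c "Lf N" by (rule gl[OF N])
    have L: "g.L \<omega> = A N \<omega>" for \<omega> by (intro ext) (simp add: g.L_def A)
    have nn': "0 \<le> mtrace N (word_mat N (g.L \<omega>) (w N))" for \<omega> unfolding L by (rule nn)
    have y: "0 < y" using xy by linarith
    note t = g.mtrace_tail[OF nn' le[OF N g.schwinger_dyson_expectation] y]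
    show "B N \<in> sets M" using t(1) unfolding L B_def .
    have "prob (B N) \<le> 2 * (real N * (x / y) ^ k N)" using t(2) unfolding L B_def .
    also have "real N * (x / y) ^ k N \<le> D / real N ^ 2" using D k[OF N] g.N_pos by auto
    finally show "prob (B N) \<le> (2 * D) / real N ^ 2" by simp
  qed
  have "AE \<omega> in M. \<forall>\<^sub>F N in sequentially. \<omega> \<notin> B N" by (rule AE_eventually_of_tail[OF B])
  then show ?thesis
    by (rule AE_mp) (intro AE_I2 impI, erule eventually_mono, simp add: B_def not_le)
qed

context ginibre_space begin

lemma AE_power_word_trace:
  assumes j: "\<forall>N\<ge>16. (2 ^ Suc (j N)) ^ 4 \<le> N \<and> N < 16 * (2 ^ Suc (j N)) ^ 4" and y: "(real m + 1)\<^sup>2 < y"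
  shows "AE \<omega> in M. \<forall>\<^sub>F N in sequentially.
    mtrace N (word_mat N (gletters (gin N \<omega>)) (concat (replicate (2 ^ Suc (j N)) (power_word m)))) < y ^ 2 ^ Suc (j N)"
proof (rule AE_eventually_trace_less[where start="16 + 32 * m ^ 4 * (m + 1) ^ 4" and x="(real m + 1)\<^sup>2" and Lf=lfG and c="\<lambda>x y. of_bool (x \<noteq> y)"])
  fix N assume N: "16 + 32 * m ^ 4 * (m + 1) ^ 4 \<le> N"
  show "gaussian_letters M Z N (\<lambda>x y. of_bool (x \<noteq> y)) (lfG N)" by (rule gaussian_letters_G) (use N in simp)
  define k :: nat where "k = 2 ^ Suc (j N)"
  have k: "k ^ 4 \<le> N" "N < 16 * k ^ 4" using j N by (auto simp: k_def)
  have "real N \<le> real (16 * k ^ 4)" using k(2) by (intro of_nat_mono) simp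
  then show "real N \<le> 16 * real (2 ^ Suc (j N)) ^ 4" by (simp add: k_def)
  fix \<alpha> :: "bool list list \<Rightarrow> real" assume "schwinger_dyson (\<lambda>x y. of_bool (x \<noteq> y)) (1 / real N ^ 2) \<alpha>"
  then interpret s: schwinger_dyson "\<lambda>x y :: bool. of_bool (x \<noteq> y)" "1 / real N ^ 2" \<alpha> .
  \<comment> \<open>This explains the starting index: for the word length \<open>2 * m * k\<close>
    the smallness condition of \<open>alpha_blocks_le\<close> reads
    \<open>32 * m ^ 4 * (m + 1) ^ 4 * k ^ 4 \<le> N^2\<close>, and either group of factors is at
    most \<open>N\<close>.\<close>
  have "32 * m ^ 4 * (m + 1) ^ 4 * k ^ 4 \<le> N * N" using N k(1) by (intro mult_mono) auto
  then have "real (32 * m ^ 4 * (m + 1) ^ 4 * k ^ 4) \<le> real (N * N)" by (rule of_nat_mono)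
  then have b: "real (2 * m * k) ^ 4 * (real m + 1) ^ 4 \<le> (real N)\<^sup>2 / 2"
    by (simp add: power_mult_distrib power2_eq_square mult_ac add.commute)
  have "1 / (real N)\<^sup>2 * (real (2 * m * k) ^ 4 * (real m + 1) ^ 4) \<le> 1 / (real N)\<^sup>2 * ((real N)\<^sup>2 / 2)"
    by (rule mult_left_mono[OF b]) simp
  also have "\<dots> \<le> 1 / 2" using N by simp
  finally have q: "1 / (real N)\<^sup>2 * (real (2 * m * k) ^ 4 * (real m + 1) ^ 4) \<le> 1 / 2" .
  have "\<alpha> [concat (replicate k (power_word m))] \<le> 2 * (real m + 1) ^ (2 * k)"
  proof (rule s.alpha_blocks_le[OF _ _ q])
    show "blocks m (2 * k) (concat (replicate k (power_word m)))"
      unfolding power_word_def by (rule blocks_replicate_cycle)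
    show "length (concat (replicate k (power_word m))) \<le> 2 * m * k"
      by (simp add: power_word_def length_concat sum_list_replicate)
  qed simp_all
  then show "\<alpha> [concat (replicate (2 ^ Suc (j N)) (power_word m))] \<le> 2 * ((real m + 1)\<^sup>2) ^ 2 ^ Suc (j N)"
    unfolding k_def[symmetric] by (simp only: power_mult)
next
  fix N \<omega>
  define Q where "Q = word_mat N (gletters (gin N \<omega>)) (power_word m)"
  have Q: "adjoint_on N Q Q"
    using adjoint_on_word_rev[of N "gletters (gin N \<omega>)" Not "power_word m"] adjoint_gletters[of N "gin N \<omega>"]
    by (simp add: Q_def power_word_def)
  have "mtrace N (word_mat N (gletters (gin N \<omega>)) (concat (replicate (2 ^ Suc (j N)) (power_word m)))) = mtrace N (mpow N Q (2 * 2 ^ j N))"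
    unfolding Q_def by (rule mtrace_cong) (simp only: word_mat_concat power_Suc)
  then show "0 \<le> mtrace N (word_mat N (gletters (gin N \<omega>)) (concat (replicate (2 ^ Suc (j N)) (power_word m))))"
    using mtrace_mpow_nonneg[OF Q] by simp
next
  show "lin (lfG N x i j) \<omega> = gletters (gin N \<omega>) x i j" for N \<omega> x i j by (rule lin_lfG)
  show "0 < (real m + 1)\<^sup>2" by (intro zero_less_power) linarith
qed (rule y)

lemma AE_rotated_part_trace:
  assumes j: "\<forall>N\<ge>16. (2 ^ Suc (j N)) ^ 4 \<le> N \<and> N < 16 * (2 ^ Suc (j N)) ^ 4" and e: "0 < e" and c: "cmod c = 1"
  shows "AE \<omega> in M. \<forall>\<^sub>F N in sequentially.
    mtrace N (mpow N (rotated_part c (gin N \<omega>)) (2 ^ Suc (j N))) < (sqrt 2 + e) ^ 2 ^ Suc (j N)"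
  unfolding mpow_def
proof (rule AE_eventually_trace_less[where start=16 and x="sqrt 2" and Lf="\<lambda>N _. lfH N c" and c="\<lambda>_ _. 1 / 2"])
  fix N :: nat assume N: "16 \<le> N"
  show "gaussian_letters M Z N (\<lambda>_ _ :: unit. 1 / 2) (\<lambda>_. lfH N c)" by (rule gaussian_letters_H[OF _ c]) (use N in simp)
  define k :: nat where "k = 2 ^ Suc (j N)"
  have k: "k ^ 4 \<le> N" "N < 16 * k ^ 4" using j N by (auto simp: k_def)
  have "real N \<le> real (16 * k ^ 4)" using k(2) by (intro of_nat_mono) simp
  then show "real N \<le> 16 * real (2 ^ Suc (j N)) ^ 4" by (simp add: k_def)
  fix \<alpha> assume "schwinger_dyson (\<lambda>_ _ :: unit. 1 / 2) (1 / real N ^ 2) \<alpha>"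
  then interpret s: schwinger_dyson "\<lambda>_ _ :: unit. 1 / 2" "1 / real N ^ 2" \<alpha> .
  have "2 * k ^ 4 \<le> N * N" using N k(1) by (intro mult_mono) auto
  then have "real (2 * k ^ 4) \<le> real (N * N)" by (rule of_nat_mono)
  then have b: "real k ^ 4 \<le> (real N)\<^sup>2 / 2" by (simp add: power2_eq_square)
  have "1 / (real N)\<^sup>2 * real k ^ 4 \<le> 1 / (real N)\<^sup>2 * ((real N)\<^sup>2 / 2)"
    by (rule mult_left_mono[OF b]) simp
  also have "\<dots> \<le> 1 / 2" using N by simp
  finally have q: "1 / (real N)\<^sup>2 * real k ^ 4 \<le> 1 / 2" .
  have "\<alpha> [replicate k ()] \<le> 2 * sqrt 2 ^ length (replicate k ())"
    by (rule s.alpha_half_le[OF _ q]) simp_all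
  then show "\<alpha> [replicate (2 ^ Suc (j N)) ()] \<le> 2 * sqrt 2 ^ 2 ^ Suc (j N)"
    unfolding k_def[symmetric] by simp
next
  show "0 \<le> mtrace N (word_mat N (\<lambda>_. rotated_part c (gin N \<omega>)) (replicate (2 ^ Suc (j N)) ()))" for N \<omega>
    using mtrace_mpow_nonneg[OF adjoint_rotated_part, of N c "gin N \<omega>" "2 ^ j N"] by (simp only: mpow_def power_Suc)
  show "lin (lfH N c i j) \<omega> = rotated_part c (gin N \<omega>) i j" for N \<omega> and x :: unit and i j by (rule lin_lfH)
qed (use e in simp_all)

end

section \<open>Lower bound on the edge from a moment of fixed order\<close>

lemma ex_dominating_exponent:
  assumes "0 < t" "t < (s::real)"
  shows "\<exists>K. 2 * t ^ (2 * K) \<le> s ^ (2 * K) / (4 * (real K + 1)\<^sup>2)"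
proof -
  define x where "x = (t / s)\<^sup>2"
  have x: "0 < x" "x < 1" using assms by (auto simp: x_def power_less_one_iff)
  then have "(\<lambda>K. 8 * (real K + 1)\<^sup>2 * x ^ K) \<longlonglongrightarrow> 0" by real_asymp
  then have "\<forall>\<^sub>F K in sequentially. 8 * (real K + 1)\<^sup>2 * x ^ K < 1" by (rule order_tendstoD) simp
  then obtain K where K: "8 * (real K + 1)\<^sup>2 * x ^ K < 1" by (auto simp: eventually_sequentially)
  have "x ^ K = t ^ (2 * K) / s ^ (2 * K)" by (simp add: x_def power_divide flip: power_mult)
  then have "8 * (real K + 1)\<^sup>2 * t ^ (2 * K) \<le> s ^ (2 * K)" using K assms by (simp add: pos_divide_less_eq)
  then show ?thesis by (intro exI[of _ K]) (simp add: pos_le_divide_eq add_pos_pos mult_ac)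
qed

lemma ntrace_self_adjoint:
  assumes "adjoint_on N A A"
  shows "ntrace N A = of_real (Re (ntrace N A))"
proof -
  have "A i i = of_real (Re (A i i))" if "i < N" for i
  proof -
    have "A i i = cnj (A i i)" using assms that unfolding adjoint_on_def by blast
    from arg_cong[OF this, of Im] show ?thesis by (simp add: complex_eq_iff)
  qed
  then have "ntrace N A = (\<Sum>i<N. of_real (Re (A i i))) / of_nat N"
    unfolding ntrace_def by (intro arg_cong2[where f=divide] sum.cong) auto
  also have "\<dots> = of_real ((\<Sum>i<N. Re (A i i)) / real N)" by simp
  finally show ?thesis by (metis Re_complex_of_real)
qed

text \<open>Compares \<open>m\<close> with the moments of two point masses at \<open>sqrt 2\<close>
  and \<open>- sqrt 2\<close>: the even ones lose a polynomial factor, the odd ones cancel. With the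
  binomial weights the point masses give at least \<open>(2 + sqrt 2) ^ (2 * K)\<close>.\<close>

lemma semicircle_moment_sum_ge:
  assumes nn: "\<And>k. 0 \<le> m k" and ev: "\<And>k. k \<le> K \<Longrightarrow> 2 ^ k / (2 * (real k + 1)\<^sup>2) \<le> m (2 * k)"
  shows "(2 + sqrt 2) ^ (2 * K) / (4 * (real K + 1)\<^sup>2) \<le> (\<Sum>k\<le>2 * K. real (2 * K choose k) * 2 ^ (2 * K - k) * m k)"
proof -
  have le: "(sqrt 2 ^ k + (- sqrt 2) ^ k) / (4 * (real K + 1)\<^sup>2) \<le> m k" if "k \<le> 2 * K" for k
  proof (cases "even k")
    case True
    then obtain l where l: "k = 2 * l" by (auto elim: evenE)
    have "(sqrt 2 ^ k + (- sqrt 2) ^ k) / (4 * (real K + 1)\<^sup>2) = 2 ^ l / (2 * (real K + 1)\<^sup>2)"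
      unfolding l power_mult by simp
    also have "\<dots> \<le> 2 ^ l / (2 * (real l + 1)\<^sup>2)"
      using that by (intro divide_left_mono mult_left_mono power_mono mult_pos_pos zero_less_power) (auto simp: l)
    also have "\<dots> \<le> m k" unfolding l by (rule ev) (use that l in simp)
    finally show ?thesis .
  qed (use nn[of k] in simp)
  have "(2 + sqrt 2) ^ (2 * K) \<le> (sqrt 2 + 2) ^ (2 * K) + (- sqrt 2 + 2) ^ (2 * K)"
    by (simp add: add.commute zero_le_even_power)
  also have "\<dots> = (\<Sum>k\<le>2 * K. real (2 * K choose k) * 2 ^ (2 * K - k) * (sqrt 2 ^ k + (- sqrt 2) ^ k))"
    unfolding binomial_ring sum.distrib[symmetric] by (intro sum.cong refl) (simp add: algebra_simps)
  finally have "(2 + sqrt 2) ^ (2 * K) / (4 * (real K + 1)\<^sup>2) \<le>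
    (\<Sum>k\<le>2 * K. real (2 * K choose k) * 2 ^ (2 * K - k) * (sqrt 2 ^ k + (- sqrt 2) ^ k)) / (4 * (real K + 1)\<^sup>2)"
    by (rule divide_right_mono) simp
  also have "\<dots> = (\<Sum>k\<le>2 * K. real (2 * K choose k) * 2 ^ (2 * K - k) * ((sqrt 2 ^ k + (- sqrt 2) ^ k) / (4 * (real K + 1)\<^sup>2)))"
    by (simp add: sum_divide_distrib)
  also have "\<dots> \<le> (\<Sum>k\<le>2 * K. real (2 * K choose k) * 2 ^ (2 * K - k) * m k)"
    by (intro sum_mono mult_left_mono le) auto
  finally show ?thesis .
qed

context ginibre_space begin

text \<open>\<open>S\<close> is the normalised trace of the power \<open>2 * K\<close> of the
  shifted rotated part. Its mean is at least \<open>2 * t\<close> by the Catalan bound and its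
  variance is of order \<open>1 / N^2\<close>, so Chebyshev's inequality applies to a deviation of
  \<open>t\<close>.\<close>

lemma rotated_part_moment_sum_tail:
  fixes c K N
  defines "S \<equiv> \<lambda>\<omega>. \<Sum>k\<le>2 * K. real (2 * K choose k) * 2 ^ (2 * K - k) * Re (ntrace N (mpow N (rotated_part c (gin N \<omega>)) k))"
  assumes c: "cmod c = 1" and N: "0 < N" "2 * (4 * K) ^ 4 \<le> N"
    and t: "0 < t" "2 * t \<le> (2 + sqrt 2) ^ (2 * K) / (4 * (real K + 1)\<^sup>2)"
  shows "{\<omega> \<in> space M. S \<omega> \<le> t} \<in> sets M"
    and "prob {\<omega> \<in> space M. S \<omega> \<le> t} \<le> real (4 * K) ^ 2 * (2 * sqrt 2 ^ (4 * K)) * (3 ^ (2 * K))\<^sup>2 / t\<^sup>2 / real N ^ 2"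
proof -
  define b where "b k = real (2 * K choose k) * 2 ^ (2 * K - k)" for k
  define w where "w k = replicate k ()" for k
  define Y where "Y k \<omega> = Re (ntrace N (mpow N (rotated_part c (gin N \<omega>)) k))" for k \<omega>
  have Sb: "S \<omega> = (\<Sum>k\<le>2 * K. b k * Y k \<omega>)" for \<omega> by (simp add: S_def b_def Y_def)
  interpret g: gaussian_letters M Z N "\<lambda>_ _ :: unit. 1 / 2" "\<lambda>_. lfH N c" by (rule gaussian_letters_H[OF N(1) c])
  define \<alpha> where "\<alpha> = (\<lambda>ws. Re (\<integral>\<omega>. word_traces N (g.L \<omega>) ws \<partial>M))"
  interpret s: schwinger_dyson "\<lambda>_ _ :: unit. 1 / 2" "1 / real N ^ 2" \<alpha>
    unfolding \<alpha>_def by (rule g.schwinger_dyson_expectation)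
  have L: "g.L \<omega> = (\<lambda>_. rotated_part c (gin N \<omega>))" for \<omega> by (intro ext) (simp add: g.L_def lin_lfH)
  have T: "ntrace N (word_mat N (g.L \<omega>) (w k)) = of_real (Y k \<omega>)" for k \<omega>
    using ntrace_self_adjoint[OF adjoint_on_mpow[OF adjoint_rotated_part]] by (simp add: L w_def Y_def mpow_def)
  have i1: "integrable M (Y k)" and e1: "expectation (Y k) = \<alpha> [w k]" for k
  proof -
    have e: "Y k = (\<lambda>\<omega>. Re (word_traces N (g.L \<omega>) [w k]))" by (simp add: word_traces_def T fun_eq_iff)
    show "integrable M (Y k)" unfolding e by (intro integrable_Re g.integrable_traces)
    show "expectation (Y k) = \<alpha> [w k]" unfolding e \<alpha>_def by (simp add: integral_Re[OF g.integrable_traces])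
  qed
  have i2: "integrable M (\<lambda>\<omega>. Y k \<omega> * Y l \<omega>)" and e2: "expectation (\<lambda>\<omega>. Y k \<omega> * Y l \<omega>) = \<alpha> [w k, w l]" for k l
  proof -
    have e: "(\<lambda>\<omega>. Y k \<omega> * Y l \<omega>) = (\<lambda>\<omega>. Re (word_traces N (g.L \<omega>) [w k, w l]))" by (simp add: word_traces_def T fun_eq_iff)
    show "integrable M (\<lambda>\<omega>. Y k \<omega> * Y l \<omega>)" unfolding e by (intro integrable_Re g.integrable_traces)
    show "expectation (\<lambda>\<omega>. Y k \<omega> * Y l \<omega>) = \<alpha> [w k, w l]" unfolding e \<alpha>_def by (simp add: integral_Re[OF g.integrable_traces])
  qed
  have iS: "integrable M S" unfolding Sb[abs_def] by (intro Bochner_Integration.integrable_sum integrable_mult_right i1)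
  note [measurable] = borel_measurable_integrable[OF iS]
  show "{\<omega> \<in> space M. S \<omega> \<le> t} \<in> sets M" by measurable
  have eS: "expectation S = (\<Sum>k\<le>2 * K. b k * \<alpha> [w k])"
    unfolding Sb[abs_def] by (subst Bochner_Integration.integral_sum) (auto intro: i1 simp: e1)
  have S2: "(S \<omega>)\<^sup>2 = (\<Sum>k\<le>2 * K. \<Sum>l\<le>2 * K. b k * b l * (Y k \<omega> * Y l \<omega>))" for \<omega>
    unfolding Sb power2_eq_square sum_product by (intro sum.cong refl) simp
  have iS2: "integrable M (\<lambda>\<omega>. (S \<omega>)\<^sup>2)" unfolding S2 by (intro Bochner_Integration.integrable_sum integrable_mult_right i2)
  have eS2: "expectation (\<lambda>\<omega>. (S \<omega>)\<^sup>2) = (\<Sum>k\<le>2 * K. \<Sum>l\<le>2 * K. b k * b l * \<alpha> [w k, w l])"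
    unfolding S2 by (simp add: Bochner_Integration.integral_sum i2 e2)
  \<comment> \<open>The covariance bound for two words of length at most \<open>2 * K\<close> each,
    hence \<open>L = 4 * K\<close>.\<close>
  define d where "d = 1 / real N ^ 2 * (real (4 * K) ^ 2 * (2 * sqrt 2 ^ (4 * K)))"
  have b0: "0 \<le> b k" for k by (simp add: b_def)
  have q: "1 / real N ^ 2 * real (4 * K) ^ 4 \<le> 1 / 2"
  proof -
    have "2 * (4 * K) ^ 4 \<le> N * N" using N by (metis le_square le_trans)
    then have "real (2 * (4 * K) ^ 4) \<le> real (N * N)" by (rule of_nat_mono)
    then have "real (4 * K) ^ 4 \<le> (real N)\<^sup>2 / 2" by (simp add: power2_eq_square)
    then have "1 / real N ^ 2 * real (4 * K) ^ 4 \<le> 1 / real N ^ 2 * ((real N)\<^sup>2 / 2)" by (rule mult_left_mono) simp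
    then show ?thesis using N by simp
  qed
  have "expectation (\<lambda>\<omega>. (S \<omega>)\<^sup>2) \<le> (\<Sum>k\<le>2 * K. \<Sum>l\<le>2 * K. b k * b l * (\<alpha> [w k] * \<alpha> [w l] + d))"
    unfolding eS2 d_def
    by (intro sum_mono mult_left_mono s.alpha_half_pair_le[OF _ q] mult_nonneg_nonneg b0) (auto simp: w_def)
  also have "\<dots> = (expectation S)\<^sup>2 + d * (\<Sum>k\<le>2 * K. b k)\<^sup>2"
    unfolding eS power2_eq_square sum_product by (simp add: distrib_left sum.distrib sum_distrib_left mult_ac)
  also have "(\<Sum>k\<le>2 * K. b k) = 3 ^ (2 * K)"
    using binomial_ring[of 1 "2 :: real" "2 * K"] by (simp add: b_def)
  finally have var: "variance S \<le> d * (3 ^ (2 * K))\<^sup>2"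
    unfolding variance_eq[OF iS iS2] by simp
  have low: "2 * t \<le> expectation S"
  proof -
    have "2 ^ k / (2 * (real k + 1)\<^sup>2) \<le> \<alpha> [w (2 * k)]" for k
      using order.trans[OF stack_count_half_ge s.stack_count_le_alpha, of "w (2 * k)" k] by (simp add: w_def)
    then show ?thesis
      using order.trans[OF t(2) semicircle_moment_sum_ge[of "\<lambda>k. \<alpha> [w k]" K]] s.alpha_nonneg
      unfolding eS b_def by blast
  qed
  have "prob {\<omega> \<in> space M. S \<omega> \<le> t} \<le> prob {\<omega> \<in> space M. t \<le> \<bar>S \<omega> - expectation S\<bar>}"
    by (rule finite_measure_mono) (use low t in \<open>auto simp: abs_if\<close>)
  also have "\<dots> \<le> variance S / t\<^sup>2"
    by (rule Chebyshev_inequality) (use iS2 t in auto)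
  also have "\<dots> \<le> d * (3 ^ (2 * K))\<^sup>2 / t\<^sup>2" by (rule divide_right_mono[OF var]) simp
  also have "\<dots> = real (4 * K) ^ 2 * (2 * sqrt 2 ^ (4 * K)) * (3 ^ (2 * K))\<^sup>2 / t\<^sup>2 / real N ^ 2"
    by (simp add: d_def)
  finally show "prob {\<omega> \<in> space M. S \<omega> \<le> t} \<le> \<dots>" .
qed

text \<open>The order \<open>2 * K\<close> stays fixed as \<open>N\<close> grows; the second
  hypothesis says that \<open>K\<close> is large enough for the exponential gap between
  \<open>t\<close> and \<open>2 + sqrt 2\<close> to beat the polynomial loss.\<close>

lemma AE_shifted_trace:
  assumes c: "cmod c = 1" and t: "0 < t" "2 * t ^ (2 * K) \<le> (2 + sqrt 2) ^ (2 * K) / (4 * (real K + 1)\<^sup>2)"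
  shows "AE \<omega> in M. \<forall>\<^sub>F N in sequentially.
    real N * t ^ (2 * K) < mtrace N (mpow N (shifted (rotated_part c (gin N \<omega>))) (2 * K))"
proof -
  define S where "S N \<omega> = (\<Sum>k\<le>2 * K. real (2 * K choose k) * 2 ^ (2 * K - k) * Re (ntrace N (mpow N (rotated_part c (gin N \<omega>)) k)))" for N \<omega>
  define N0 where "N0 = 1 + 2 * (4 * K) ^ 4"
  have N0: "0 < N" "2 * (4 * K) ^ 4 \<le> N" if "N0 \<le> N" for N using that by (simp_all add: N0_def)
  have t': "0 < t ^ (2 * K)" using t by simp
  note tail = rotated_part_moment_sum_tail[OF c N0 t' t(2), folded S_def]
  have "AE \<omega> in M. \<forall>\<^sub>F N in sequentially. \<omega> \<notin> {\<omega> \<in> space M. S N \<omega> \<le> t ^ (2 * K)}"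
    by (rule AE_eventually_of_tail[OF tail])
  then show ?thesis
  proof (rule AE_mp, intro AE_I2 impI)
    fix \<omega> assume \<omega>: "\<omega> \<in> space M" "\<forall>\<^sub>F N in sequentially. \<omega> \<notin> {\<omega> \<in> space M. S N \<omega> \<le> t ^ (2 * K)}"
    from \<omega>(2) eventually_gt_at_top[of 0]
    show "\<forall>\<^sub>F N in sequentially. real N * t ^ (2 * K) < mtrace N (mpow N (shifted (rotated_part c (gin N \<omega>))) (2 * K))"
    proof eventually_elim
      case (elim N)
      then show ?case using \<omega>(1) by (simp add: mtrace_shifted S_def[symmetric] not_le)
    qed
  qed
qed

end

section \<open>Choice of parameters and conclusion\<close>

lemma word_mat_entries_cong:
  assumes "\<And>x i j. i < N \<Longrightarrow> j < N \<Longrightarrow> A x i j = B x i j"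
  shows "i < N \<Longrightarrow> word_mat N A w i j = word_mat N B w i j"
  by (induction w arbitrary: i) (auto intro!: sum.cong simp: assms)

lemma mtrace_word_mat_cong:
  "(\<And>x i j. i < N \<Longrightarrow> j < N \<Longrightarrow> A x i j = B x i j) \<Longrightarrow> mtrace N (word_mat N A w) = mtrace N (word_mat N B w)"
  by (intro mtrace_cong word_mat_entries_cong)

text \<open>As \<open>e\<close> tends to 0, both \<open>\<rho>\<close> and \<open>r'\<close> tend to
  \<open>sqrt 2\<close>, so \<open>1 - r' / \<rho>\<close> tends to 0. Meanwhile the series stays
  below a constant: 27/20 lies between 13/10 and \<open>sqrt 2\<close>, and once \<open>r'\<close>
  exceeds it the ratio is at most \<open>(13 / 10) / (27 / 20) = 26 / 27\<close>.\<close>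

lemma ex_criterion_parameters:
  assumes "0 < (\<epsilon> :: real)"
  obtains e \<rho> r r' where "0 < e" "e < 1" "\<rho> = (sqrt 2 + e) / (1 - e)" "\<rho> \<le> 2" "r = sqrt 2 - e - e * \<rho>"
    "13 / 10 < r'" "r' < r" "3 ^ 10 * (1 - r' / \<rho>) * (\<Sum>k. real k * ((13 / 10) / r') ^ k) \<le> \<epsilon>"
proof -
  define \<rho> r' where "\<rho> e = (sqrt 2 + e) / (1 - e)" and "r' e = sqrt 2 - e - e * \<rho> e - e" for e :: real
  define B where "B = (\<Sum>k. real k * (26 / 27 :: real) ^ k)"
  have t1: "(\<rho> \<longlongrightarrow> sqrt 2) (at_right 0)" unfolding \<rho>_def by (auto intro!: tendsto_eq_intros)
  have t2: "(r' \<longlongrightarrow> sqrt 2) (at_right 0)" unfolding r'_def by (auto intro!: tendsto_eq_intros t1)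
  have t3: "((\<lambda>e. 3 ^ 10 * \<bar>1 - r' e / \<rho> e\<bar> * B) \<longlongrightarrow> 0) (at_right 0)" by (auto intro!: tendsto_eq_intros t1 t2)
  have s2: "27 / 20 < sqrt 2" "sqrt 2 < 2"
    by (rule real_less_rsqrt, simp add: power2_eq_square, rule real_less_lsqrt, simp_all)
  have "\<forall>\<^sub>F e in at_right 0. 0 < e \<and> e < 1 \<and> \<rho> e < 2 \<and> 27 / 20 < r' e \<and> 3 ^ 10 * \<bar>1 - r' e / \<rho> e\<bar> * B < \<epsilon>"
    by (intro eventually_conj eventually_at_right_less order_tendstoD(2)[OF t1 s2(2)] order_tendstoD(1)[OF t2 s2(1)]
      order_tendstoD(2)[OF t3 assms] order_tendstoD(2)[OF tendsto_ident_at]) simp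
  then obtain e where e: "0 < e" "e < 1" "\<rho> e < 2" "27 / 20 < r' e" "3 ^ 10 * \<bar>1 - r' e / \<rho> e\<bar> * B < \<epsilon>"
    using eventually_happens'[OF trivial_limit_at_right_real] by blast
  have x: "0 \<le> 13 / 10 / r' e" "13 / 10 / r' e \<le> 26 / 27" using e by (auto simp: pos_divide_le_eq)
  have S: "(\<Sum>k. real k * ((13 / 10) / r' e) ^ k) \<le> B" "0 \<le> (\<Sum>k. real k * ((13 / 10) / r' e) ^ k)"
    unfolding B_def using x by (auto intro!: suminf_le suminf_nonneg summable_index_geometric mult_left_mono power_mono)
  have "3 ^ 10 * (1 - r' e / \<rho> e) * (\<Sum>k. real k * ((13 / 10) / r' e) ^ k) \<le> 3 ^ 10 * \<bar>1 - r' e / \<rho> e\<bar> * B"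
    by (rule mult_mono[OF mult_left_mono[OF abs_ge_self]]) (use S in simp_all)
  then show ?thesis using that[of e "\<rho> e" "sqrt 2 - e - e * \<rho> e" "r' e"] e by (simp add: \<rho>_def[symmetric] r'_def)
qed

lemma ex_finite_circle_net:
  assumes "0 < e"
  shows "\<exists>D. finite D \<and> (\<forall>c\<in>D. cmod c = 1) \<and> (\<forall>u. cmod u = 1 \<longrightarrow> (\<exists>c\<in>D. cmod (u - c) \<le> e))"
proof -
  obtain D where D: "D \<subseteq> sphere (0 :: complex) 1" "finite D" "sphere 0 1 \<subseteq> (\<Union>c\<in>D. ball c e)"
  proof (rule compactE_image[of "sphere (0 :: complex) 1" "sphere 0 1" "\<lambda>c. ball c e"])
    show "sphere (0 :: complex) 1 \<subseteq> (\<Union>c\<in>sphere 0 1. ball c e)" using assms by force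
  qed auto
  have "\<exists>c\<in>D. cmod (u - c) \<le> e" if "cmod u = 1" for u
  proof -
    have "u \<in> sphere 0 1" using that by simp
    then obtain c where "c \<in> D" "dist c u < e" using D(3) by auto
    then show ?thesis by (intro bexI[of _ c]) (auto simp: dist_norm norm_minus_commute)
  qed
  then show ?thesis using D by (intro exI[of _ D]) auto
qed

theorem (in ginibre_space) AE_spectral_constant_le:
  assumes \<epsilon>: "0 < \<epsilon>"
  shows "AE \<omega> in M. \<forall>\<^sub>F N in sequentially.
    spectral_constant (numerical_range (Matrix.mat N N (\<lambda>(i, j). gin N \<omega> i j))) (Matrix.mat N N (\<lambda>(i, j). gin N \<omega> i j)) \<le> ennreal (2 + \<epsilon>)"
proof -
  obtain e \<rho> r r' where e: "0 < e" "e < 1" and rho: "\<rho> = (sqrt 2 + e) / (1 - e)" "\<rho> \<le> 2" and r: "r = sqrt 2 - e - e * \<rho>"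
    and r': "13 / 10 < r'" "r' < r" and le: "3 ^ 10 * (1 - r' / \<rho>) * (\<Sum>k. real k * ((13 / 10) / r') ^ k) \<le> \<epsilon>"
    by (rule ex_criterion_parameters[OF \<epsilon>])
  obtain D where D: "finite D" "\<And>c. c \<in> D \<Longrightarrow> cmod c = 1" "\<And>u. cmod u = 1 \<Longrightarrow> \<exists>c\<in>D. cmod (u - c) \<le> e"
    using ex_finite_circle_net[OF e(1)] by blast
  obtain j :: "nat \<Rightarrow> nat" where j: "\<forall>N\<ge>16. (2 ^ Suc (j N)) ^ 4 \<le> N \<and> N < 16 * (2 ^ Suc (j N)) ^ 4"
    using ex_dyadic_exponent by blast
  have t: "0 < 2 + sqrt 2 - e" "2 + sqrt 2 - e < 2 + sqrt 2" using e real_sqrt_ge_zero[of 2] by linarith+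
  obtain K where K: "2 * (2 + sqrt 2 - e) ^ (2 * K) \<le> (2 + sqrt 2) ^ (2 * K) / (4 * (real K + 1)\<^sup>2)"
    using ex_dominating_exponent[OF t] by blast
  \<comment> \<open>The thresholds are strict: \<open>2^2 < 3^2\<close> for first powers, and
    \<open>11^2\<close> against the square of \<open>(13 / 10) ^ 10\<close> for tenth
    powers.\<close>
  have "AE \<omega> in M. \<forall>\<^sub>F N in sequentially.
    mtrace N (word_mat N (gletters (gin N \<omega>)) (concat (replicate (2 ^ Suc (j N)) (power_word 1)))) < (3\<^sup>2) ^ 2 ^ Suc (j N)"
    by (rule AE_power_word_trace[OF j]) simp
  moreover have "AE \<omega> in M. \<forall>\<^sub>F N in sequentially.
    mtrace N (word_mat N (gletters (gin N \<omega>)) (concat (replicate (2 ^ Suc (j N)) (power_word 10)))) < (((13 / 10) ^ 10)\<^sup>2) ^ 2 ^ Suc (j N)"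
    by (rule AE_power_word_trace[OF j]) (simp add: power2_eq_square power_divide)
  moreover have "AE \<omega> in M. \<forall>c\<in>D. \<forall>\<^sub>F N in sequentially.
    mtrace N (mpow N (rotated_part c (gin N \<omega>)) (2 ^ Suc (j N))) < (sqrt 2 + e) ^ 2 ^ Suc (j N)"
    using AE_rotated_part_trace[OF j e(1) D(2)] D(1) by (simp add: AE_ball_countable countable_finite)
  moreover have "AE \<omega> in M. \<forall>c\<in>D. \<forall>\<^sub>F N in sequentially.
    real N * (2 + sqrt 2 - e) ^ (2 * K) < mtrace N (mpow N (shifted (rotated_part c (gin N \<omega>))) (2 * K))"
    using AE_shifted_trace[OF D(2) t(1) K] D(1) by (simp add: AE_ball_countable countable_finite)
  ultimately show ?thesis
  proof eventually_elim
    case (elim \<omega>)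
    \<comment> \<open>Finiteness of the net lets one threshold on \<open>N\<close> serve all its
      directions.\<close>
    note V2 = elim(3)[folded eventually_ball_finite_distrib[OF D(1)]]
    note V3 = elim(4)[folded eventually_ball_finite_distrib[OF D(1)]]
    from elim(1,2) V2 V3 eventually_gt_at_top[of 0] show ?case
    proof eventually_elim
      case (elim N)
      define A where "A = Matrix.mat N N (\<lambda>(i, j). gin N \<omega> i j)"
      define a where "a = (\<lambda>i j. A $$ (i, j))"
      have A: "A \<in> carrier_mat N N" by (simp add: A_def)
      have a: "a i j = gin N \<omega> i j" if "i < N" "j < N" for i j using that by (simp add: a_def A_def)
      have "spectral_constant (numerical_range A) A \<le> ennreal (2 + 3 ^ 10 * (1 - r' / \<rho>) * (\<Sum>k. real k * ((13 / 10) / r') ^ k))"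
      proof (rule deterministic_criterion[OF A a_def elim(5) _ _ _ _ D(2,3) e rho r r'])
        have g: "mtrace N (word_mat N (gletters a) w) = mtrace N (word_mat N (gletters (gin N \<omega>)) w)" for w
          by (rule mtrace_word_mat_cong) (simp add: gletters_def a)
        show "mtrace N (word_mat N (gletters a) (concat (replicate (2 ^ Suc (j N)) (power_word 1)))) \<le> (3\<^sup>2) ^ 2 ^ Suc (j N)"
          unfolding g by (rule less_imp_le[OF elim(1)])
        show "mtrace N (word_mat N (gletters a) (concat (replicate (2 ^ Suc (j N)) (power_word 10)))) \<le> (((13 / 10) ^ 10)\<^sup>2) ^ 2 ^ Suc (j N)"
          unfolding g by (rule less_imp_le[OF elim(2)])
        fix c assume c: "c \<in> D"
        have "mtrace N (mpow N (rotated_part c a) k) = mtrace N (mpow N (rotated_part c (gin N \<omega>)) k)" for k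
          unfolding mpow_def by (rule mtrace_word_mat_cong) (simp add: rotated_part_def a)
        then show "mtrace N (mpow N (rotated_part c a) (2 ^ Suc (j N))) \<le> (sqrt 2 + e) ^ 2 ^ Suc (j N)"
          using elim(3) c by (metis less_imp_le)
        have "mtrace N (mpow N (shifted (rotated_part c a)) k) = mtrace N (mpow N (shifted (rotated_part c (gin N \<omega>))) k)" for k
          unfolding mpow_def by (rule mtrace_word_mat_cong) (simp add: shifted_def rotated_part_def a)
        then show "real N * (2 + sqrt 2 - e) ^ (2 * K) < mtrace N (mpow N (shifted (rotated_part c a)) (2 * K))"
          using elim(4) c by metis
      qed
      also have "\<dots> \<le> ennreal (2 + \<epsilon>)" using le by (intro ennreal_leI) simp
      finally show ?case unfolding A_def .
    qed
  qed
qed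

theorem theorem3p3:
  fixes M :: "'a measure" and X Y :: "nat \<Rightarrow> nat \<Rightarrow> 'a \<Rightarrow> real"
  assumes "prob_space M"
    and "\<And>i j. distributed M lborel (X i j) std_normal_density"
    and "\<And>i j. distributed M lborel (Y i j) std_normal_density"
    and "prob_space.indep_vars M (\<lambda>_. borel)
           (\<lambda>k. case k of Inl (i, j) \<Rightarrow> X i j | Inr (i, j) \<Rightarrow> Y i j)
           (UNIV :: (nat \<times> nat + nat \<times> nat) set)"
  shows "\<forall>\<epsilon>>0. AE \<omega> in M.
           (\<lambda>N. indicat_real {\<omega> \<in> space M.
              spectral_constant (numerical_range (ginibre X Y N \<omega>)) (ginibre X Y N \<omega>)
                < 2 + ennreal \<epsilon>} \<omega>) \<longlonglongrightarrow> 1"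
proof (intro allI impI)
  fix \<epsilon> :: real assume \<epsilon>: "0 < \<epsilon>"
  define Z :: "nat \<times> nat + nat \<times> nat \<Rightarrow> 'a \<Rightarrow> real" where "Z = (\<lambda>k. case k of Inl (i, j) \<Rightarrow> X i j | Inr (i, j) \<Rightarrow> Y i j)"
  interpret prob_space M by fact
  interpret ginibre_space M Z
  proof
    show "distributed M lborel (Z k) std_normal_density" for k
      using assms(2,3) by (auto simp: Z_def split: sum.split prod.split)
    show "indep_vars (\<lambda>_. borel) Z UNIV" unfolding Z_def by fact
  qed
  have G: "ginibre X Y N \<omega> = Matrix.mat N N (\<lambda>(i, j). gin N \<omega> i j)" for N \<omega>
    unfolding ginibre_def gin_def by (simp add: Z_def)
  \<comment> \<open>Half of \<open>\<epsilon>\<close> is kept back to turn the non-strict bound into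
    a strict one.\<close>
  have "ennreal (2 + \<epsilon> / 2) < ennreal (2 + \<epsilon>)" using \<epsilon> by (intro ennreal_lessI) auto
  also have "\<dots> = 2 + ennreal \<epsilon>" using \<epsilon> by (simp add: ennreal_plus)
  finally have lt: "ennreal (2 + \<epsilon> / 2) < 2 + ennreal \<epsilon>" .
  note ae = AE_spectral_constant_le[of "\<epsilon> / 2", folded G, OF half_gt_zero[OF \<epsilon>]]
  show "AE \<omega> in M. (\<lambda>N. indicat_real {\<omega> \<in> space M.
    spectral_constant (numerical_range (ginibre X Y N \<omega>)) (ginibre X Y N \<omega>) < 2 + ennreal \<epsilon>} \<omega>) \<longlonglongrightarrow> 1"
  proof (rule AE_mp[OF ae], intro AE_I2 impI)
    fix \<omega> assume \<omega>: "\<omega> \<in> space M" and ev: "\<forall>\<^sub>F N in sequentially.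
      spectral_constant (numerical_range (ginibre X Y N \<omega>)) (ginibre X Y N \<omega>) \<le> ennreal (2 + \<epsilon> / 2)"
    from ev have "\<forall>\<^sub>F N in sequentially. indicat_real {\<omega> \<in> space M.
      spectral_constant (numerical_range (ginibre X Y N \<omega>)) (ginibre X Y N \<omega>) < 2 + ennreal \<epsilon>} \<omega> = 1"
      by eventually_elim (use \<omega> lt in \<open>auto simp: indicator_def dest: le_less_trans\<close>)
    then show "(\<lambda>N. indicat_real {\<omega> \<in> space M.
      spectral_constant (numerical_range (ginibre X Y N \<omega>)) (ginibre X Y N \<omega>) < 2 + ennreal \<epsilon>} \<omega>) \<longlonglongrightarrow> 1"
      by (rule tendsto_eventually)
  qed
qed

end
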